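(* Let $\{X_\lambda\}_{\lambda\in\Lambda}$ be a family of real Banach spaces and let $\mathcal{U}$ be a countably incomplete ultrafilter over $\Lambda$. The following are equivalent: (1) The ultraproduct $(X_\lambda)_{\mathcal{U}}$ has the strong diameter two property (SD2P). (2) For every $n\in\mathbb{N}$ and every $\varepsilon,\delta>0$ there exists $m\in\mathbb{N}$ such that $$\{\lambda\in\Lambda: D_m^{n,\varepsilon}(X_\lambda)<\delta\}\in\mathcal{U}.$$ (3) For every $n\in\mathbb{N}$ and every $\varepsilon,\delta>0$ there exists $m\in\mathbb{N}$ such that $$\{\lambda\in\Lambda: D_m^{n,\varepsilon+}(X_\lambda)<\delta\}\in\mathcal{U}.$$
   Context: $B_X$ is the closed unit ball of $X$, and $\mathbb{N}=\{1,2,\dots\}$. A slice of $B_X$ is a set $S(B_X,f,\alpha)=\{x\in B_X: f(x)>\sup f(B_X)-\alpha\}$ with $f\in X^*$, $\alpha>0$. A convex combination of slices of $B_X$ is a set $\sum_{i=1}^n\lambda_iS_i=\{\sum_{i=1}^n\lambda_i x_i: x_i\in S_i\}$ with $n\in\mathbb{N}$, $\lambda_i>0$, $\sum_{i=1}^n\lambda_i=1$ and each $S_i$ a slice of $B_X$. $X$ has the strong diameter two property (SD2P) if every convex combination of slices of $B_X$ has diameter $2$. An ultrafilter $\mathcal{U}$ over $\Lambda$ is countably incomplete if there is a countable family of members of $\mathcal{U}$ with empty intersection. The ultraproduct is $(X_\lambda)_{\mathcal{U}}=\ell_\infty(\Lambda,X_\lambda)/c_{0,\mathcal{U}}(\Lambda,X_\lambda)$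 with the quotient norm, where $\ell_\infty(\Lambda,X_\lambda)=\{f\in\prod_{\lambda}X_\lambda:\sup_\lambda\|f(\lambda)\|<\infty\}$ (sup norm) and $c_{0,\mathcal{U}}(\Lambda,X_\lambda)=\{f\in\ell_\infty(\Lambda,X_\lambda):\lim_{\mathcal{U}}\|f(\lambda)\|=0\}$; its norm satisfies $\|[x_\lambda]\|_{\mathcal{U}}=\lim_{\mathcal{U}}\|x_\lambda\|$. $\ell_\infty^n(X)$ is $X^n$ with the norm $\|(z_1,\dots,z_n)\|_\infty=\max_i\|z_i\|$. For a set $C$, $\mathrm{co}_m(C)$ is the set of all convex combinations of at most $m$ elements of $C$. For $n,m\in\mathbb{N}$ and $\varepsilon,\alpha>0$ put $$C_m^{n,\varepsilon,\alpha}(X)=\mathrm{co}_m\left(\left\{z\in\ell_\infty^n(X):\|z\|_\infty\le\alpha,\ \frac1n\left\|\sum_{i=1}^n z_i\right\|>1-\varepsilon\right\}\right),$$ $$D_m^{n,\varepsilon,\alpha}(X)=\sup_{z\in B_{\ell_\infty^n(X)}}d\left(z,C_m^{n,\varepsilon,\alpha}(X)\right),$$ where $d$ is the distance in $\ell_\infty^n(X)$ (the distance to the empty set being $+\infty$). Write $D_m^{n,\varepsilon}(X)=D_m^{n,\varepsilon,1}(X)$ and $D_m^{n,\varepsilon+}(X)=D_m^{n,\varepsilon,1+\varepsilon}(X)$. *)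

theory Defs
  imports "HOL-Analysis.Analysis" "HOL-Algebra.AbelCoset" "HOL-Algebra.Module"
begin

section \<open>Real normed spaces on explicit carriers\<close>

text \<open>
  The members of the family \<open>(X\<^sub>i)\<close> may be unrelated spaces and the ultraproduct depends on the family
  and on the ultrafilter, so spaces are records over an explicit carrier: the modules
  of HOL-Algebra over the field of real numbers, extended by a norm.  The multiplicative fields
  \<open>mult\<close> and \<open>one\<close> inherited from the ring record are never used.
\<close>

definition real_ring :: "real ring" where
  "real_ring = \<lparr>carrier = UNIV, mult = (*), one = 1, zero = 0, add = (+)\<rparr>"

record 'a nspace = "(real, 'a) module" +
  vnorm :: "'a \<Rightarrow> real"

text \<open>
  The value outside the carrier is a dummy: the library locale \<open>Metric_space\<close> demands symmetry and
  nonnegativity for all elements of the type.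
\<close>

definition vdist :: "'a nspace \<Rightarrow> 'a \<Rightarrow> 'a \<Rightarrow> real" where
  "vdist V x y =
     (if x \<in> carrier V \<and> y \<in> carrier V then vnorm V (x \<ominus>\<^bsub>V\<^esub> y) else 0)"

locale real_normed_space = Module.module real_ring V for V :: "'a nspace" (structure) +
  assumes vnorm_eq_0_iff: "x \<in> carrier V \<Longrightarrow> vnorm V x = 0 \<longleftrightarrow> x = \<zero>"
    and vnorm_smult: "x \<in> carrier V \<Longrightarrow> vnorm V (r \<odot> x) = \<bar>r\<bar> * vnorm V x"
    and vnorm_triangle:
      "x \<in> carrier V \<Longrightarrow> y \<in> carrier V \<Longrightarrow> vnorm V (x \<oplus> y) \<le> vnorm V x + vnorm V y"

locale real_banach_space = real_normed_space +
  assumes complete: "Metric_space.mcomplete (carrier V) (vdist V)"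

context real_normed_space
begin

lemma smult_minus_one:
  assumes x: "x \<in> carrier V"
  shows "(- 1) \<odot> x = \<ominus> x"
proof -
  have "(1 + - 1 :: real) \<odot> x = 1 \<odot> x \<oplus> (- 1) \<odot> x"
    using smult_l_distr[of 1 "- 1" x] x by (simp add: real_ring_def)
  moreover have "(1::real) \<odot> x = x"
    using smult_one[of x] x by (simp add: real_ring_def)
  moreover have "(0::real) \<odot> x = \<zero>"
    using smult_l_null[of x] x by (simp add: real_ring_def)
  moreover have "(- 1) \<odot> x \<in> carrier V"
    using smult_closed[of "- 1" x] x by (simp add: real_ring_def)
  ultimately show ?thesis
    using x by (metis M.a_comm M.minus_equality add.right_inverse)
qed

lemma vnorm_uminus: "x \<in> carrier V \<Longrightarrow> vnorm V (\<ominus> x) = vnorm V x"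
  by (metis abs_minus_cancel abs_one mult_1 smult_minus_one vnorm_smult)

lemma vnorm_nonneg:
  assumes "x \<in> carrier V"
  shows "0 \<le> vnorm V x"
  using vnorm_triangle[of x "\<ominus> x"] vnorm_eq_0_iff[of \<zero>] assms
  by (simp add: vnorm_uminus M.r_neg)

lemma Metric_space_vdist: "Metric_space (carrier V) (vdist V)"
proof
  fix x y
  show "0 \<le> vdist V x y"
    by (simp add: vdist_def vnorm_nonneg)
  show "vdist V x y = vdist V y x"
    using vnorm_uminus[of "x \<ominus> y"]
    by (auto simp: vdist_def M.minus_eq M.minus_add M.a_comm)
next
  fix x y assume c: "x \<in> carrier V" "y \<in> carrier V"
  then have "x \<ominus> y = \<zero> \<longleftrightarrow> x = y"
    by (metis M.minus_closed M.minus_eq M.r_neg M.minus_equality M.minus_minus M.a_inv_closed)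
  then show "vdist V x y = 0 \<longleftrightarrow> x = y"
    using c by (simp add: vdist_def vnorm_eq_0_iff)
next
  fix x y z assume c: "x \<in> carrier V" "y \<in> carrier V" "z \<in> carrier V"
  then have "x \<ominus> z = (x \<ominus> y) \<oplus> (y \<ominus> z)"
    by (simp add: M.minus_eq M.a_assoc M.r_neg1)
  then show "vdist V x z \<le> vdist V x y + vdist V y z"
    using c vnorm_triangle[of "x \<ominus> y" "y \<ominus> z"] by (simp add: vdist_def)
qed

end

definition vball :: "'a nspace \<Rightarrow> 'a set" where
  "vball V = {x \<in> carrier V. vnorm V x \<le> 1}"

text \<open>
  Diameters and distances to sets take values in \<open>[0, \<infinity>]\<close>; thus the distance to the empty set
  is \<open>\<infinity>\<close>.
\<close>

definition vdiameter :: "'a nspace \<Rightarrow> 'a set \<Rightarrow> ennreal" where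
  "vdiameter V C = (SUP x\<in>C. SUP y\<in>C. ennreal (vdist V x y))"

definition vsetdist :: "'a nspace \<Rightarrow> 'a \<Rightarrow> 'a set \<Rightarrow> ennreal" where
  "vsetdist V x C = (INF y\<in>C. ennreal (vdist V x y))"

definition vdual :: "'a nspace \<Rightarrow> ('a \<Rightarrow> real) set" where
  "vdual V = {f.
     (\<forall>x\<in>carrier V. \<forall>y\<in>carrier V. f (x \<oplus>\<^bsub>V\<^esub> y) = f x + f y) \<and>
     (\<forall>r. \<forall>x\<in>carrier V. f (r \<odot>\<^bsub>V\<^esub> x) = r * f x) \<and>
     (\<exists>K. \<forall>x\<in>carrier V. \<bar>f x\<bar> \<le> K * vnorm V x)}"

definition co :: "'a nspace \<Rightarrow> nat \<Rightarrow> 'a set \<Rightarrow> 'a set" where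
  "co V m C = {(\<Oplus>\<^bsub>V\<^esub>j\<in>{1..k}. t j \<odot>\<^bsub>V\<^esub> x j) | k (t :: nat \<Rightarrow> real) x.
     k \<le> m \<and> (\<forall>j\<in>{1..k}. t j \<ge> 0 \<and> x j \<in> C) \<and> (\<Sum>j\<in>{1..k}. t j) = 1}"


section \<open>The strong diameter two property\<close>

definition slice :: "'a nspace \<Rightarrow> ('a \<Rightarrow> real) \<Rightarrow> real \<Rightarrow> 'a set" where
  "slice V f \<alpha> = {x \<in> vball V. f x > (SUP y\<in>vball V. f y) - \<alpha>}"

definition is_slice :: "'a nspace \<Rightarrow> 'a set \<Rightarrow> bool" where
  "is_slice V S \<longleftrightarrow> (\<exists>f\<in>vdual V. \<exists>\<alpha>>0. S = slice V f \<alpha>)"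

definition is_convex_combination_of_slices :: "'a nspace \<Rightarrow> 'a set \<Rightarrow> bool" where
  "is_convex_combination_of_slices V C \<longleftrightarrow>
     (\<exists>(n :: nat) (t :: nat \<Rightarrow> real) S.
        n \<ge> 1 \<and> (\<forall>i\<in>{1..n}. t i > 0 \<and> is_slice V (S i)) \<and> (\<Sum>i\<in>{1..n}. t i) = 1 \<and>
        C = {(\<Oplus>\<^bsub>V\<^esub>i\<in>{1..n}. t i \<odot>\<^bsub>V\<^esub> x i) | x. \<forall>i\<in>{1..n}. x i \<in> S i})"

definition SD2P :: "'a nspace \<Rightarrow> bool" where
  "SD2P V \<longleftrightarrow> (\<forall>C. is_convex_combination_of_slices V C \<longrightarrow> vdiameter V C = 2)"


section \<open>Sup-normed products and the ultraproduct\<close>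

text \<open>
  \<open>linf I X\<close> is \<open>\<ell>\<^sub>\<infinity>(I, X\<^sub>i)\<close>.  It also yields \<open>\<ell>\<^sub>\<infinity>\<^sup>n(V)\<close>, as \<open>linf {1..n} (\<lambda>_. V)\<close>: over a nonempty
  finite index set boundedness is automatic and the supremum is a maximum.
\<close>

definition linf :: "'i set \<Rightarrow> ('i \<Rightarrow> 'a nspace) \<Rightarrow> ('i \<Rightarrow> 'a) nspace" where
  "linf I X = \<lparr>
     carrier = {x \<in> (\<Pi>\<^sub>E i\<in>I. carrier (X i)). bdd_above ((\<lambda>i. vnorm (X i) (x i)) ` I)},
     mult = undefined,
     one = undefined,
     zero = (\<lambda>i\<in>I. \<zero>\<^bsub>X i\<^esub>),
     add = (\<lambda>x y. \<lambda>i\<in>I. x i \<oplus>\<^bsub>X i\<^esub> y i),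
     smult = (\<lambda>r x. \<lambda>i\<in>I. r \<odot>\<^bsub>X i\<^esub> x i),
     vnorm = (\<lambda>x. SUP i\<in>I. vnorm (X i) (x i))\<rparr>"

abbreviation linf_n :: "nat \<Rightarrow> 'a nspace \<Rightarrow> (nat \<Rightarrow> 'a) nspace" where
  "linf_n n V \<equiv> linf {1..n} (\<lambda>_. V)"

text \<open>Quotient of a normed space by a subspace \<open>N\<close>: the elements are the cosets of \<open>N\<close>.\<close>

definition vquotient :: "'a nspace \<Rightarrow> 'a set \<Rightarrow> 'a set nspace" where
  "vquotient V N = \<lparr>
     carrier = a_rcosets\<^bsub>V\<^esub> N,
     mult = undefined,
     one = undefined,
     zero = N,
     add = set_add V,
     smult = (\<lambda>r A. \<Union>x\<in>A. N +>\<^bsub>V\<^esub> (r \<odot>\<^bsub>V\<^esub> x)),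
     vnorm = (\<lambda>A. INF x\<in>A. vnorm V x)\<rparr>"

text \<open>
  Ultrafilters over the index set (the type \<open>'i\<close>) are library filters; a set \<open>A\<close> is a member of \<open>U\<close>
  iff \<open>eventually (\<lambda>i. i \<in> A) U\<close>.
\<close>

definition ultrafilter :: "'i filter \<Rightarrow> bool" where
  "ultrafilter U \<longleftrightarrow>
     U \<noteq> bot \<and> (\<forall>P. eventually P U \<or> eventually (\<lambda>i. \<not> P i) U)"

definition countably_incomplete :: "'i filter \<Rightarrow> bool" where
  "countably_incomplete U \<longleftrightarrow>
     (\<exists>F :: 'i set set. countable F \<and> (\<forall>A\<in>F. eventually (\<lambda>i. i \<in> A) U) \<and> \<Inter>F = {})"

definition c0 :: "'i filter \<Rightarrow> ('i \<Rightarrow> 'a nspace) \<Rightarrow> ('i \<Rightarrow> 'a) set" where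
  "c0 U X = {x \<in> carrier (linf UNIV X). ((\<lambda>i. vnorm (X i) (x i)) \<longlongrightarrow> 0) U}"

definition ultraproduct :: "'i filter \<Rightarrow> ('i \<Rightarrow> 'a nspace) \<Rightarrow> ('i \<Rightarrow> 'a) set nspace" where
  "ultraproduct U X = vquotient (linf UNIV X) (c0 U X)"


section \<open>The quantities C and D\<close>

definition Cset :: "nat \<Rightarrow> nat \<Rightarrow> real \<Rightarrow> real \<Rightarrow> 'a nspace \<Rightarrow> (nat \<Rightarrow> 'a) set" where
  "Cset m n \<epsilon> \<alpha> V = co (linf_n n V) m
     {z \<in> carrier (linf_n n V). vnorm (linf_n n V) z \<le> \<alpha> \<and>
        1 / real n * vnorm V (\<Oplus>\<^bsub>V\<^esub>i\<in>{1..n}. z i) > 1 - \<epsilon>}"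

definition Dgen :: "nat \<Rightarrow> nat \<Rightarrow> real \<Rightarrow> real \<Rightarrow> 'a nspace \<Rightarrow> ennreal" where
  "Dgen m n \<epsilon> \<alpha> V =
     (SUP z\<in>vball (linf_n n V). vsetdist (linf_n n V) z (Cset m n \<epsilon> \<alpha> V))"

abbreviation D :: "nat \<Rightarrow> nat \<Rightarrow> real \<Rightarrow> 'a nspace \<Rightarrow> ennreal" where
  "D m n \<epsilon> V \<equiv> Dgen m n \<epsilon> 1 V"

abbreviation Dplus :: "nat \<Rightarrow> nat \<Rightarrow> real \<Rightarrow> 'a nspace \<Rightarrow> ennreal" where
  "Dplus m n \<epsilon> V \<equiv> Dgen m n \<epsilon> (1 + \<epsilon>) V"

end

theory Submission
  imports Defs
begin

text \<open>
  Call a tuple in \<open>\<ell>\<^sub>\<infinity>\<^sup>n(V)\<close> large if its mean has norm greater than \<open>1 - \<epsilon>\<close>.  A normed space \<open>V\<close> has the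
  SD2P iff, for all \<open>n\<close> and \<open>\<epsilon>\<close>, the convex hull of the large tuples is dense in the unit ball of
  \<open>\<ell>\<^sub>\<infinity>\<^sup>n(V)\<close>: a point outside the closed hull is separated from it by a functional \<open>(f\<^sub>1, \<dots>, f\<^sub>n)\<close>, whose
  coordinates define slices with a mean of small diameter; conversely, a large tuple on which such a
  functional is almost maximal has its coordinates in prescribed slices.  Allowing tuples of norm
  \<open>1 + \<epsilon>\<close> changes nothing, by rescaling.

  For the ultraproduct, \<open>D\<^sub>m < \<delta>\<close> along the ultrafilter yields approximations by \<open>m\<close> large tuples in the
  fibres, and since \<open>m\<close> is fixed the coefficients converge along the ultrafilter.  If instead
  \<open>D\<^sub>m \<ge> \<delta>\<close> along the ultrafilter for every \<open>m\<close>, countable incompleteness gives decreasing members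
  \<open>E\<^sub>m\<close> with empty intersection on which this holds, and choosing badly approximable points
  diagonally on \<open>E\<^sub>m - E\<^sub>m\<^sub>+\<^sub>1\<close> produces a point of the ultraproduct that no finite convex combination
  approximates.
\<close>

text \<open>The SD2P quantifies over functionals, and the dual of an ultraproduct can be larger than
  the ultraproduct of the duals, so slices of the ultraproduct need not come from slices in the
  fibres. Density of a convex hull involves only norms and finite sums, which pass to limits along
  the ultrafilter as long as the number of terms is the same in all fibres. That is the role of m:
  in a single space the number of terms may depend on the approximated point, and a bound on
  \<open>D\<close> or \<open>Dplus\<close> makes it uniform.

  A diameter involves two points of each of n slices, while a large tuple only has a mean of norm
  near 1. Recovering the SD2P therefore uses tuples of length 2n: the coordinates come in pairs x,
  -y with x and y meant for the same slice, and a mean of norm near 1 says that the n differences x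
  - y add up to a vector of norm near 2n. In the other direction one point of a mean of slices is
  enough, since two points of the unit ball at distance near 2 both have norm near 1.\<close>

lemma cring_real_ring: "cring real_ring"
  by (intro cringI abelian_groupI comm_monoidI)
    (auto simp: real_ring_def algebra_simps intro: exI[of _ "- x" for x])

lemma real_normed_spaceI:
  fixes V :: "'a nspace" (structure)
  assumes "abelian_group V"
    and "\<And>r x. x \<in> carrier V \<Longrightarrow> r \<odot> x \<in> carrier V"
    and "\<And>r s x. x \<in> carrier V \<Longrightarrow> (r + s) \<odot> x = r \<odot> x \<oplus> s \<odot> x"
    and "\<And>r x y. x \<in> carrier V \<Longrightarrow> y \<in> carrier V \<Longrightarrow> r \<odot> (x \<oplus> y) = r \<odot> x \<oplus> r \<odot> y"
    and "\<And>r s x. x \<in> carrier V \<Longrightarrow> (r * s) \<odot> x = r \<odot> (s \<odot> x)"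
    and "\<And>x. x \<in> carrier V \<Longrightarrow> 1 \<odot> x = x"
    and "\<And>x. x \<in> carrier V \<Longrightarrow> vnorm V x = 0 \<longleftrightarrow> x = \<zero>"
    and "\<And>r x. x \<in> carrier V \<Longrightarrow> vnorm V (r \<odot> x) = \<bar>r\<bar> * vnorm V x"
    and "\<And>x y. x \<in> carrier V \<Longrightarrow> y \<in> carrier V \<Longrightarrow> vnorm V (x \<oplus> y) \<le> vnorm V x + vnorm V y"
  shows "real_normed_space V"
proof (rule real_normed_space.intro)
  show "Module.module real_ring V"
    by (rule moduleI) (use assms cring_real_ring in \<open>auto simp: real_ring_def\<close>)
  show "real_normed_space_axioms V"
    by (rule real_normed_space_axioms.intro) (use assms in auto)
qed

text \<open>Separate from \<open>finsum_additive\<close> because functionals take values in the type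
  \<open>real\<close> with its own \<open>sum\<close>, not in a group record.\<close>

lemma (in abelian_group) finsum_additive_real:
  fixes f :: "'a \<Rightarrow> real"
  assumes f: "\<And>x y. x \<in> carrier G \<Longrightarrow> y \<in> carrier G \<Longrightarrow> f (x \<oplus> y) = f x + f y"
    and "finite A" "g \<in> A \<rightarrow> carrier G"
  shows "f (finsum G g A) = (\<Sum>a\<in>A. f (g a))"
proof -
  have zero: "f \<zero> = 0"
    using f[of \<zero> \<zero>] by simp
  show ?thesis
    using \<open>finite A\<close> \<open>g \<in> A \<rightarrow> carrier G\<close>
    by (induction A rule: finite_induct) (auto simp: f zero Pi_def)
qed

lemma finsum_additive:
  assumes "abelian_group G" "abelian_group H"
    and hom: "\<And>x. x \<in> carrier G \<Longrightarrow> h x \<in> carrier H"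
      "\<And>x y. x \<in> carrier G \<Longrightarrow> y \<in> carrier G \<Longrightarrow> h (x \<oplus>\<^bsub>G\<^esub> y) = h x \<oplus>\<^bsub>H\<^esub> h y"
    and "finite A" "g \<in> A \<rightarrow> carrier G"
  shows "h (finsum G g A) = (\<Oplus>\<^bsub>H\<^esub>a\<in>A. h (g a))"
proof -
  interpret G: abelian_group G by fact
  interpret H: abelian_group H by fact
  have zero: "h \<zero>\<^bsub>G\<^esub> = \<zero>\<^bsub>H\<^esub>"
    using hom(2)[of "\<zero>\<^bsub>G\<^esub>" "\<zero>\<^bsub>G\<^esub>"] hom(1)[of "\<zero>\<^bsub>G\<^esub>"]
    by (metis G.l_zero G.zero_closed H.add.r_cancel_one')
  show ?thesis
    using \<open>finite A\<close> \<open>g \<in> A \<rightarrow> carrier G\<close>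
    by (induction A rule: finite_induct) (auto simp: hom zero Pi_def)
qed

section \<open>Elementary rules for scalars, finite sums and norms\<close>

context real_normed_space
begin

lemma scale_closed [simp, intro]: "x \<in> carrier V \<Longrightarrow> r \<odot> x \<in> carrier V"
  using smult_closed[of r x] by (simp add: real_ring_def)

lemma scale_left_distrib: "x \<in> carrier V \<Longrightarrow> (r + s) \<odot> x = r \<odot> x \<oplus> s \<odot> x"
  using smult_l_distr[of r s x] by (simp add: real_ring_def)

lemma scale_right_distrib:
  "x \<in> carrier V \<Longrightarrow> y \<in> carrier V \<Longrightarrow> r \<odot> (x \<oplus> y) = r \<odot> x \<oplus> r \<odot> y"
  using smult_r_distr[of r x y] by (simp add: real_ring_def)

lemma scale_scale: "x \<in> carrier V \<Longrightarrow> r \<odot> (s \<odot> x) = (r * s) \<odot> x"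
  using smult_assoc1[of r s x] by (simp add: real_ring_def)

lemma scale_one [simp]: "x \<in> carrier V \<Longrightarrow> 1 \<odot> x = x"
  using smult_one[of x] by (simp add: real_ring_def)

lemma scale_zero_left [simp]: "x \<in> carrier V \<Longrightarrow> 0 \<odot> x = \<zero>"
  using smult_l_null[of x] by (simp add: real_ring_def)

lemma scale_zero_right [simp]: "r \<odot> \<zero> = \<zero>"
  using smult_r_null[of r] by (simp add: real_ring_def)

lemma scale_uminus: "x \<in> carrier V \<Longrightarrow> r \<odot> (\<ominus> x) = \<ominus> (r \<odot> x)"
  using smult_r_minus[of r x] by (simp add: real_ring_def)

lemma scale_finsum:
  assumes "finite A" "g \<in> A \<rightarrow> carrier V"
  shows "r \<odot> finsum V g A = (\<Oplus>a\<in>A. r \<odot> g a)"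
  by (rule finsum_additive[OF M.abelian_group_axioms M.abelian_group_axioms])
    (use assms in \<open>auto simp: scale_right_distrib\<close>)

lemma minus_zero [simp]: "\<ominus> \<zero> = \<zero>"
  by (metis M.minus_equality M.l_zero M.zero_closed)

lemma vnorm_zero [simp]: "vnorm V \<zero> = 0"
  by (simp add: vnorm_eq_0_iff)

lemma vnorm_finsum_le:
  assumes "finite A" "g \<in> A \<rightarrow> carrier V"
  shows "vnorm V (finsum V g A) \<le> (\<Sum>a\<in>A. vnorm V (g a))"
  using assms
proof (induction A rule: finite_induct)
  case (insert a A)
  then have "vnorm V (finsum V g (insert a A)) \<le> vnorm V (g a) + vnorm V (finsum V g A)"
    by (auto simp: Pi_def intro!: vnorm_triangle)
  with insert show ?case
    by (auto simp: Pi_def)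
qed auto

lemma vnorm_minus_le:
  assumes "x \<in> carrier V" "y \<in> carrier V"
  shows "vnorm V (x \<ominus> y) \<le> vnorm V x + vnorm V y"
  using vnorm_triangle[of x "\<ominus> y"] assms by (simp add: vnorm_uminus M.minus_eq)

lemma vnorm_triangle_sub:
  assumes "x \<in> carrier V" "y \<in> carrier V"
  shows "vnorm V x \<le> vnorm V y + vnorm V (x \<ominus> y)"
proof -
  have "x = y \<oplus> (x \<ominus> y)"
    using assms by (metis M.a_comm M.a_inv_closed M.minus_eq M.r_neg1 M.a_closed M.a_lcomm M.r_neg M.r_zero)
  then show ?thesis
    using vnorm_triangle[of y "x \<ominus> y"] assms by (metis M.minus_closed)
qed

lemma minus_finsum:
  assumes "finite A" "g \<in> A \<rightarrow> carrier V" "h \<in> A \<rightarrow> carrier V"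
  shows "finsum V g A \<ominus> finsum V h A = (\<Oplus>a\<in>A. g a \<ominus> h a)"
proof -
  have "\<ominus> finsum V h A = (\<Oplus>a\<in>A. \<ominus> h a)"
    by (rule finsum_additive[OF M.abelian_group_axioms M.abelian_group_axioms])
      (use assms in \<open>auto simp: M.minus_add M.a_comm\<close>)
  then show ?thesis
    using assms by (auto simp: M.minus_eq Pi_def intro!: M.finsum_addf[symmetric])
qed

lemma zero_in_vball [simp]: "\<zero> \<in> vball V"
  by (simp add: vball_def)

end

section \<open>The Hahn-Banach theorem\<close>

definition sublinear :: "'a nspace \<Rightarrow> ('a \<Rightarrow> real) \<Rightarrow> bool" where
  "sublinear V p \<longleftrightarrow>
     (\<forall>x\<in>carrier V. \<forall>y\<in>carrier V. p (x \<oplus>\<^bsub>V\<^esub> y) \<le> p x + p y) \<and>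
     (\<forall>r\<ge>0. \<forall>x\<in>carrier V. p (r \<odot>\<^bsub>V\<^esub> x) = r * p x)"

definition vconvex :: "'a nspace \<Rightarrow> 'a set \<Rightarrow> bool" where
  "vconvex V K \<longleftrightarrow>
     (\<forall>x\<in>K. \<forall>y\<in>K. \<forall>a\<ge>0. \<forall>b\<ge>0. a + b = 1 \<longrightarrow> a \<odot>\<^bsub>V\<^esub> x \<oplus>\<^bsub>V\<^esub> b \<odot>\<^bsub>V\<^esub> y \<in> K)"

context real_normed_space
begin

lemma sublinear_vnorm: "sublinear V (vnorm V)"
  by (simp add: sublinear_def vnorm_triangle vnorm_smult)

text \<open>This lower bound keeps every infimum formed below finite, both over a cone and over a
  chain.\<close>

lemma sublinear_ge_uminus:
  assumes "sublinear V p" "x \<in> carrier V" "y \<in> carrier V"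
  shows "p y - p (\<ominus> x) \<le> p (x \<oplus> y)"
proof -
  have "y = \<ominus> x \<oplus> (x \<oplus> y)"
    using assms by (simp add: M.r_neg1)
  then have "p y \<le> p (\<ominus> x) + p (x \<oplus> y)"
    using assms unfolding sublinear_def by (metis M.a_closed M.a_inv_closed)
  then show ?thesis by simp
qed

lemma sublinear_zero: "sublinear V p \<Longrightarrow> p \<zero> = 0"
  unfolding sublinear_def by (metis M.zero_closed mult_zero_left order_refl scale_zero_right)

text \<open>Applying the one-sided estimate to \<open>inverse r\<close> gives its converse.
  Functionals defined as infima are naturally estimated from above only, which is why this form is
  convenient.\<close>

lemma sublinearI:
  assumes add: "\<And>x y. x \<in> carrier V \<Longrightarrow> y \<in> carrier V \<Longrightarrow> p (x \<oplus> y) \<le> p x + p y"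
    and zero: "p \<zero> = 0"
    and scale: "\<And>r x. 0 < r \<Longrightarrow> x \<in> carrier V \<Longrightarrow> p (r \<odot> x) \<le> r * p x"
  shows "sublinear V p"
  unfolding sublinear_def
proof (intro conjI ballI allI impI)
  fix r :: real and x assume r: "0 \<le> r" and x: "x \<in> carrier V"
  show "p (r \<odot> x) = r * p x"
  proof (cases "r = 0")
    case False
    then have "p x \<le> inverse r * p (r \<odot> x)"
      using scale[of "inverse r" "r \<odot> x"] r x by (simp add: scale_scale)
    then have "r * p x \<le> p (r \<odot> x)"
      using False r by (simp add: field_simps)
    then show ?thesis
      using scale[of r x] False r x by simp
  qed (use x zero in simp)
qed (use add in auto)

text \<open>
  Used twice: with \<open>K\<close> the convex set to be bounded below, and with a singleton \<open>K = {y}\<close>, \<open>c = p y\<close>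
  to see that a minimal sublinear functional is additive.
\<close>

definition lower_functional :: "('a \<Rightarrow> real) \<Rightarrow> 'a set \<Rightarrow> real \<Rightarrow> 'a \<Rightarrow> real" where
  "lower_functional p K c x = (INF (t, k)\<in>{0..} \<times> K. p (x \<oplus> t \<odot> k) - t * c)"

context
  fixes p K and c :: real
  assumes p: "sublinear V p" and K: "K \<subseteq> carrier V" "vconvex V K" "K \<noteq> {}"
    and c: "\<And>k. k \<in> K \<Longrightarrow> c \<le> p k"
begin

text \<open>The hypothesis \<open>c \<le> p k\<close> enters here: it gives
  \<open>t * c \<le> p (t \<odot> k)\<close>, so the bound is independent of \<open>t\<close> and
  \<open>k\<close> and the infimum is finite.\<close>

lemma lower_functional_bound:
  assumes "x \<in> carrier V" "k \<in> K" "0 \<le> t"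
  shows "- p (\<ominus> x) \<le> p (x \<oplus> t \<odot> k) - t * c"
proof -
  have k: "k \<in> carrier V"
    using assms K by auto
  have "t * c \<le> t * p k"
    using assms c by (simp add: mult_left_mono)
  also have "\<dots> = p (t \<odot> k)"
    using p k assms by (simp add: sublinear_def)
  finally show ?thesis
    using sublinear_ge_uminus[OF p assms(1), of "t \<odot> k"] k by simp
qed

lemma lower_functional_le:
  assumes "x \<in> carrier V" "k \<in> K" "0 \<le> t"
  shows "lower_functional p K c x \<le> p (x \<oplus> t \<odot> k) - t * c"
proof -
  have "bdd_below ((\<lambda>(t, k). p (x \<oplus> t \<odot> k) - t * c) ` ({0..} \<times> K))"
    using lower_functional_bound[OF assms(1)] by (intro bdd_belowI2[where m = "- p (\<ominus> x)"]) auto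
  then show ?thesis
    unfolding lower_functional_def using assms by (intro cINF_lower2[where x = "(t, k)"]) auto
qed

lemma lower_functional_greatest:
  assumes "\<And>t k. 0 \<le> t \<Longrightarrow> k \<in> K \<Longrightarrow> b \<le> p (x \<oplus> t \<odot> k) - t * c"
  shows "b \<le> lower_functional p K c x"
  unfolding lower_functional_def using assms K by (intro cINF_greatest) auto

lemma lower_functional_le_self: "x \<in> carrier V \<Longrightarrow> lower_functional p K c x \<le> p x"
  using lower_functional_le[of x _ 0] K by fastforce

text \<open>The value at \<open>t = 1\<close> is \<open>p \<zero> - c\<close>. An additive
  functional below \<open>lower_functional\<close> thus satisfies
  \<open>f (\<ominus> k) \<le> - c\<close>, that is \<open>c \<le> f k\<close>.\<close>

lemma lower_functional_uminus:
  assumes "k \<in> K"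
  shows "lower_functional p K c (\<ominus> k) \<le> - c"
  using lower_functional_le[of "\<ominus> k" k 1] sublinear_zero[OF p] K assms
  by (auto simp: M.l_neg subset_iff)

text \<open>Subadditivity rests on convexity of \<open>K\<close>: the cone generated by
  \<open>K\<close> is closed under addition, so the terms for \<open>x\<close> and for
  \<open>y\<close> merge into one term for \<open>x \<oplus> y\<close>.\<close>

lemma sublinear_lower_functional: "sublinear V (lower_functional p K c)"
proof (rule sublinearI)
  fix x y assume x: "x \<in> carrier V" and y: "y \<in> carrier V"
  have key: "lower_functional p K c (x \<oplus> y) \<le> (p (x \<oplus> t \<odot> k) - t * c) + (p (y \<oplus> s \<odot> l) - s * c)"
    if t: "0 \<le> t" "k \<in> K" and s: "0 \<le> s" "l \<in> K" for t k s l
  proof -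
    have kl: "k \<in> carrier V" "l \<in> carrier V"
      using that K by auto
    \<comment> \<open>For \<open>t + s > 0\<close> the point is the convex combination with weights
      \<open>t / (t + s)\<close> and \<open>s / (t + s)\<close>; when both scalars vanish any point
      of \<open>K\<close> will do.\<close>
    obtain m where m: "m \<in> K" "(t + s) \<odot> m = t \<odot> k \<oplus> s \<odot> l"
    proof (cases "t + s = 0")
      case True
      then have "t = 0" "s = 0"
        using t s by auto
      then show ?thesis
        using that[of k] kl t by simp
    next
      case False
      let ?m = "(t / (t + s)) \<odot> k \<oplus> (s / (t + s)) \<odot> l"
      have "?m \<in> K"
        using K(2) t s False unfolding vconvex_def by (simp add: add_divide_distrib[symmetric])
      moreover have "(t + s) \<odot> ?m = t \<odot> k \<oplus> s \<odot> l"
        using kl False by (simp add: scale_right_distrib scale_scale)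
      ultimately show ?thesis
        using that by blast
    qed
    have "lower_functional p K c (x \<oplus> y) \<le> p ((x \<oplus> y) \<oplus> (t + s) \<odot> m) - (t + s) * c"
      using x y t s m by (intro lower_functional_le) auto
    also have "(x \<oplus> y) \<oplus> (t + s) \<odot> m = (x \<oplus> t \<odot> k) \<oplus> (y \<oplus> s \<odot> l)"
      using x y kl m by (simp add: M.a_ac)
    also have "p \<dots> \<le> p (x \<oplus> t \<odot> k) + p (y \<oplus> s \<odot> l)"
      using p x y kl unfolding sublinear_def by auto
    finally show ?thesis by (simp add: algebra_simps)
  qed
  \<comment> \<open>The infimum of the sum is split by freezing the term for \<open>y\<close> while
    passing to the infimum for \<open>x\<close>, and only then varying the term for
    \<open>y\<close>.\<close>
  have "lower_functional p K c (x \<oplus> y) - lower_functional p K c x \<le> lower_functional p K c y"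
  proof (rule lower_functional_greatest)
    fix s l assume sl: "(0::real) \<le> s" "l \<in> K"
    have "lower_functional p K c (x \<oplus> y) - (p (y \<oplus> s \<odot> l) - s * c) \<le> lower_functional p K c x"
      by (rule lower_functional_greatest) (use key sl in \<open>fastforce simp: algebra_simps\<close>)
    then show "lower_functional p K c (x \<oplus> y) - lower_functional p K c x \<le> p (y \<oplus> s \<odot> l) - s * c"
      by simp
  qed
  then show "lower_functional p K c (x \<oplus> y) \<le> lower_functional p K c x + lower_functional p K c y"
    by simp
next
  have "- p (\<ominus> \<zero>) \<le> lower_functional p K c \<zero>"
    by (intro lower_functional_greatest lower_functional_bound) auto
  then show "lower_functional p K c \<zero> = 0"
    using lower_functional_le_self[of \<zero>] sublinear_zero[OF p] by simp
next
  fix r :: real and x assume r: "0 < r" and x: "x \<in> carrier V"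
  have "lower_functional p K c (r \<odot> x) / r \<le> lower_functional p K c x"
  proof (rule lower_functional_greatest)
    fix t k assume tk: "(0::real) \<le> t" "k \<in> K"
    then have k: "k \<in> carrier V"
      using K by auto
    have "lower_functional p K c (r \<odot> x) \<le> p (r \<odot> x \<oplus> (r * t) \<odot> k) - (r * t) * c"
      using r x tk by (intro lower_functional_le) auto
    also have "r \<odot> x \<oplus> (r * t) \<odot> k = r \<odot> (x \<oplus> t \<odot> k)"
      using x k by (simp add: scale_right_distrib scale_scale)
    also have "p \<dots> = r * p (x \<oplus> t \<odot> k)"
      using p x k r unfolding sublinear_def by auto
    finally show "lower_functional p K c (r \<odot> x) / r \<le> p (x \<oplus> t \<odot> k) - t * c"
      using r by (simp add: field_simps)
  qed
  then show "lower_functional p K c (r \<odot> x) \<le> r * lower_functional p K c x"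
    using r by (simp add: field_simps)
qed

end

text \<open>Infima of sublinear functionals are not subadditive in general. In a chain, of any two
  members one is below the other, so a single \<open>r\<close> serves for both \<open>x\<close> and
  \<open>y\<close>.\<close>

lemma sublinear_chain_Inf:
  assumes "C \<noteq> {}" and sub: "\<And>p. p \<in> C \<Longrightarrow> sublinear V p"
    and chain: "\<And>p q. p \<in> C \<Longrightarrow> q \<in> C \<Longrightarrow>
      (\<forall>x\<in>carrier V. p x \<le> q x) \<or> (\<forall>x\<in>carrier V. q x \<le> p x)"
    and bd: "\<And>p x. p \<in> C \<Longrightarrow> x \<in> carrier V \<Longrightarrow> p x \<le> b x"
  shows "sublinear V (\<lambda>x. INF p\<in>C. p x)"
    and "\<And>p x. p \<in> C \<Longrightarrow> x \<in> carrier V \<Longrightarrow> (INF p\<in>C. p x) \<le> p x"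
proof -
  have low: "(INF p\<in>C. p x) \<le> p x" if p: "p \<in> C" and x: "x \<in> carrier V" for p x
  proof (rule cINF_lower[OF _ p])
    show "bdd_below ((\<lambda>p. p x) ` C)"
    proof (rule bdd_belowI2)
      fix p assume "p \<in> C"
      then show "- b (\<ominus> x) \<le> p x"
        using sublinear_ge_uminus[OF sub x, of p \<zero>] sublinear_zero[OF sub, of p]
          bd[of p "\<ominus> x"] x by force
    qed
  qed
  show "(INF p\<in>C. p x) \<le> p x" if "p \<in> C" "x \<in> carrier V" for p x
    using low that .
  let ?u = "\<lambda>x. INF p\<in>C. p x"
  show "sublinear V ?u"
  proof (rule sublinearI)
    fix x y assume x: "x \<in> carrier V" and y: "y \<in> carrier V"
    have key: "?u (x \<oplus> y) \<le> p x + q y" if "p \<in> C" "q \<in> C" for p q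
    proof -
      note pq = that
      obtain r where r: "r \<in> C" "r x \<le> p x" "r y \<le> q y"
        using chain[OF pq] pq x y by blast
      have "?u (x \<oplus> y) \<le> r (x \<oplus> y)"
        using r x y by (intro low) auto
      also have "\<dots> \<le> r x + r y"
        using sub[OF r(1)] x y by (simp add: sublinear_def)
      finally show ?thesis
        using r by simp
    qed
    have "?u (x \<oplus> y) - ?u x \<le> ?u y"
    proof (rule cINF_greatest[OF \<open>C \<noteq> {}\<close>])
      fix q assume q: "q \<in> C"
      have "?u (x \<oplus> y) - q y \<le> ?u x"
        by (rule cINF_greatest[OF \<open>C \<noteq> {}\<close>]) (use key q in \<open>force simp: algebra_simps\<close>)
      then show "?u (x \<oplus> y) - ?u x \<le> q y"
        by simp
    qed
    then show "?u (x \<oplus> y) \<le> ?u x + ?u y"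
      by simp
  next
    have "(\<lambda>p. p \<zero>) ` C = {0}"
      using sublinear_zero sub \<open>C \<noteq> {}\<close> by (auto simp: image_iff)
    then show "?u \<zero> = 0"
      by simp
  next
    fix r :: real and x assume r: "0 < r" and x: "x \<in> carrier V"
    have "?u (r \<odot> x) / r \<le> ?u x"
    proof (rule cINF_greatest[OF \<open>C \<noteq> {}\<close>])
      fix p assume p: "p \<in> C"
      have "?u (r \<odot> x) \<le> p (r \<odot> x)"
        using p x by (intro low) auto
      also have "\<dots> = r * p x"
        using sub[OF p] r x by (simp add: sublinear_def)
      finally show "?u (r \<odot> x) / r \<le> p x"
        using r by (simp add: field_simps)
    qed
    then show "?u (r \<odot> x) \<le> r * ?u x"
      using r by (simp add: field_simps)
  qed
qed

lemma sublinear_cong: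
  assumes "sublinear V p" "\<And>x. x \<in> carrier V \<Longrightarrow> p x = q x"
  shows "sublinear V q"
  using assms unfolding sublinear_def by (metis M.a_closed scale_closed)

text \<open>Zorn's lemma, with lower bounds of chains given by pointwise infima.\<close>

lemma minimal_sublinear_below:
  assumes p: "sublinear V p"
  obtains q where "sublinear V q" "\<And>x. x \<in> carrier V \<Longrightarrow> q x \<le> p x"
    "\<And>r. sublinear V r \<Longrightarrow> (\<And>x. x \<in> carrier V \<Longrightarrow> r x \<le> q x) \<Longrightarrow>
      (\<And>x. x \<in> carrier V \<Longrightarrow> r x = q x)"
proof -
  \<comment> \<open>Pointwise comparison on the carrier is antisymmetric only after the values off
    the carrier are fixed, hence the restriction to \<open>extensional\<close> functions.\<close>
  define A where "A = {q \<in> extensional (carrier V). sublinear V q \<and> (\<forall>x\<in>carrier V. q x \<le> p x)}"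
  \<comment> \<open>The order is reversed, so that the maximal element provided by Zorn's lemma is a
    minimal functional.\<close>
  define P where "P = (\<lambda>q r. \<forall>x\<in>carrier V. (r x :: real) \<le> q x)"
  have restrictA: "restrict q (carrier V) \<in> A"
    if "sublinear V q" "\<And>x. x \<in> carrier V \<Longrightarrow> q x \<le> p x" for q
    using that sublinear_cong[of q "restrict q (carrier V)"] by (simp add: A_def)
  have "\<exists>m\<in>A. \<forall>a\<in>A. P m a \<longrightarrow> a = m"
  proof (rule predicate_Zorn)
    show "partial_order_on A (relation_of P A)"
    proof (rule partial_order_on_relation_ofI)
      fix a b assume "a \<in> A" "b \<in> A" "P a b" "P b a"
      then show "a = b"
        unfolding A_def P_def by (intro extensionalityI[of a "carrier V" b]) (auto intro: order_antisym)
    qed (force simp: P_def)+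
    fix C assume C: "C \<in> Chains (relation_of P A)"
    show "\<exists>u\<in>A. \<forall>a\<in>C. P a u"
    proof (cases "C = {}")
      case True
      then show ?thesis
        using restrictA[OF p] by auto
    next
      case False
      have CA: "q \<in> A" if "q \<in> C" for q
        using C that by (auto simp: Chains_def relation_of_def)
      have "P q r \<or> P r q" if "q \<in> C" "r \<in> C" for q r
        using C that by (auto simp: Chains_def relation_of_def)
      then have chain: "(\<forall>x\<in>carrier V. q x \<le> r x) \<or> (\<forall>x\<in>carrier V. r x \<le> q x)"
        if "q \<in> C" "r \<in> C" for q r
        using that by (auto simp: P_def)
      have subC: "sublinear V q" and leC: "x \<in> carrier V \<Longrightarrow> q x \<le> p x" if "q \<in> C" for q x
        using CA[OF that] by (auto simp: A_def)
      have inf: "sublinear V (\<lambda>x. INF q\<in>C. q x)"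
        "\<And>q x. q \<in> C \<Longrightarrow> x \<in> carrier V \<Longrightarrow> (INF q\<in>C. q x) \<le> q x"
        using sublinear_chain_Inf[where b = p and C = C] False subC chain leC by blast+
      have "restrict (\<lambda>x. INF q\<in>C. q x) (carrier V) \<in> A"
        using False leC inf(2) by (intro restrictA inf(1)) (force intro: order_trans)+
      then show ?thesis
        by (rule bexI[rotated]) (simp add: P_def inf(2))
    qed
  qed
  then obtain m where m: "m \<in> A" "\<And>a. a \<in> A \<Longrightarrow> P m a \<Longrightarrow> a = m"
    by blast
  show ?thesis
  proof (rule that)
    show "sublinear V m" "\<And>x. x \<in> carrier V \<Longrightarrow> m x \<le> p x"
      using m(1) by (auto simp: A_def)
    fix r x assume r: "sublinear V r" "\<And>x. x \<in> carrier V \<Longrightarrow> r x \<le> m x" and x: "x \<in> carrier V"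
    have "restrict r (carrier V) = m"
      using r m(1) by (intro m(2) restrictA) (auto simp: A_def P_def intro: order_trans)
    then show "r x = m x"
      using x by (metis restrict_apply')
  qed
qed

lemma vconvex_singleton: "x \<in> carrier V \<Longrightarrow> vconvex V {x}"
  by (auto simp: vconvex_def scale_left_distrib[symmetric])

text \<open>Any functional minimal among the sublinear ones below
  \<open>lower_functional p K c\<close> is linear, and lying below it encodes both requirements at
  once: \<open>f \<le> p\<close>, and \<open>c \<le> f\<close> on \<open>K\<close>. With
  \<open>p\<close> the norm this separates 0 from a convex set at distance at least
  \<open>c\<close>.\<close>

theorem hahn_banach_sandwich:
  assumes p: "sublinear V p" and K: "K \<subseteq> carrier V" "vconvex V K" "K \<noteq> {}"
    and c: "\<And>k. k \<in> K \<Longrightarrow> c \<le> p k"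
  obtains f where
    "\<And>x y. x \<in> carrier V \<Longrightarrow> y \<in> carrier V \<Longrightarrow> f (x \<oplus> y) = f x + f y"
    "\<And>r x. x \<in> carrier V \<Longrightarrow> f (r \<odot> x) = r * f x"
    "\<And>x. x \<in> carrier V \<Longrightarrow> f x \<le> p x"
    "\<And>k. k \<in> K \<Longrightarrow> c \<le> f k"
proof -
  let ?q = "lower_functional p K c"
  obtain f where f: "sublinear V f" and fq: "\<And>x. x \<in> carrier V \<Longrightarrow> f x \<le> ?q x"
    and min: "\<And>r x. sublinear V r \<Longrightarrow> (\<And>x. x \<in> carrier V \<Longrightarrow> r x \<le> f x) \<Longrightarrow>
      x \<in> carrier V \<Longrightarrow> r x = f x"
    using minimal_sublinear_below[OF sublinear_lower_functional[OF p K c]] by blast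
  have add: "f (x \<oplus> y) = f x + f y" if x: "x \<in> carrier V" and y: "y \<in> carrier V" for x y
  proof -
    let ?K = "{y}"
    have K': "?K \<subseteq> carrier V" "vconvex V ?K" "?K \<noteq> {}" "\<And>k. k \<in> ?K \<Longrightarrow> f y \<le> f k"
      using y vconvex_singleton by auto
    \<comment> \<open>Lowering \<open>f\<close> along \<open>y\<close> gives a sublinear functional
      below \<open>f\<close>, hence \<open>f\<close> again by minimality. The term
      \<open>t = 1\<close> of its defining infimum then reads
      \<open>f x \<le> f (x \<oplus> y) - f y\<close>, the converse of subadditivity.\<close>
    have "lower_functional f ?K (f y) x = f x"
      using lower_functional_le_self[OF f K'] x by (intro min sublinear_lower_functional f K')
    then have "f x + f y \<le> f (x \<oplus> y)"
      using lower_functional_le[OF f K' x, of y 1] y by simp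
    then show ?thesis
      using f x y by (auto simp: sublinear_def intro: antisym)
  qed
  have neg: "f (\<ominus> x) = - f x" if "x \<in> carrier V" for x
    using add[of x "\<ominus> x"] sublinear_zero[OF f] that by (simp add: M.r_neg)
  show ?thesis
  proof (rule that)
    show "f (x \<oplus> y) = f x + f y" if "x \<in> carrier V" "y \<in> carrier V" for x y
      using add that .
    show "f (r \<odot> x) = r * f x" if x: "x \<in> carrier V" for r x
    proof (cases "0 \<le> r")
      case True
      then show ?thesis
        using f x by (simp add: sublinear_def)
    next
      case False
      have "\<ominus> (r \<odot> x) = (- r) \<odot> x"
        using smult_minus_one[of "r \<odot> x"] x by (simp add: scale_scale)
      then have "f (\<ominus> (r \<odot> x)) = - r * f x"
        using f x False by (simp add: sublinear_def)
      then show ?thesis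
        using neg[of "r \<odot> x"] x by simp
    qed
    show "f x \<le> p x" if "x \<in> carrier V" for x
      using fq[OF that] lower_functional_le_self[OF p K c that] by simp
    show "c \<le> f k" if k: "k \<in> K" for k
      using fq[of "\<ominus> k"] lower_functional_uminus[OF p K c k] neg[of k] K k by auto
  qed
qed

end

section \<open>Sup-normed products and convex hulls\<close>

text \<open>Keeps index sets in the form \<open>{1..n}\<close>, as written in the definitions.\<close>

declare One_nat_def [simp del]

text \<open>Covers both \<open>linf_n n V\<close> and the space whose quotient is the ultraproduct.
  Nonemptiness excludes the supremum of the empty set, which has no meaningful value in the
  reals.\<close>

locale normed_family =
  fixes I :: "'i set" and X :: "'i \<Rightarrow> 'a nspace"
  assumes normed: "\<And>i. i \<in> I \<Longrightarrow> real_normed_space (X i)"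
    and nonempty: "I \<noteq> {}"
begin

lemma linf_zero_apply: "i \<in> I \<Longrightarrow> \<zero>\<^bsub>linf I X\<^esub> i = \<zero>\<^bsub>X i\<^esub>"
  and linf_add_apply: "i \<in> I \<Longrightarrow> (x \<oplus>\<^bsub>linf I X\<^esub> y) i = x i \<oplus>\<^bsub>X i\<^esub> y i"
  and linf_smult_apply: "i \<in> I \<Longrightarrow> (r \<odot>\<^bsub>linf I X\<^esub> x) i = r \<odot>\<^bsub>X i\<^esub> x i"
  by (simp_all add: linf_def)

lemma linf_carrierI:
  assumes "x \<in> extensional I" "\<And>i. i \<in> I \<Longrightarrow> x i \<in> carrier (X i)"
    and "\<And>i. i \<in> I \<Longrightarrow> vnorm (X i) (x i) \<le> B"
  shows "x \<in> carrier (linf I X)"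
  using assms by (auto simp: linf_def PiE_def intro!: bdd_aboveI2[where M = B])

lemma linf_carrierD: "x \<in> carrier (linf I X) \<Longrightarrow> i \<in> I \<Longrightarrow> x i \<in> carrier (X i)"
  by (auto simp: linf_def)

lemma linf_extensional: "x \<in> carrier (linf I X) \<Longrightarrow> x \<in> extensional I"
  by (auto simp: linf_def PiE_def)

lemma linf_eqI:
  assumes "x \<in> carrier (linf I X)" "y \<in> carrier (linf I X)" "\<And>i. i \<in> I \<Longrightarrow> x i = y i"
  shows "x = y"
  using assms linf_extensional extensionalityI by metis

lemma vnorm_apply_le: "x \<in> carrier (linf I X) \<Longrightarrow> i \<in> I \<Longrightarrow> vnorm (X i) (x i) \<le> vnorm (linf I X) x"
  by (auto simp: linf_def intro: cSUP_upper)

lemma linf_vnorm_leI: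
  assumes "\<And>i. i \<in> I \<Longrightarrow> vnorm (X i) (x i) \<le> B"
  shows "vnorm (linf I X) x \<le> B"
  using assms nonempty by (auto simp: linf_def intro: cSUP_least)

lemma
  shows linf_zero_closed: "\<zero>\<^bsub>linf I X\<^esub> \<in> carrier (linf I X)"
    and linf_add_closed: "\<And>x y. x \<in> carrier (linf I X) \<Longrightarrow> y \<in> carrier (linf I X) \<Longrightarrow>
      x \<oplus>\<^bsub>linf I X\<^esub> y \<in> carrier (linf I X)"
    and linf_smult_closed: "\<And>r x. x \<in> carrier (linf I X) \<Longrightarrow> r \<odot>\<^bsub>linf I X\<^esub> x \<in> carrier (linf I X)"
proof -
  show "\<zero>\<^bsub>linf I X\<^esub> \<in> carrier (linf I X)"
  proof (rule linf_carrierI)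
    fix i assume "i \<in> I"
    then interpret Xi: real_normed_space "X i" by (rule normed)
    show "\<zero>\<^bsub>linf I X\<^esub> i \<in> carrier (X i)" "vnorm (X i) (\<zero>\<^bsub>linf I X\<^esub> i) \<le> 0"
      using \<open>i \<in> I\<close> by (simp_all add: linf_zero_apply)
  qed (simp add: linf_def)
next
  fix x y assume x: "x \<in> carrier (linf I X)" and y: "y \<in> carrier (linf I X)"
  show "x \<oplus>\<^bsub>linf I X\<^esub> y \<in> carrier (linf I X)"
  proof (rule linf_carrierI)
    fix i assume i: "i \<in> I"
    then interpret Xi: real_normed_space "X i" by (rule normed)
    show "(x \<oplus>\<^bsub>linf I X\<^esub> y) i \<in> carrier (X i)"
      using i x y by (simp add: linf_add_apply linf_carrierD)
    show "vnorm (X i) ((x \<oplus>\<^bsub>linf I X\<^esub> y) i) \<le> vnorm (linf I X) x + vnorm (linf I X) y"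
      using Xi.vnorm_triangle[of "x i" "y i"] vnorm_apply_le[OF x i] vnorm_apply_le[OF y i] i x y
      by (simp add: linf_add_apply linf_carrierD)
  qed (simp add: linf_def)
next
  fix r x assume x: "x \<in> carrier (linf I X)"
  show "r \<odot>\<^bsub>linf I X\<^esub> x \<in> carrier (linf I X)"
  proof (rule linf_carrierI)
    fix i assume i: "i \<in> I"
    then interpret Xi: real_normed_space "X i" by (rule normed)
    show "(r \<odot>\<^bsub>linf I X\<^esub> x) i \<in> carrier (X i)"
      using i x by (simp add: linf_smult_apply linf_carrierD)
    show "vnorm (X i) ((r \<odot>\<^bsub>linf I X\<^esub> x) i) \<le> \<bar>r\<bar> * vnorm (linf I X) x"
      using vnorm_apply_le[OF x i] i x
      by (simp add: linf_smult_apply linf_carrierD Xi.vnorm_smult mult_left_mono)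
  qed (simp add: linf_def)
qed

lemma real_normed_space_linf: "real_normed_space (linf I X)"
proof -
  note closed = linf_zero_closed linf_add_closed linf_smult_closed
  note apps = linf_zero_apply linf_add_apply linf_smult_apply linf_carrierD
  have ag: "abelian_group (linf I X)"
  proof (rule abelian_groupI)
    fix x y z assume x: "x \<in> carrier (linf I X)" and y: "y \<in> carrier (linf I X)"
      and z: "z \<in> carrier (linf I X)"
    show "(x \<oplus>\<^bsub>linf I X\<^esub> y) \<oplus>\<^bsub>linf I X\<^esub> z = x \<oplus>\<^bsub>linf I X\<^esub> (y \<oplus>\<^bsub>linf I X\<^esub> z)"
    proof (rule linf_eqI)
      fix i assume "i \<in> I"
      then interpret Xi: real_normed_space "X i" by (rule normed)
      show "((x \<oplus>\<^bsub>linf I X\<^esub> y) \<oplus>\<^bsub>linf I X\<^esub> z) i = (x \<oplus>\<^bsub>linf I X\<^esub> (y \<oplus>\<^bsub>linf I X\<^esub> z)) i"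
        using \<open>i \<in> I\<close> x y z by (simp add: apps Xi.M.a_assoc)
    qed (use x y z closed in auto)
  next
    fix x y assume x: "x \<in> carrier (linf I X)" and y: "y \<in> carrier (linf I X)"
    show "x \<oplus>\<^bsub>linf I X\<^esub> y = y \<oplus>\<^bsub>linf I X\<^esub> x"
    proof (rule linf_eqI)
      fix i assume "i \<in> I"
      then interpret Xi: real_normed_space "X i" by (rule normed)
      show "(x \<oplus>\<^bsub>linf I X\<^esub> y) i = (y \<oplus>\<^bsub>linf I X\<^esub> x) i"
        using \<open>i \<in> I\<close> x y by (simp add: apps Xi.M.a_comm)
    qed (use x y closed in auto)
  next
    fix x assume x: "x \<in> carrier (linf I X)"
    show "\<zero>\<^bsub>linf I X\<^esub> \<oplus>\<^bsub>linf I X\<^esub> x = x"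
    proof (rule linf_eqI)
      fix i assume "i \<in> I"
      then interpret Xi: real_normed_space "X i" by (rule normed)
      show "(\<zero>\<^bsub>linf I X\<^esub> \<oplus>\<^bsub>linf I X\<^esub> x) i = x i"
        using \<open>i \<in> I\<close> x by (simp add: apps)
    qed (use x closed in auto)
    show "\<exists>y\<in>carrier (linf I X). y \<oplus>\<^bsub>linf I X\<^esub> x = \<zero>\<^bsub>linf I X\<^esub>"
    proof (rule bexI[of _ "(- 1) \<odot>\<^bsub>linf I X\<^esub> x"])
      show "((- 1) \<odot>\<^bsub>linf I X\<^esub> x) \<oplus>\<^bsub>linf I X\<^esub> x = \<zero>\<^bsub>linf I X\<^esub>"
      proof (rule linf_eqI)
        fix i assume "i \<in> I"
        then interpret Xi: real_normed_space "X i" by (rule normed)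
        show "(((- 1) \<odot>\<^bsub>linf I X\<^esub> x) \<oplus>\<^bsub>linf I X\<^esub> x) i = \<zero>\<^bsub>linf I X\<^esub> i"
          using \<open>i \<in> I\<close> x by (simp add: apps Xi.smult_minus_one Xi.M.l_neg)
      qed (use x closed in auto)
    qed (use x closed in auto)
  qed (use closed in auto)
  show ?thesis
  proof (rule real_normed_spaceI[OF ag])
    fix r s x assume x: "x \<in> carrier (linf I X)"
    show "r \<odot>\<^bsub>linf I X\<^esub> x \<in> carrier (linf I X)"
      using x closed by auto
    show "(r + s) \<odot>\<^bsub>linf I X\<^esub> x = r \<odot>\<^bsub>linf I X\<^esub> x \<oplus>\<^bsub>linf I X\<^esub> s \<odot>\<^bsub>linf I X\<^esub> x"
    proof (rule linf_eqI)
      fix i assume "i \<in> I"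
      then interpret Xi: real_normed_space "X i" by (rule normed)
      show "((r + s) \<odot>\<^bsub>linf I X\<^esub> x) i = (r \<odot>\<^bsub>linf I X\<^esub> x \<oplus>\<^bsub>linf I X\<^esub> s \<odot>\<^bsub>linf I X\<^esub> x) i"
        using \<open>i \<in> I\<close> x by (simp add: apps Xi.scale_left_distrib)
    qed (use x closed in auto)
    show "(r * s) \<odot>\<^bsub>linf I X\<^esub> x = r \<odot>\<^bsub>linf I X\<^esub> (s \<odot>\<^bsub>linf I X\<^esub> x)"
    proof (rule linf_eqI)
      fix i assume "i \<in> I"
      then interpret Xi: real_normed_space "X i" by (rule normed)
      show "((r * s) \<odot>\<^bsub>linf I X\<^esub> x) i = (r \<odot>\<^bsub>linf I X\<^esub> (s \<odot>\<^bsub>linf I X\<^esub> x)) i"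
        using \<open>i \<in> I\<close> x by (simp add: apps Xi.scale_scale)
    qed (use x closed in auto)
    show "1 \<odot>\<^bsub>linf I X\<^esub> x = x"
    proof (rule linf_eqI)
      fix i assume "i \<in> I"
      then interpret Xi: real_normed_space "X i" by (rule normed)
      show "(1 \<odot>\<^bsub>linf I X\<^esub> x) i = x i"
        using \<open>i \<in> I\<close> x by (simp add: apps)
    qed (use x closed in auto)
    show "vnorm (linf I X) x = 0 \<longleftrightarrow> x = \<zero>\<^bsub>linf I X\<^esub>"
    proof
      assume eq: "vnorm (linf I X) x = 0"
      show "x = \<zero>\<^bsub>linf I X\<^esub>"
      proof (rule linf_eqI)
        fix i assume i: "i \<in> I"
        then interpret Xi: real_normed_space "X i" by (rule normed)
        have "vnorm (X i) (x i) = 0"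
          using vnorm_apply_le[OF x i] eq Xi.vnorm_nonneg[of "x i"] i x by (simp add: apps)
        then show "x i = \<zero>\<^bsub>linf I X\<^esub> i"
          using i x by (simp add: apps Xi.vnorm_eq_0_iff)
      qed (use x closed in auto)
    next
      assume eq: "x = \<zero>\<^bsub>linf I X\<^esub>"
      have "vnorm (X i) (x i) = 0" if i: "i \<in> I" for i
      proof -
        interpret Xi: real_normed_space "X i" using i by (rule normed)
        show ?thesis
          using i eq by (simp add: apps)
      qed
      then show "vnorm (linf I X) x = 0"
        using nonempty by (simp add: linf_def cong: SUP_cong)
    qed
    show "vnorm (linf I X) (r \<odot>\<^bsub>linf I X\<^esub> x) = \<bar>r\<bar> * vnorm (linf I X) x"
    proof (rule antisym)
      have le: "vnorm (linf I X) (r \<odot>\<^bsub>linf I X\<^esub> x) \<le> \<bar>r\<bar> * vnorm (linf I X) x"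
        if x: "x \<in> carrier (linf I X)" for r x
      proof (rule linf_vnorm_leI)
        fix i assume i: "i \<in> I"
        then interpret Xi: real_normed_space "X i" by (rule normed)
        show "vnorm (X i) ((r \<odot>\<^bsub>linf I X\<^esub> x) i) \<le> \<bar>r\<bar> * vnorm (linf I X) x"
          using vnorm_apply_le[OF x i] i x by (simp add: apps Xi.vnorm_smult mult_left_mono)
      qed
      show "vnorm (linf I X) (r \<odot>\<^bsub>linf I X\<^esub> x) \<le> \<bar>r\<bar> * vnorm (linf I X) x"
        using le x .
      show "\<bar>r\<bar> * vnorm (linf I X) x \<le> vnorm (linf I X) (r \<odot>\<^bsub>linf I X\<^esub> x)"
      \<comment> \<open>For \<open>r \<noteq> 0\<close> this is the estimate \<open>le\<close> for
        the scalar \<open>inverse r\<close>; for \<open>r = 0\<close> only nonnegativity of the norm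
        is left, and one coordinate shows it.\<close>
      proof (cases "r = 0")
        case True
        obtain i where i: "i \<in> I"
          using nonempty by blast
        interpret Xi: real_normed_space "X i" using i by (rule normed)
        have "0 \<le> vnorm (X i) ((r \<odot>\<^bsub>linf I X\<^esub> x) i)"
          using i x by (simp add: apps Xi.vnorm_nonneg)
        also have "\<dots> \<le> vnorm (linf I X) (r \<odot>\<^bsub>linf I X\<^esub> x)"
          using i x closed by (intro vnorm_apply_le) auto
        finally show ?thesis
          using True by simp
      next
        case False
        have "inverse r \<odot>\<^bsub>linf I X\<^esub> (r \<odot>\<^bsub>linf I X\<^esub> x) = x"
        proof (rule linf_eqI)
          fix i assume "i \<in> I"
          then interpret Xi: real_normed_space "X i" by (rule normed)
          show "(inverse r \<odot>\<^bsub>linf I X\<^esub> (r \<odot>\<^bsub>linf I X\<^esub> x)) i = x i"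
            using \<open>i \<in> I\<close> x False by (simp add: apps Xi.scale_scale)
        qed (use x closed in auto)
        then have "vnorm (linf I X) x \<le> \<bar>inverse r\<bar> * vnorm (linf I X) (r \<odot>\<^bsub>linf I X\<^esub> x)"
          using le[of "r \<odot>\<^bsub>linf I X\<^esub> x" "inverse r"] x closed by simp
        then show ?thesis
          using False by (simp add: field_simps)
      qed
    qed
  next
    fix r x y assume x: "x \<in> carrier (linf I X)" and y: "y \<in> carrier (linf I X)"
    show "r \<odot>\<^bsub>linf I X\<^esub> (x \<oplus>\<^bsub>linf I X\<^esub> y) = r \<odot>\<^bsub>linf I X\<^esub> x \<oplus>\<^bsub>linf I X\<^esub> r \<odot>\<^bsub>linf I X\<^esub> y"
    proof (rule linf_eqI)
      fix i assume "i \<in> I"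
      then interpret Xi: real_normed_space "X i" by (rule normed)
      show "(r \<odot>\<^bsub>linf I X\<^esub> (x \<oplus>\<^bsub>linf I X\<^esub> y)) i = (r \<odot>\<^bsub>linf I X\<^esub> x \<oplus>\<^bsub>linf I X\<^esub> r \<odot>\<^bsub>linf I X\<^esub> y) i"
        using \<open>i \<in> I\<close> x y by (simp add: apps Xi.scale_right_distrib)
    qed (use x y closed in auto)
    show "vnorm (linf I X) (x \<oplus>\<^bsub>linf I X\<^esub> y) \<le> vnorm (linf I X) x + vnorm (linf I X) y"
    proof (rule linf_vnorm_leI)
      fix i assume i: "i \<in> I"
      then interpret Xi: real_normed_space "X i" by (rule normed)
      show "vnorm (X i) ((x \<oplus>\<^bsub>linf I X\<^esub> y) i) \<le> vnorm (linf I X) x + vnorm (linf I X) y"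
        using Xi.vnorm_triangle[of "x i" "y i"] vnorm_apply_le[OF x i] vnorm_apply_le[OF y i] i x y
        by (simp add: apps)
    qed
  qed
qed

sublocale L: real_normed_space "linf I X"
  by (rule real_normed_space_linf)

lemma linf_uminus_apply:
  assumes "x \<in> carrier (linf I X)" "i \<in> I"
  shows "(\<ominus>\<^bsub>linf I X\<^esub> x) i = \<ominus>\<^bsub>X i\<^esub> x i"
proof -
  interpret Xi: real_normed_space "X i" using assms(2) by (rule normed)
  show ?thesis
    using assms linf_smult_apply[of i "- 1" x] L.smult_minus_one[of x]
      Xi.smult_minus_one[of "x i"] by (simp add: linf_carrierD)
qed

lemma linf_minus_apply:
  assumes "x \<in> carrier (linf I X)" "y \<in> carrier (linf I X)" "i \<in> I"
  shows "(x \<ominus>\<^bsub>linf I X\<^esub> y) i = x i \<ominus>\<^bsub>X i\<^esub> y i"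
  using assms by (simp add: a_minus_def linf_add_apply linf_uminus_apply)

lemma linf_finsum_apply:
  assumes "i \<in> I" "finite A" "g \<in> A \<rightarrow> carrier (linf I X)"
  shows "finsum (linf I X) g A i = (\<Oplus>\<^bsub>X i\<^esub>a\<in>A. g a i)"
proof -
  interpret Xi: real_normed_space "X i" using assms(1) by (rule normed)
  show ?thesis
    by (rule finsum_additive[OF L.M.abelian_group_axioms Xi.M.abelian_group_axioms, where h = "\<lambda>x. x i"])
      (use assms in \<open>auto simp: linf_carrierD linf_add_apply\<close>)
qed

end

section \<open>Convex combinations with a bounded number of terms\<close>

text \<open>Frees the terms from the index set \<open>{1..k}\<close> in the definition of
  \<open>co\<close>: a bijection renumbers any finite index set of the right size.\<close>

lemma co_memI:
  assumes "abelian_monoid V" "finite J" "card J \<le> m"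
    and "\<And>j. j \<in> J \<Longrightarrow> 0 \<le> t j" "\<And>j. j \<in> J \<Longrightarrow> x j \<in> C" "(\<Sum>j\<in>J. t j) = 1"
    and carrier: "\<And>j. j \<in> J \<Longrightarrow> t j \<odot>\<^bsub>V\<^esub> x j \<in> carrier V"
  shows "(\<Oplus>\<^bsub>V\<^esub>j\<in>J. t j \<odot>\<^bsub>V\<^esub> x j) \<in> co V m C"
proof -
  interpret abelian_monoid V by fact
  obtain h where h: "bij_betw h {1..card J} J"
    using ex_bij_betw_nat_finite_1[OF \<open>finite J\<close>] by blast
  then have J: "J = h ` {1..card J}" and inj: "inj_on h {1..card J}"
    by (auto simp: bij_betw_def)
  have "(\<Oplus>\<^bsub>V\<^esub>j\<in>J. t j \<odot>\<^bsub>V\<^esub> x j) = (\<Oplus>\<^bsub>V\<^esub>j\<in>{1..card J}. t (h j) \<odot>\<^bsub>V\<^esub> x (h j))"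
    using finsum_reindex[of "\<lambda>j. t j \<odot>\<^bsub>V\<^esub> x j" h "{1..card J}"] inj carrier J by (auto simp: Pi_def)
  moreover have "(\<Sum>j\<in>{1..card J}. t (h j)) = 1"
    using sum.reindex_bij_betw[OF h, of t] assms(6) by simp
  moreover have "h j \<in> J" if "j \<in> {1..card J}" for j
    using h that by (auto simp: bij_betw_def)
  ultimately show ?thesis
    unfolding co_def using assms(3-5)
    by (intro CollectI exI[of _ "card J"] exI[of _ "t \<circ> h"] exI[of _ "x \<circ> h"]) auto
qed

lemma co_mono: "m \<le> m' \<Longrightarrow> co V m C \<subseteq> co V m' C"
  unfolding co_def by fastforce

context real_normed_space
begin

lemma co_closed:
  assumes "C \<subseteq> carrier V"
  shows "co V m C \<subseteq> carrier V"
  unfolding co_def using assms by (auto intro!: M.finsum_closed)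

text \<open>Combining a k-term and an l-term combination may take k + l terms, so convexity is
  claimed only for the union over all \<open>m\<close>. The disjoint sum \<open>nat + nat\<close>
  indexes the concatenation.\<close>

lemma vconvex_Union_co:
  assumes C: "C \<subseteq> carrier V"
  shows "vconvex V (\<Union>m. co V m C)"
  unfolding vconvex_def
proof (intro ballI allI impI)
  fix u v and a b :: real
  assume "u \<in> (\<Union>m. co V m C)" "v \<in> (\<Union>m. co V m C)" and ab: "0 \<le> a" "0 \<le> b" "a + b = 1"
  then obtain k t x l s y where
    u: "u = (\<Oplus>j\<in>{1..k::nat}. t j \<odot> x j)" "\<And>j. j \<in> {1..k} \<Longrightarrow> t j \<ge> 0 \<and> x j \<in> C"
      "(\<Sum>j\<in>{1..k}. t j) = 1" and
    v: "v = (\<Oplus>j\<in>{1..l::nat}. s j \<odot> y j)" "\<And>j. j \<in> {1..l} \<Longrightarrow> s j \<ge> 0 \<and> y j \<in> C"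
      "(\<Sum>j\<in>{1..l}. s j) = 1"
    unfolding co_def by blast
  define A :: "(nat + nat) set" where "A = Inl ` {1..k}"
  define B :: "(nat + nat) set" where "B = Inr ` {1..l}"
  define r where "r = case_sum (\<lambda>j. a * t j) (\<lambda>j. b * s j)"
  define z where "z = case_sum x y"
  have inj: "inj_on Inl {1..k}" "inj_on Inr {1..l}"
    by (auto simp: inj_on_def)
  have xy: "x j \<in> carrier V" if "j \<in> {1..k}" for j
    using u that C by blast
  have yc: "y j \<in> carrier V" if "j \<in> {1..l}" for j
    using v that C by blast
  have fin: "finite A" "finite B" "A \<inter> B = {}"
    by (auto simp: A_def B_def)
  have zC: "z j \<in> C" if "j \<in> A \<union> B" for j
    using that u v by (auto simp: A_def B_def z_def)
  then have zV: "z j \<in> carrier V" if "j \<in> A \<union> B" for j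
    using that C by blast
  have "a \<odot> u = (\<Oplus>j\<in>{1..k}. r (Inl j) \<odot> z (Inl j))"
    unfolding u using xy
    by (subst scale_finsum) (auto simp: r_def z_def scale_scale intro!: M.finsum_cong')
  also have "\<dots> = (\<Oplus>j\<in>A. r j \<odot> z j)"
    unfolding A_def using zV inj by (intro M.finsum_reindex[symmetric]) (auto simp: A_def)
  finally have 1: "a \<odot> u = (\<Oplus>j\<in>A. r j \<odot> z j)" .
  have "b \<odot> v = (\<Oplus>j\<in>{1..l}. r (Inr j) \<odot> z (Inr j))"
    unfolding v using yc
    by (subst scale_finsum) (auto simp: r_def z_def scale_scale intro!: M.finsum_cong')
  also have "\<dots> = (\<Oplus>j\<in>B. r j \<odot> z j)"
    unfolding B_def using zV inj by (intro M.finsum_reindex[symmetric]) (auto simp: B_def)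
  finally have 2: "b \<odot> v = (\<Oplus>j\<in>B. r j \<odot> z j)" .
  have "a \<odot> u \<oplus> b \<odot> v = (\<Oplus>j\<in>A \<union> B. r j \<odot> z j)"
    unfolding 1 2 using fin zV by (intro M.finsum_Un_disjoint[symmetric]) auto
  also have "\<dots> \<in> co V (card (A \<union> B)) C"
  proof (rule co_memI)
    show "0 \<le> r j" if "j \<in> A \<union> B" for j
      using that u v ab by (auto simp: A_def B_def r_def)
    have "(\<Sum>j\<in>A \<union> B. r j) = (\<Sum>j\<in>A. r j) + (\<Sum>j\<in>B. r j)"
      using fin by (intro sum.union_disjoint)
    also have "(\<Sum>j\<in>A. r j) = a"
      unfolding A_def using u(3) by (simp add: sum.reindex inj r_def sum_distrib_left[symmetric])
    also have "(\<Sum>j\<in>B. r j) = b"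
      unfolding B_def using v(3) by (simp add: sum.reindex inj r_def sum_distrib_left[symmetric])
    finally show "(\<Sum>j\<in>A \<union> B. r j) = 1"
      using ab by simp
  qed (use fin zC zV M.abelian_monoid_axioms in auto)
  finally show "a \<odot> u \<oplus> b \<odot> v \<in> (\<Union>m. co V m C)"
    by blast
qed

lemma scale_minus:
  "x \<in> carrier V \<Longrightarrow> y \<in> carrier V \<Longrightarrow> r \<odot> (x \<ominus> y) = r \<odot> x \<ominus> r \<odot> y"
  by (simp add: M.minus_eq scale_right_distrib scale_uminus)

lemma add_minus_add:
  assumes "a \<in> carrier V" "b \<in> carrier V" "c \<in> carrier V" "d \<in> carrier V"
  shows "(a \<ominus> b) \<oplus> (c \<ominus> d) = (a \<oplus> c) \<ominus> (b \<oplus> d)"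
proof -
  have "(a \<oplus> \<ominus> b) \<oplus> (c \<oplus> \<ominus> d) = (a \<oplus> c) \<oplus> (\<ominus> b \<oplus> \<ominus> d)"
    using assms by (simp only: M.a_ac M.a_closed M.a_inv_closed)
  then show ?thesis
    using assms by (simp add: M.minus_eq M.minus_add)
qed

section \<open>Bounded linear functionals\<close>

lemma vdual_finsum:
  assumes "f \<in> vdual V" "finite A" "g \<in> A \<rightarrow> carrier V"
  shows "f (finsum V g A) = (\<Sum>a\<in>A. f (g a))"
  using M.finsum_additive_real[of f A g] assms by (simp add: vdual_def)

lemma vdual_add: "f \<in> vdual V \<Longrightarrow> x \<in> carrier V \<Longrightarrow> y \<in> carrier V \<Longrightarrow> f (x \<oplus> y) = f x + f y"
  and vdual_scale: "f \<in> vdual V \<Longrightarrow> x \<in> carrier V \<Longrightarrow> f (r \<odot> x) = r * f x"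
  by (simp_all add: vdual_def)

lemma vdual_uminus: "f \<in> vdual V \<Longrightarrow> x \<in> carrier V \<Longrightarrow> f (\<ominus> x) = - f x"
  using vdual_scale[of f x "- 1"] by (simp add: smult_minus_one)

lemma vdual_minus: "f \<in> vdual V \<Longrightarrow> x \<in> carrier V \<Longrightarrow> y \<in> carrier V \<Longrightarrow> f (x \<ominus> y) = f x - f y"
  by (simp add: M.minus_eq vdual_add vdual_uminus)

text \<open>The definition of \<open>vdual\<close> admits a negative constant, which can occur on
  the zero space; monotonicity arguments want a nonnegative one.\<close>

lemma vdual_bound:
  assumes "f \<in> vdual V"
  obtains K where "0 \<le> K" "\<And>x. x \<in> carrier V \<Longrightarrow> \<bar>f x\<bar> \<le> K * vnorm V x"
proof -
  obtain K where K: "\<And>x. x \<in> carrier V \<Longrightarrow> \<bar>f x\<bar> \<le> K * vnorm V x"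
    using assms unfolding vdual_def by blast
  have "\<bar>f x\<bar> \<le> \<bar>K\<bar> * vnorm V x" if "x \<in> carrier V" for x
    using K[OF that] mult_right_mono[OF abs_ge_self[of K] vnorm_nonneg[OF that]] by simp
  then show ?thesis
    using that[of "\<bar>K\<bar>"] by auto
qed

lemma vdual_le_SUP:
  assumes "f \<in> vdual V" "x \<in> vball V"
  shows "f x \<le> (SUP y\<in>vball V. f y)"
proof -
  obtain K where K: "0 \<le> K" "\<And>x. x \<in> carrier V \<Longrightarrow> \<bar>f x\<bar> \<le> K * vnorm V x"
    using vdual_bound[OF assms(1)] by blast
  have "f y \<le> K" if "y \<in> vball V" for y
    using K(2)[of y] mult_left_mono[OF _ K(1), of "vnorm V y" 1] that by (auto simp: vball_def)
  then show ?thesis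
    using assms(2) by (intro cSUP_upper bdd_aboveI2[where M = K]) auto
qed

end

section \<open>The strong diameter two property via large tuples\<close>

definition large_tuples :: "nat \<Rightarrow> real \<Rightarrow> real \<Rightarrow> 'a nspace \<Rightarrow> (nat \<Rightarrow> 'a) set" where
  "large_tuples n \<epsilon> \<alpha> V = {z \<in> carrier (linf_n n V). vnorm (linf_n n V) z \<le> \<alpha> \<and>
     1 / real n * vnorm V (\<Oplus>\<^bsub>V\<^esub>i\<in>{1..n}. z i) > 1 - \<epsilon>}"

lemma Cset_eq: "Cset m n \<epsilon> \<alpha> V = co (linf_n n V) m (large_tuples n \<epsilon> \<alpha> V)"
  by (simp add: Cset_def large_tuples_def)

lemma large_tuples_subset: "large_tuples n \<epsilon> \<alpha> V \<subseteq> carrier (linf_n n V)"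
  by (auto simp: large_tuples_def)

section \<open>From the SD2P to density of the hull of large tuples\<close>

context real_normed_space
begin

lemma normed_family_n: "1 \<le> n \<Longrightarrow> normed_family {1..n::nat} (\<lambda>_. V)"
  by (auto intro!: normed_family.intro real_normed_space_axioms)

text \<open>The coordinates of \<open>F\<close> define n slices, and their mean with weights
  \<open>1 / n\<close> has diameter 2. Of two points of this mean at distance above
  \<open>2 - \<epsilon>\<close>, the first has norm above \<open>1 - \<epsilon>\<close> because the
  second has norm at most 1; the slice points averaged by the first form the tuple
  \<open>a\<close>.\<close>

lemma SD2P_functional:
  assumes SD2P: "SD2P V" and n: "1 \<le> n" and \<epsilon>: "0 < \<epsilon>" and \<eta>: "0 < \<eta>"
    and F: "F \<in> vdual (linf_n n V)" and z: "z \<in> vball (linf_n n V)"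
  obtains a where "a \<in> large_tuples n \<epsilon> 1 V" "F z - \<eta> < F a"
proof -
  interpret N: normed_family "{1..n}" "\<lambda>_. V"
    using n by (rule normed_family_n)
  let ?L = "linf_n n V"
  \<comment> \<open>Embedding of \<open>V\<close> as the i-th coordinate; composing \<open>F\<close>
    with it gives the i-th component of \<open>F\<close>.\<close>
  define single where "single = (\<lambda>i x. \<lambda>j\<in>{1..n}. if j = i then x else \<zero>)"
  define f where "f = (\<lambda>i x. F (single i x))"
  have single_closed: "single i x \<in> carrier ?L" and single_norm: "vnorm ?L (single i x) \<le> vnorm V x"
    if "x \<in> carrier V" for i x
    using that vnorm_nonneg[OF that]
    by (auto simp: single_def intro!: N.linf_vnorm_leI N.linf_carrierI[where B = "vnorm V x"])
  obtain K where K: "0 \<le> K" "\<And>x. x \<in> carrier ?L \<Longrightarrow> \<bar>F x\<bar> \<le> K * vnorm ?L x"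
    using N.L.vdual_bound[OF F] by blast
  have f: "f i \<in> vdual V" for i
    unfolding vdual_def
  proof (intro CollectI conjI ballI allI exI)
    fix x y assume xy: "x \<in> carrier V" "y \<in> carrier V"
    have "single i (x \<oplus> y) = single i x \<oplus>\<^bsub>?L\<^esub> single i y"
      using xy by (intro N.linf_eqI) (auto simp: N.linf_add_apply single_closed, auto simp: single_def)
    then show "f i (x \<oplus> y) = f i x + f i y"
      using xy by (simp add: f_def N.L.vdual_add[OF F] single_closed)
  next
    fix r x assume x: "x \<in> carrier V"
    have "single i (r \<odot> x) = r \<odot>\<^bsub>?L\<^esub> single i x"
      using x by (intro N.linf_eqI) (auto simp: N.linf_smult_apply single_closed, auto simp: single_def)
    then show "f i (r \<odot> x) = r * f i x"
      using x by (simp add: f_def N.L.vdual_scale[OF F] single_closed)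
  next
    fix x assume x: "x \<in> carrier V"
    show "\<bar>f i x\<bar> \<le> K * vnorm V x"
      using K(2)[OF single_closed[OF x, of i]] mult_left_mono[OF single_norm[OF x, of i] K(1)]
      by (simp add: f_def)
  qed
  have F_eq: "F x = (\<Sum>i\<in>{1..n}. f i (x i))" if x: "x \<in> carrier ?L" for x
  proof -
    have xc: "x i \<in> carrier V" if "i \<in> {1..n}" for i
      using N.linf_carrierD[OF x that] .
    have "x = (\<Oplus>\<^bsub>?L\<^esub>i\<in>{1..n}. single i (x i))"
    proof (rule N.linf_eqI)
      fix j assume j: "j \<in> {1..n}"
      have "(\<Oplus>\<^bsub>?L\<^esub>i\<in>{1..n}. single i (x i)) j = (\<Oplus>i\<in>{1..n}. single i (x i) j)"
        using j xc by (intro N.linf_finsum_apply) (auto simp: single_closed)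
      also have "\<dots> = (\<Oplus>i\<in>{1..n}. if j = i then x i else \<zero>)"
        using j xc by (intro M.finsum_cong') (auto simp: single_def)
      also have "\<dots> = x j"
        using j xc by (intro M.finsum_singleton) auto
      finally show "x j = (\<Oplus>\<^bsub>?L\<^esub>i\<in>{1..n}. single i (x i)) j" by simp
    qed (use x xc in \<open>auto intro!: N.L.M.finsum_closed simp: single_closed\<close>)
    then have "F x = F (\<Oplus>\<^bsub>?L\<^esub>i\<in>{1..n}. single i (x i))"
      by simp
    also have "\<dots> = (\<Sum>i\<in>{1..n}. f i (x i))"
      unfolding f_def using xc by (intro N.L.vdual_finsum[OF F]) (auto simp: single_closed)
    finally show ?thesis .
  qed
  define s where "s = (\<lambda>i. SUP y\<in>vball V. f i y)"
  \<comment> \<open>Depth \<open>\<eta> / n\<close>, since the losses of the n coordinates add up to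
    the loss \<open>\<eta>\<close> in \<open>F\<close>.\<close>
  define S where "S = (\<lambda>i. slice V (f i) (\<eta> / n))"
  define C where "C = {(\<Oplus>i\<in>{1..n}. (1 / n) \<odot> x i) | x. \<forall>i\<in>{1..n}. x i \<in> S i}"
  have "is_slice V (S i)" for i
    unfolding is_slice_def S_def
    using n \<eta> by (intro bexI[OF _ f] exI[of _ "\<eta> / n"]) auto
  then have "is_convex_combination_of_slices V C"
    unfolding is_convex_combination_of_slices_def C_def
    by (intro exI[of _ n] exI[of _ "\<lambda>_. 1 / n"] exI[of _ S]) (use n in auto)
  then have "ennreal (2 - \<epsilon>) < vdiameter V C"
    using SD2P \<epsilon> ennreal_lessI[of 2 "2 - \<epsilon>"] by (simp add: SD2P_def)
  then obtain u v where uv: "u \<in> C" "v \<in> C" "ennreal (2 - \<epsilon>) < ennreal (vdist V u v)"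
    by (auto simp: vdiameter_def less_SUP_iff)
  then have dist: "2 - \<epsilon> < vdist V u v"
    by (meson ennreal_leI not_le)
  obtain x y where x: "u = (\<Oplus>i\<in>{1..n}. (1 / n) \<odot> x i)" "\<And>i. i \<in> {1..n} \<Longrightarrow> x i \<in> S i"
    and y: "v = (\<Oplus>i\<in>{1..n}. (1 / n) \<odot> y i)" "\<And>i. i \<in> {1..n} \<Longrightarrow> y i \<in> S i"
    using uv by (auto simp: C_def)
  have xc: "x i \<in> carrier V" "vnorm V (x i) \<le> 1" "s i - \<eta> / n < f i (x i)"
    and yc: "y i \<in> carrier V" "vnorm V (y i) \<le> 1" if "i \<in> {1..n}" for i
    using x(2)[OF that] y(2)[OF that] by (auto simp: S_def slice_def vball_def s_def)
  have uc: "u \<in> carrier V" and vc: "v \<in> carrier V"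
    using x y xc yc by (auto intro!: M.finsum_closed)
  have "vnorm V v \<le> (\<Sum>i\<in>{1..n}. vnorm V ((1 / n) \<odot> y i))"
    unfolding y using yc by (intro vnorm_finsum_le) auto
  also have "\<dots> \<le> (\<Sum>i\<in>{1..n}. 1 / n)"
    using yc by (intro sum_mono) (auto simp: vnorm_smult field_simps)
  also have "\<dots> = 1"
    using n by simp
  finally have "1 - \<epsilon> < vnorm V u"
    using dist vnorm_minus_le[OF uc vc] uc vc by (simp add: vdist_def)
  define a where "a = (\<lambda>i\<in>{1..n}. x i)"
  have ac: "a \<in> carrier ?L"
    unfolding a_def using xc by (intro N.linf_carrierI[where B = 1]) auto
  have "vnorm ?L a \<le> 1"
    unfolding a_def using xc by (intro N.linf_vnorm_leI) auto
  moreover have "u = (1 / n) \<odot> (\<Oplus>i\<in>{1..n}. x i)"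
    unfolding x using xc by (intro scale_finsum[symmetric]) auto
  then have "vnorm V u = 1 / n * vnorm V (\<Oplus>i\<in>{1..n}. x i)"
    using xc by (simp add: vnorm_smult Pi_def)
  moreover have "(\<Oplus>i\<in>{1..n}. a i) = (\<Oplus>i\<in>{1..n}. x i)"
    using xc by (intro M.finsum_cong') (auto simp: a_def)
  ultimately have "a \<in> large_tuples n \<epsilon> 1 V"
    using ac \<open>1 - \<epsilon> < vnorm V u\<close> by (simp add: large_tuples_def)
  moreover have "F z - \<eta> < F a"
  proof -
    have zc: "z i \<in> vball V" if "i \<in> {1..n}" for i
      using z N.linf_carrierD[of z i] N.vnorm_apply_le[of z i] that by (force simp: vball_def)
    have "F z - \<eta> = (\<Sum>i\<in>{1..n}. f i (z i) - \<eta> / n)"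
      using F_eq[of z] z n by (simp add: vball_def sum_subtractf)
    also have "\<dots> \<le> (\<Sum>i\<in>{1..n}. s i - \<eta> / n)"
      unfolding s_def using zc f by (intro sum_mono diff_right_mono vdual_le_SUP) auto
    also have "\<dots> < (\<Sum>i\<in>{1..n}. f i (x i))"
      using n xc by (intro sum_strict_mono) auto
    also have "\<dots> = F a"
      using F_eq[OF ac] by (simp add: a_def)
    finally show ?thesis .
  qed
  ultimately show ?thesis
    using that by blast
qed

text \<open>If every point of the hull had distance at least \<open>\<delta>\<close> from
  \<open>z\<close>, Hahn-Banach would give a functional of norm at most 1 that is at least
  \<open>\<delta>\<close> on all differences \<open>z - a\<close>, whereas
  \<open>SD2P_functional\<close> with \<open>\<eta> = \<delta>\<close> yields a large tuple
  \<open>a\<close> with difference below \<open>\<delta>\<close>.\<close>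

lemma SD2P_imp_dense:
  assumes SD2P: "SD2P V" and n: "1 \<le> n" and \<epsilon>: "0 < \<epsilon>" and \<delta>: "0 < \<delta>"
    and z: "z \<in> vball (linf_n n V)"
  obtains k y where "y \<in> Cset k n \<epsilon> 1 V" "vdist (linf_n n V) z y < \<delta>"
proof (rule ccontr)
  assume "\<not> thesis"
  then have far: "\<delta> \<le> vdist (linf_n n V) z y" if "y \<in> Cset k n \<epsilon> 1 V" for k y
    using that \<open>\<And>y k. y \<in> Cset k n \<epsilon> 1 V \<Longrightarrow> _ y < \<delta> \<Longrightarrow> thesis\<close> by (meson not_le)
  interpret N: normed_family "{1..n}" "\<lambda>_. V"
    using n by (rule normed_family_n)
  let ?L = "linf_n n V" and ?A = "large_tuples n \<epsilon> 1 V"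
  define H where "H = (\<Union>k. co ?L k ?A)"
  \<comment> \<open>Translated and reflected so that separating \<open>z\<close> from the hull
    becomes separating 0 from \<open>K\<close>, the form \<open>hahn_banach_sandwich\<close>
    provides.\<close>
  define K where "K = (\<lambda>y. z \<ominus>\<^bsub>?L\<^esub> y) ` H"
  have zc: "z \<in> carrier ?L"
    using z by (simp add: vball_def)
  have Hc: "H \<subseteq> carrier ?L"
    unfolding H_def using N.L.co_closed[OF large_tuples_subset] by auto
  have convH: "vconvex ?L H"
    unfolding H_def by (rule N.L.vconvex_Union_co[OF large_tuples_subset])
  have AH: "a \<in> H" if "a \<in> ?A" for a
  proof -
    have ac: "a \<in> carrier ?L"
      using that large_tuples_subset by blast
    then have "(\<Oplus>\<^bsub>?L\<^esub>j\<in>{1..1::nat}. 1 \<odot>\<^bsub>?L\<^esub> a) \<in> co ?L 1 ?A"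
      using that by (intro co_memI N.L.M.abelian_monoid_axioms) auto
    then show ?thesis
      using ac by (auto simp: H_def)
  qed
  \<comment> \<open>The zero functional serves only to produce some large tuple, so that
    \<open>K\<close> is nonempty.\<close>
  have zero: "(\<lambda>_. 0) \<in> vdual ?L"
    by (auto simp: vdual_def intro: exI[of _ 0])
  obtain a where "a \<in> ?A"
    using SD2P_functional[OF SD2P n \<epsilon> \<delta> zero z] by blast
  then have K_ne: "K \<noteq> {}"
    using AH by (auto simp: K_def)
  have K_closed: "K \<subseteq> carrier ?L"
    using Hc zc by (auto simp: K_def)
  have K_convex: "vconvex ?L K"
    unfolding vconvex_def
  proof (intro ballI allI impI)
    fix x y and r s :: real
    assume "x \<in> K" "y \<in> K" and rs: "0 \<le> r" "0 \<le> s" "r + s = 1"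
    then obtain u v where uv: "x = z \<ominus>\<^bsub>?L\<^esub> u" "y = z \<ominus>\<^bsub>?L\<^esub> v" "u \<in> H" "v \<in> H"
      by (auto simp: K_def)
    then have uvc: "u \<in> carrier ?L" "v \<in> carrier ?L"
      using Hc by auto
    have "r \<odot>\<^bsub>?L\<^esub> x \<oplus>\<^bsub>?L\<^esub> s \<odot>\<^bsub>?L\<^esub> y =
        (r \<odot>\<^bsub>?L\<^esub> z \<oplus>\<^bsub>?L\<^esub> s \<odot>\<^bsub>?L\<^esub> z) \<ominus>\<^bsub>?L\<^esub> (r \<odot>\<^bsub>?L\<^esub> u \<oplus>\<^bsub>?L\<^esub> s \<odot>\<^bsub>?L\<^esub> v)"
      using uv uvc zc by (simp add: N.L.scale_minus N.L.add_minus_add)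
    also have "r \<odot>\<^bsub>?L\<^esub> z \<oplus>\<^bsub>?L\<^esub> s \<odot>\<^bsub>?L\<^esub> z = z"
      using rs zc by (simp flip: N.L.scale_left_distrib)
    finally have eq: "r \<odot>\<^bsub>?L\<^esub> x \<oplus>\<^bsub>?L\<^esub> s \<odot>\<^bsub>?L\<^esub> y =
        z \<ominus>\<^bsub>?L\<^esub> (r \<odot>\<^bsub>?L\<^esub> u \<oplus>\<^bsub>?L\<^esub> s \<odot>\<^bsub>?L\<^esub> v)" .
    have "r \<odot>\<^bsub>?L\<^esub> u \<oplus>\<^bsub>?L\<^esub> s \<odot>\<^bsub>?L\<^esub> v \<in> H"
      using convH uv(3,4) rs by (simp add: vconvex_def)
    then show "r \<odot>\<^bsub>?L\<^esub> x \<oplus>\<^bsub>?L\<^esub> s \<odot>\<^bsub>?L\<^esub> y \<in> K"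
      unfolding eq K_def by (rule imageI)
  qed
  have K_far: "\<delta> \<le> vnorm ?L k" if "k \<in> K" for k
  proof -
    obtain y m where "k = z \<ominus>\<^bsub>?L\<^esub> y" "y \<in> Cset m n \<epsilon> 1 V" "y \<in> carrier ?L"
      using \<open>k \<in> K\<close> Hc by (auto simp: K_def H_def Cset_eq)
    then show ?thesis
      using far[of y m] zc by (simp add: vdist_def)
  qed
  obtain f where f: "\<And>x y. x \<in> carrier ?L \<Longrightarrow> y \<in> carrier ?L \<Longrightarrow> f (x \<oplus>\<^bsub>?L\<^esub> y) = f x + f y"
    "\<And>r x. x \<in> carrier ?L \<Longrightarrow> f (r \<odot>\<^bsub>?L\<^esub> x) = r * f x"
    "\<And>x. x \<in> carrier ?L \<Longrightarrow> f x \<le> vnorm ?L x"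
    "\<And>k. k \<in> K \<Longrightarrow> \<delta> \<le> f k"
    by (rule N.L.hahn_banach_sandwich[OF N.L.sublinear_vnorm K_closed K_convex K_ne K_far]) (assumption, rule that)
  have "\<bar>f x\<bar> \<le> 1 * vnorm ?L x" if "x \<in> carrier ?L" for x
    using f(3)[OF that] f(3)[of "(- 1) \<odot>\<^bsub>?L\<^esub> x"] f(2)[OF that, of "- 1"] that
    by (simp add: N.L.vnorm_smult)
  then have F: "f \<in> vdual ?L"
    unfolding vdual_def using f by blast
  obtain a where a: "a \<in> ?A" "f z - \<delta> < f a"
    using SD2P_functional[OF SD2P n \<epsilon> \<delta> F z] .
  have "\<delta> \<le> f (z \<ominus>\<^bsub>?L\<^esub> a)"
    using AH[OF a(1)] by (intro f) (auto simp: K_def)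
  also have "\<dots> = f z - f a"
    using subsetD[OF large_tuples_subset a(1)] zc by (intro N.L.vdual_minus[OF F])
  finally show False
    using a(2) by simp
qed

end

text \<open>The bound \<open>1 + \<epsilon>\<close> gives the weaker form of density, the one that
  \<open>Dplus\<close> controls. The number of terms \<open>k\<close> may depend on
  \<open>z\<close>; uniformity matters only across the fibres.\<close>

definition approximable_by_large_tuples :: "'a nspace \<Rightarrow> bool" where
  "approximable_by_large_tuples V \<longleftrightarrow>
     (\<forall>n\<ge>1. \<forall>\<epsilon>>0. \<forall>\<delta>>0. \<forall>z\<in>vball (linf_n n V).
        \<exists>k. \<exists>y\<in>Cset k n \<epsilon> (1 + \<epsilon>) V. vdist (linf_n n V) z y < \<delta>)"

section \<open>From density back to the SD2P\<close>

context real_normed_space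
begin

lemma finsum_pairs:
  assumes "b \<in> {1..2 * n} \<rightarrow> carrier V"
  shows "(\<Oplus>j\<in>{1..2 * n}. b j) = (\<Oplus>i\<in>{1..n::nat}. b (2 * i - 1) \<oplus> b (2 * i))"
  using assms
proof (induction n)
  case (Suc n)
  have b: "b j \<in> carrier V" if "j \<in> {1..2 * Suc n}" for j
    using Suc.prems that by auto
  have "{1..2 * Suc n} = insert (Suc (2 * n)) (insert (Suc (Suc (2 * n))) {1..2 * n})"
    by auto
  then have "(\<Oplus>j\<in>{1..2 * Suc n}. b j) =
      b (Suc (2 * n)) \<oplus> (b (Suc (Suc (2 * n))) \<oplus> (\<Oplus>j\<in>{1..2 * n}. b j))"
    using b by (simp add: Pi_def)
  also have "\<dots> = (b (Suc (2 * n)) \<oplus> b (Suc (Suc (2 * n)))) \<oplus> (\<Oplus>j\<in>{1..2 * n}. b j)"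
    using b by (intro M.a_assoc[symmetric] M.finsum_closed) auto
  also have "(\<Oplus>j\<in>{1..2 * n}. b j) = (\<Oplus>i\<in>{1..n}. b (2 * i - 1) \<oplus> b (2 * i))"
    using b by (intro Suc.IH) auto
  also have "(b (Suc (2 * n)) \<oplus> b (Suc (Suc (2 * n)))) \<oplus> \<dots> =
      (\<Oplus>i\<in>insert (Suc n) {1..n}. b (2 * i - 1) \<oplus> b (2 * i))"
  proof (subst M.finsum_insert)
    show "(\<lambda>i. b (2 * i - 1) \<oplus> b (2 * i)) \<in> {1..n} \<rightarrow> carrier V"
      by (intro funcsetI M.a_closed b) auto
    show "b (2 * Suc n - 1) \<oplus> b (2 * Suc n) \<in> carrier V"
      using b[of "2 * Suc n - 1"] b[of "2 * Suc n"] by auto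
  qed auto
  also have "insert (Suc n) {1..n} = {1..Suc n}"
    by auto
  finally show ?case .
qed simp

text \<open>
  Passes from equal weights to arbitrary ones: a sum of almost maximal norm forces every convex
  combination of its terms to have almost maximal norm.
\<close>

lemma vnorm_convex_combination_ge:
  assumes "finite A" "x \<in> A \<rightarrow> carrier V"
    and x: "\<And>a. a \<in> A \<Longrightarrow> vnorm V (x a) \<le> M" and t: "\<And>a. a \<in> A \<Longrightarrow> 0 \<le> t a" "sum t A = 1"
  shows "vnorm V (finsum V x A) - (real (card A) - 1) * M \<le> vnorm V (\<Oplus>a\<in>A. t a \<odot> x a)"
proof -
  have le1: "t a \<le> 1" if "a \<in> A" for a
    using member_le_sum[of a A t] assms that by auto
  \<comment> \<open>The difference again has nonnegative weights, \<open>1 - t a\<close>, and their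
    total \<open>card A - 1\<close> is the coefficient of \<open>M\<close>.\<close>
  have "finsum V x A \<ominus> (\<Oplus>a\<in>A. t a \<odot> x a) = (\<Oplus>a\<in>A. x a \<ominus> t a \<odot> x a)"
    using assms by (intro minus_finsum) auto
  also have "\<dots> = (\<Oplus>a\<in>A. (1 - t a) \<odot> x a)"
  proof (rule M.finsum_cong')
    fix a assume "a \<in> A"
    then have "x a \<in> carrier V"
      using assms by auto
    then have "(1 + - t a) \<odot> x a = x a \<oplus> (- 1) \<odot> (t a \<odot> x a)"
      by (simp add: scale_left_distrib scale_scale del: add_uminus_conv_diff)
    then show "x a \<ominus> t a \<odot> x a = (1 - t a) \<odot> x a"
      using \<open>x a \<in> carrier V\<close> by (simp add: smult_minus_one M.minus_eq)
  qed (use assms in auto)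
  finally have "vnorm V (finsum V x A \<ominus> (\<Oplus>a\<in>A. t a \<odot> x a)) \<le> (\<Sum>a\<in>A. vnorm V ((1 - t a) \<odot> x a))"
    using assms by (auto intro!: vnorm_finsum_le)
  also have "\<dots> \<le> (\<Sum>a\<in>A. (1 - t a) * M)"
  proof (rule sum_mono)
    fix a assume "a \<in> A"
    moreover from this have "x a \<in> carrier V"
      using assms by auto
    ultimately show "vnorm V ((1 - t a) \<odot> x a) \<le> (1 - t a) * M"
      using x[of a] le1[of a] by (simp add: vnorm_smult mult_left_mono)
  qed
  also have "\<dots> = (real (card A) - 1) * M"
    using t by (simp add: sum_distrib_right[symmetric] sum_subtractf)
  finally show ?thesis
    using vnorm_triangle_sub[of "finsum V x A" "\<Oplus>a\<in>A. t a \<odot> x a"] assms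
    by (force simp: Pi_def)
qed

lemma convex_combination_in_vball:
  assumes "finite A" "\<And>a. a \<in> A \<Longrightarrow> x a \<in> vball V" "\<And>a. a \<in> A \<Longrightarrow> 0 \<le> t a" "sum t A = 1"
  shows "(\<Oplus>a\<in>A. t a \<odot> x a) \<in> vball V"
proof -
  have x: "x a \<in> carrier V" "vnorm V (x a) \<le> 1" if "a \<in> A" for a
    using assms(2)[OF that] by (auto simp: vball_def)
  have "vnorm V (\<Oplus>a\<in>A. t a \<odot> x a) \<le> (\<Sum>a\<in>A. vnorm V (t a \<odot> x a))"
    using x assms by (intro vnorm_finsum_le) auto
  also have "\<dots> \<le> (\<Sum>a\<in>A. t a)"
    using x assms by (intro sum_mono) (simp add: vnorm_smult mult_left_le)
  finally show ?thesis
    using x assms by (auto simp: vball_def intro!: M.finsum_closed)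
qed

text \<open>A functional takes on a convex combination at most its largest value on the terms. If
  all large tuples fell short of \<open>F z\<close> by \<open>\<eta>\<close>, so would the whole
  hull, and continuity of \<open>F\<close> would keep the hull away from \<open>z\<close>.\<close>

lemma dense_imp_functional:
  assumes n: "1 \<le> n" and \<eta>: "0 < \<eta>" and F: "F \<in> vdual (linf_n n V)" and z: "z \<in> carrier (linf_n n V)"
    and dense: "\<And>\<delta>. 0 < \<delta> \<Longrightarrow> \<exists>k. \<exists>y\<in>Cset k n \<epsilon> \<alpha> V. vdist (linf_n n V) z y < \<delta>"
  obtains a where "a \<in> large_tuples n \<epsilon> \<alpha> V" "F z - \<eta> < F a"
proof (rule ccontr)
  assume "\<not> thesis"
  then have le: "F a \<le> F z - \<eta>" if "a \<in> large_tuples n \<epsilon> \<alpha> V" for a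
    using that \<open>\<And>a. a \<in> large_tuples n \<epsilon> \<alpha> V \<Longrightarrow> F z - \<eta> < F a \<Longrightarrow> thesis\<close> by (meson not_le)
  interpret N: normed_family "{1..n}" "\<lambda>_. V"
    using n by (rule normed_family_n)
  let ?L = "linf_n n V"
  obtain K where K: "0 \<le> K" "\<And>x. x \<in> carrier ?L \<Longrightarrow> \<bar>F x\<bar> \<le> K * vnorm ?L x"
    using N.L.vdual_bound[OF F] by blast
  \<comment> \<open>Dividing by \<open>K + 1\<close> instead of \<open>K\<close> covers
    \<open>K = 0\<close> and makes the final estimate \<open>K * (\<eta> / (K + 1)) < \<eta>\<close>
    strict.\<close>
  obtain k y where y: "y \<in> Cset k n \<epsilon> \<alpha> V" "vdist ?L z y < \<eta> / (K + 1)"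
    using dense[of "\<eta> / (K + 1)"] K \<eta> by auto
  obtain l t x where y_eq: "y = (\<Oplus>\<^bsub>?L\<^esub>j\<in>{1..l::nat}. t j \<odot>\<^bsub>?L\<^esub> x j)"
    and tx: "\<And>j. j \<in> {1..l} \<Longrightarrow> 0 \<le> t j \<and> x j \<in> large_tuples n \<epsilon> \<alpha> V" "(\<Sum>j\<in>{1..l}. t j) = 1"
    using y(1) unfolding Cset_eq co_def by blast
  have xc: "x j \<in> carrier ?L" if "j \<in> {1..l}" for j
    using tx(1)[OF that] large_tuples_subset by blast
  have yc: "y \<in> carrier ?L"
    unfolding y_eq using xc by (intro N.L.M.finsum_closed) auto
  have "F y = (\<Sum>j\<in>{1..l}. t j * F (x j))"
    unfolding y_eq using xc by (subst N.L.vdual_finsum[OF F]) (auto simp: N.L.vdual_scale[OF F])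
  also have "\<dots> \<le> (\<Sum>j\<in>{1..l}. t j * (F z - \<eta>))"
    using tx(1) le by (intro sum_mono mult_left_mono) auto
  also have "\<dots> = F z - \<eta>"
    using tx(2) by (simp flip: sum_distrib_right)
  finally have "\<eta> \<le> F (z \<ominus>\<^bsub>?L\<^esub> y)"
    using N.L.vdual_minus[OF F z yc] by simp
  also have "\<dots> \<le> K * vdist ?L z y"
    using K(2)[of "z \<ominus>\<^bsub>?L\<^esub> y"] z yc by (simp add: vdist_def)
  also have "\<dots> \<le> K * (\<eta> / (K + 1))"
    using y(2) K(1) by (intro mult_left_mono) auto
  finally show False
    using K(1) \<eta> by (simp add: field_simps)
qed

text \<open>A tuple of length \<open>2 * n\<close> carries two points per slice: coordinate
  \<open>2 * i - 1\<close> gives \<open>c i\<close>, and coordinate \<open>2 * i\<close> gives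
  \<open>d i\<close> up to sign. A functional nearly maximal on the tuple puts all of them into
  their slices. Largeness gives the sum of the differences \<open>c i - d i\<close> norm near
  \<open>2 * n\<close>, and \<open>vnorm_convex_combination_ge\<close> replaces the equal weights by
  \<open>t i\<close>.\<close>

lemma convex_combination_of_slices_far_points:
  assumes dense: "approximable_by_large_tuples V"
    and n: "1 \<le> (n::nat)" and t: "\<And>i. i \<in> {1..n} \<Longrightarrow> 0 < t i" "(\<Sum>i\<in>{1..n}. t i) = 1"
    and f: "\<And>i. i \<in> {1..n} \<Longrightarrow> f i \<in> vdual V" and \<beta>: "0 < \<beta>" and \<gamma>: "0 < \<gamma>"
  shows "\<exists>c d. (\<forall>i\<in>{1..n}. c i \<in> slice V (f i) \<beta> \<and> d i \<in> slice V (f i) \<beta>) \<and>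
    2 - \<gamma> < vdist V (\<Oplus>i\<in>{1..n}. t i \<odot> c i) (\<Oplus>i\<in>{1..n}. t i \<odot> d i)"
proof -
  let ?L = "linf_n (2 * n) V"
  have n2: "1 \<le> 2 * n"
    using n by simp
  interpret N: normed_family "{1..2 * n}" "\<lambda>_. V"
    using n2 by (rule normed_family_n)
  have odd_in: "2 * i - 1 \<in> {1..2 * n}" and even_in: "2 * i \<in> {1..2 * n}" if "i \<in> {1..n}" for i
    using that by auto
  define s where "s = (\<lambda>i. SUP y\<in>vball V. f i y)"
  define S where "S = (\<Sum>i\<in>{1..n}. s i)"
  have f_le: "f i x \<le> s i" if "i \<in> {1..n}" "x \<in> vball V" for i x
    unfolding s_def using that f by (intro vdual_le_SUP) auto
  have f_zero: "f i \<zero> = 0" if "i \<in> {1..n}" for i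
    using vdual_scale[OF f[OF that], of \<zero> 0] by simp
  have "0 \<le> s i" if "i \<in> {1..n}" for i
    using f_le[OF that zero_in_vball] f_zero[OF that] by simp
  then have S: "0 \<le> S"
    unfolding S_def by (intro sum_nonneg)
  \<comment> \<open>Each \<open>w i\<close> enters \<open>F z\<close> twice and there are n of them,
    so the total loss is \<open>\<beta> / 4\<close>.\<close>
  have "\<exists>w\<in>vball V. s i - \<beta> / (8 * n) < f i w" if i: "i \<in> {1..n}" for i
  proof -
    have "bdd_above (f i ` vball V)"
      using f_le[OF i] by (intro bdd_aboveI2)
    moreover have "s i - \<beta> / (8 * n) < (SUP y\<in>vball V. f i y)"
      unfolding s_def using \<beta> n by simp
    ultimately show ?thesis
      using zero_in_vball less_cSUP_iff[of "vball V" "f i"] by blast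
  qed
  then obtain w where w: "\<And>i. i \<in> {1..n} \<Longrightarrow> w i \<in> vball V"
    "\<And>i. i \<in> {1..n} \<Longrightarrow> s i - \<beta> / (8 * n) < f i (w i)"
    by metis
  \<comment> \<open>The minus sign fits the sign convention for \<open>d i\<close>: up to the
    rescaling factor, \<open>F\<close> becomes the sum of all \<open>f i (c i) + f i (d i)\<close>,
    with supremum \<open>2 * S\<close> over the unit ball.\<close>
  define F where "F = (\<lambda>x. \<Sum>i\<in>{1..n}. f i (x (2 * i - 1)) - f i (x (2 * i)))"
  have F: "F \<in> vdual ?L"
    unfolding vdual_def
  proof (intro CollectI conjI ballI allI)
    fix x y assume x: "x \<in> carrier ?L" and y: "y \<in> carrier ?L"
    show "F (x \<oplus>\<^bsub>?L\<^esub> y) = F x + F y"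
      unfolding F_def sum.distrib[symmetric]
    proof (rule sum.cong)
      fix i assume i: "i \<in> {1..n}"
      show "f i ((x \<oplus>\<^bsub>?L\<^esub> y) (2 * i - 1)) - f i ((x \<oplus>\<^bsub>?L\<^esub> y) (2 * i)) =
          f i (x (2 * i - 1)) - f i (x (2 * i)) + (f i (y (2 * i - 1)) - f i (y (2 * i)))"
        using N.linf_carrierD[OF x] N.linf_carrierD[OF y] odd_in[OF i] even_in[OF i]
        by (simp add: N.linf_add_apply vdual_add[OF f[OF i]])
    qed simp
  next
    fix r x assume x: "x \<in> carrier ?L"
    show "F (r \<odot>\<^bsub>?L\<^esub> x) = r * F x"
      unfolding F_def sum_distrib_left
    proof (rule sum.cong)
      fix i assume i: "i \<in> {1..n}"
      show "f i ((r \<odot>\<^bsub>?L\<^esub> x) (2 * i - 1)) - f i ((r \<odot>\<^bsub>?L\<^esub> x) (2 * i)) =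
          r * (f i (x (2 * i - 1)) - f i (x (2 * i)))"
        using N.linf_carrierD[OF x] odd_in[OF i] even_in[OF i]
        by (simp add: N.linf_smult_apply vdual_scale[OF f[OF i]] right_diff_distrib)
    qed simp
  next
    have "\<forall>i\<in>{1..n}. \<exists>K\<ge>0. \<forall>x\<in>carrier V. \<bar>f i x\<bar> \<le> K * vnorm V x"
      using vdual_bound f by metis
    then obtain K where K: "\<And>i. i \<in> {1..n} \<Longrightarrow> 0 \<le> K i"
      "\<And>i x. i \<in> {1..n} \<Longrightarrow> x \<in> carrier V \<Longrightarrow> \<bar>f i x\<bar> \<le> K i * vnorm V x"
      by metis
    show "\<exists>K. \<forall>x\<in>carrier ?L. \<bar>F x\<bar> \<le> K * vnorm ?L x"
    proof (intro exI ballI)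
      fix x assume x: "x \<in> carrier ?L"
      have "\<bar>F x\<bar> \<le> (\<Sum>i\<in>{1..n}. \<bar>f i (x (2 * i - 1)) - f i (x (2 * i))\<bar>)"
        unfolding F_def by (rule sum_abs)
      also have "\<dots> \<le> (\<Sum>i\<in>{1..n}. 2 * K i * vnorm ?L x)"
      proof (rule sum_mono)
        fix i assume i: "i \<in> {1..n}"
        have *: "\<bar>f i (x j)\<bar> \<le> K i * vnorm ?L x" if j: "j \<in> {1..2 * n}" for j
          using K(2)[OF i N.linf_carrierD[OF x j]]
            mult_left_mono[OF N.vnorm_apply_le[OF x j] K(1)[OF i]] by simp
        show "\<bar>f i (x (2 * i - 1)) - f i (x (2 * i))\<bar> \<le> 2 * K i * vnorm ?L x"
          using *[OF odd_in[OF i]] *[OF even_in[OF i]] by simp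
      qed
      finally show "\<bar>F x\<bar> \<le> (\<Sum>i\<in>{1..n}. 2 * K i) * vnorm ?L x"
        by (simp add: sum_distrib_right)
    qed
  qed
  define z where "z = (\<lambda>j\<in>{1..2 * n}. if odd j then w ((j + 1) div 2) else \<ominus> w (j div 2))"
  have zj: "z j \<in> vball V" if j: "j \<in> {1..2 * n}" for j
  proof (cases "odd j")
    case True
    then have "(j + 1) div 2 \<in> {1..n}"
      using j by (auto elim!: oddE)
    then show ?thesis
      using True w(1) j by (simp add: z_def)
  next
    case False
    then have "j div 2 \<in> {1..n}"
      using j by (auto elim!: evenE)
    then show ?thesis
      using False w(1) j by (simp add: z_def vball_def vnorm_uminus)
  qed
  have z: "z \<in> vball ?L"
    using zj unfolding vball_def
    by (auto intro!: N.linf_vnorm_leI N.linf_carrierI[where B = 1]) (auto simp: z_def)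
  have "F z = (\<Sum>i\<in>{1..n}. 2 * f i (w i))"
    unfolding F_def
  proof (rule sum.cong)
    fix i assume i: "i \<in> {1..n}"
    then have "z (2 * i - 1) = w i" "z (2 * i) = \<ominus> w i"
      using odd_in even_in by (auto simp: z_def)
    then show "f i (z (2 * i - 1)) - f i (z (2 * i)) = 2 * f i (w i)"
      using w(1)[OF i] by (simp add: vball_def vdual_uminus[OF f[OF i]])
  qed simp
  also have "\<dots> \<ge> (\<Sum>i\<in>{1..n}. 2 * (s i - \<beta> / (8 * n)))"
  proof (rule sum_mono)
    fix i assume "i \<in> {1..n}"
    from w(2)[OF this] show "2 * (s i - \<beta> / (8 * n)) \<le> 2 * f i (w i)"
      by (intro mult_left_mono less_imp_le) simp_all
  qed
  also have "(\<Sum>i\<in>{1..n}. 2 * (s i - \<beta> / (8 * n))) = 2 * S - \<beta> / 4"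
    using n by (simp add: S_def sum_subtractf right_diff_distrib sum_distrib_left)
  finally have Fz: "2 * S - \<beta> / 4 \<le> F z" .
  \<comment> \<open>The first bound turns the final estimate \<open>2 - 4 * n * \<epsilon>\<close>
    into at least \<open>2 - \<gamma>\<close>. The second limits the loss by rescaling from radius
    \<open>1 + \<epsilon>\<close> to \<open>\<beta> / 2\<close>, to be added to the losses
    \<open>\<beta> / 4\<close> of \<open>F z\<close> and of \<open>F a\<close>; \<open>S + 1\<close>
    avoids division by zero.\<close>
  define \<epsilon> where "\<epsilon> = min (\<gamma> / (4 * n)) (\<beta> / (4 * (S + 1)))"
  have \<epsilon>: "0 < \<epsilon>" "4 * n * \<epsilon> \<le> \<gamma>" "2 * S * \<epsilon> \<le> \<beta> / 2"
  proof -
    show "0 < \<epsilon>"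
      using n \<beta> \<gamma> S by (simp add: \<epsilon>_def)
    have "\<epsilon> \<le> \<gamma> / (4 * n)"
      by (simp add: \<epsilon>_def)
    then show "4 * n * \<epsilon> \<le> \<gamma>"
      using n by (simp add: field_simps)
    have "\<epsilon> \<le> \<beta> / (4 * (S + 1))"
      by (simp add: \<epsilon>_def)
    then have "4 * (S + 1) * \<epsilon> \<le> \<beta>"
      using S by (simp add: field_simps)
    then show "2 * S * \<epsilon> \<le> \<beta> / 2"
      using \<open>0 < \<epsilon>\<close> by (simp add: algebra_simps)
  qed
  have zc: "z \<in> carrier ?L"
    using z by (simp add: vball_def)
  have \<beta>4: "0 < \<beta> / 4"
    using \<beta> by simp
  have "\<exists>k. \<exists>y\<in>Cset k (2 * n) \<epsilon> (1 + \<epsilon>) V. vdist ?L z y < \<delta>" if "0 < \<delta>" for \<delta>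
    using dense n2 \<epsilon>(1) z that unfolding approximable_by_large_tuples_def by blast
  then obtain a where a: "a \<in> large_tuples (2 * n) \<epsilon> (1 + \<epsilon>) V" "F z - \<beta> / 4 < F a"
    using dense_imp_functional[OF n2 \<beta>4 F zc] by blast
  have ac: "a \<in> carrier ?L"
    using subsetD[OF large_tuples_subset a(1)] .
  have aj: "a j \<in> carrier V" "vnorm V (a j) \<le> 1 + \<epsilon>" if j: "j \<in> {1..2 * n}" for j
    using N.linf_carrierD[OF ac j] N.vnorm_apply_le[OF ac j] a(1) by (auto simp: large_tuples_def)
  \<comment> \<open>Rescales the tuple into the unit ball, as membership in slices demands.\<close>
  define r where "r = inverse (1 + \<epsilon>)"
  have r: "0 < r" "r * (1 + \<epsilon>) = 1"
    using \<epsilon> by (auto simp: r_def)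
  define b where "b = (\<lambda>j. r \<odot> a j)"
  have b: "b j \<in> carrier V" "vnorm V (b j) \<le> 1" if j: "j \<in> {1..2 * n}" for j
    using aj[OF j] r mult_left_mono[of "vnorm V (a j)" "1 + \<epsilon>" r] by (auto simp: b_def vnorm_smult)
  define c where "c = (\<lambda>i. b (2 * i - 1))"
  define d where "d = (\<lambda>i. \<ominus> b (2 * i))"
  have cd: "c i \<in> vball V" "d i \<in> vball V" if "i \<in> {1..n}" for i
    using b[OF odd_in[OF that]] b[OF even_in[OF that]] by (auto simp: c_def d_def vball_def vnorm_uminus)
  have "(\<Sum>i\<in>{1..n}. f i (c i) + f i (d i)) = r * F a"
    unfolding F_def sum_distrib_left
  proof (rule sum.cong)
    fix i assume i: "i \<in> {1..n}"
    show "f i (c i) + f i (d i) = r * (f i (a (2 * i - 1)) - f i (a (2 * i)))"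
      using aj[OF odd_in[OF i]] aj[OF even_in[OF i]]
      by (simp add: c_def d_def b_def vdual_uminus[OF f[OF i]] vdual_scale[OF f[OF i]] algebra_simps)
  qed simp
  moreover have "2 * S - \<beta> < r * F a"
  proof -
    have "(1 + \<epsilon>) * (2 * S - \<beta>) = (2 * S - \<beta>) + 2 * S * \<epsilon> - \<beta> * \<epsilon>"
      by (simp add: algebra_simps)
    also have "\<dots> < F a"
      using \<epsilon>(3) mult_pos_pos[OF \<beta> \<epsilon>(1)] a(2) Fz \<beta> by linarith
    finally have "r * ((1 + \<epsilon>) * (2 * S - \<beta>)) < r * F a"
      using r(1) by simp
    then show ?thesis
      using r(2) by (simp flip: mult.assoc)
  qed
  moreover have "(\<Sum>i\<in>{1..n}. (s i - f i (c i)) + (s i - f i (d i))) =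
      2 * S - (\<Sum>i\<in>{1..n}. f i (c i) + f i (d i))"
    unfolding S_def sum_distrib_left sum_subtractf[symmetric] by (intro sum.cong) auto
  ultimately have total: "(\<Sum>i\<in>{1..n}. (s i - f i (c i)) + (s i - f i (d i))) < \<beta>"
    by simp
  \<comment> \<open>All slacks are nonnegative, so a bound on their sum bounds each one. A single
    inequality for \<open>F\<close> thus controls all \<open>2 * n\<close> slice
    memberships.\<close>
  have slack: "(s i - f i (c i)) + (s i - f i (d i)) < \<beta>" if i: "i \<in> {1..n}" for i
  proof -
    have "0 \<le> (s j - f j (c j)) + (s j - f j (d j))" if "j \<in> {1..n}" for j
      using f_le[OF that cd(1)[OF that]] f_le[OF that cd(2)[OF that]] by linarith
    then have "(s i - f i (c i)) + (s i - f i (d i)) \<le> (\<Sum>i\<in>{1..n}. (s i - f i (c i)) + (s i - f i (d i)))"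
      using i by (intro member_le_sum) auto
    then show ?thesis
      using total by simp
  qed
  have slices: "c i \<in> slice V (f i) \<beta>" "d i \<in> slice V (f i) \<beta>" if i: "i \<in> {1..n}" for i
    using slack[OF i] f_le[OF i cd(1)[OF i]] f_le[OF i cd(2)[OF i]] cd[OF i]
    by (auto simp: slice_def s_def)
  have cdc: "c i \<in> carrier V" "d i \<in> carrier V" if "i \<in> {1..n}" for i
    using cd[OF that] by (auto simp: vball_def)
  define g where "g = (\<lambda>i. c i \<ominus> d i)"
  have g: "g i \<in> carrier V" "vnorm V (g i) \<le> 2" if i: "i \<in> {1..n}" for i
    using cdc[OF i] cd[OF i] vnorm_minus_le[OF cdc[OF i]] by (auto simp: g_def vball_def)
  have "(\<Oplus>i\<in>{1..n}. t i \<odot> c i) \<ominus> (\<Oplus>i\<in>{1..n}. t i \<odot> d i) = (\<Oplus>i\<in>{1..n}. t i \<odot> c i \<ominus> t i \<odot> d i)"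
    using cdc by (intro minus_finsum) auto
  also have "\<dots> = (\<Oplus>i\<in>{1..n}. t i \<odot> g i)"
    using cdc g by (intro M.finsum_cong') (auto simp: g_def scale_minus)
  finally have dist: "vdist V (\<Oplus>i\<in>{1..n}. t i \<odot> c i) (\<Oplus>i\<in>{1..n}. t i \<odot> d i) =
      vnorm V (\<Oplus>i\<in>{1..n}. t i \<odot> g i)"
    using cdc by (simp add: vdist_def Pi_def)
  have "r \<odot> (\<Oplus>j\<in>{1..2 * n}. a j) = (\<Oplus>j\<in>{1..2 * n}. b j)"
    unfolding b_def using aj by (intro scale_finsum) auto
  also have "\<dots> = (\<Oplus>i\<in>{1..n}. b (2 * i - 1) \<oplus> b (2 * i))"
    using b by (intro finsum_pairs) auto
  also have "\<dots> = (\<Oplus>i\<in>{1..n}. g i)"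
    using g b[OF odd_in] b[OF even_in]
    by (intro M.finsum_cong') (auto simp: g_def c_def d_def M.minus_eq)
  finally have "vnorm V (finsum V g {1..n}) = r * vnorm V (\<Oplus>j\<in>{1..2 * n}. a j)"
    using aj r vnorm_smult[of "\<Oplus>j\<in>{1..2 * n}. a j" r] by (simp add: Pi_def)
  moreover have "real (2 * n) * (1 - \<epsilon>) < vnorm V (\<Oplus>j\<in>{1..2 * n}. a j)"
    using a(1) n by (simp add: large_tuples_def field_simps)
  ultimately have "r * (real (2 * n) * (1 - \<epsilon>)) < vnorm V (finsum V g {1..n})"
    using r by simp
  moreover have "1 - 2 * \<epsilon> \<le> r * (1 - \<epsilon>)"
    using \<epsilon>(1) by (simp add: r_def field_simps)
  then have "real (2 * n) * (1 - 2 * \<epsilon>) \<le> real (2 * n) * (r * (1 - \<epsilon>))"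
    by (intro mult_left_mono) auto
  ultimately have "real (2 * n) * (1 - 2 * \<epsilon>) < vnorm V (finsum V g {1..n})"
    by (simp add: mult.left_commute)
  \<comment> \<open>Each \<open>g i\<close> has norm at most 2, and \<open>2 * n * (1 - 2 *
    \<epsilon>) - 2 * (n - 1) = 2 - 4 * n * \<epsilon>\<close>.\<close>
  moreover have "vnorm V (finsum V g {1..n}) - (real (card {1..n}) - 1) * 2 \<le> vnorm V (\<Oplus>i\<in>{1..n}. t i \<odot> g i)"
    using g t by (intro vnorm_convex_combination_ge) (auto simp: less_imp_le)
  ultimately have far: "2 - \<gamma> < vnorm V (\<Oplus>i\<in>{1..n}. t i \<odot> g i)"
    using \<epsilon>(2) n by (simp add: algebra_simps of_nat_diff)
  show ?thesis
    by (intro exI[of _ c] exI[of _ d] conjI ballI slices) (use dist far in simp_all)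
qed

text \<open>The upper bound 2 is the triangle inequality in the unit ball; the lower bound comes
  from pairs of points at distance above \<open>2 - \<gamma>\<close> for every positive
  \<open>\<gamma>\<close>.\<close>

lemma dense_imp_SD2P:
  assumes dense: "approximable_by_large_tuples V"
  shows "SD2P V"
  unfolding SD2P_def
proof (intro allI impI antisym)
  fix C assume "is_convex_combination_of_slices V C"
  then obtain n t S where n: "1 \<le> n" and t: "\<And>i. i \<in> {1..n::nat} \<Longrightarrow> 0 < t i" "(\<Sum>i\<in>{1..n}. t i) = 1"
    and "\<And>i. i \<in> {1..n} \<Longrightarrow> is_slice V (S i)"
    and C: "C = {(\<Oplus>i\<in>{1..n}. t i \<odot> x i) | x. \<forall>i\<in>{1..n}. x i \<in> S i}"
    unfolding is_convex_combination_of_slices_def by blast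
  then have "\<forall>i\<in>{1..n}. \<exists>f \<alpha>. f \<in> vdual V \<and> 0 < \<alpha> \<and> S i = slice V f \<alpha>"
    unfolding is_slice_def by blast
  then obtain f \<alpha> where f: "\<And>i. i \<in> {1..n} \<Longrightarrow> f i \<in> vdual V" and \<alpha>: "\<And>i. i \<in> {1..n} \<Longrightarrow> 0 < \<alpha> i"
    and S: "\<And>i. i \<in> {1..n} \<Longrightarrow> S i = slice V (f i) (\<alpha> i)"
    by metis
  have ball: "x \<in> carrier V" "vnorm V x \<le> 1" if "x \<in> C" for x
  proof -
    obtain y where y: "x = (\<Oplus>i\<in>{1..n}. t i \<odot> y i)" "\<And>i. i \<in> {1..n} \<Longrightarrow> y i \<in> S i"
      using \<open>x \<in> C\<close> C by auto
    have "y i \<in> vball V" if "i \<in> {1..n}" for i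
      using y(2)[OF that] S[OF that] by (simp add: slice_def)
    then have "x \<in> vball V"
      unfolding y using t by (intro convex_combination_in_vball) (auto simp: less_imp_le)
    then show "x \<in> carrier V" "vnorm V x \<le> 1"
      by (auto simp: vball_def)
  qed
  show "vdiameter V C \<le> 2"
    unfolding vdiameter_def
  proof (intro SUP_least)
    fix x y assume "x \<in> C" "y \<in> C"
    then have "vdist V x y \<le> 2"
      using ball[of x] ball[of y] vnorm_minus_le[of x y] by (simp add: vdist_def)
    then show "ennreal (vdist V x y) \<le> 2"
      using ennreal_leI[of _ 2] by simp
  qed
  \<comment> \<open>One depth for all slices: shrinking each of them to depth \<open>\<beta>\<close>
    stays inside the given ones.\<close>
  define \<beta> where "\<beta> = Min (\<alpha> ` {1..n})"
  have \<beta>: "0 < \<beta>" and \<beta>_le: "\<And>i. i \<in> {1..n} \<Longrightarrow> \<beta> \<le> \<alpha> i"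
    using n \<alpha> by (auto simp: \<beta>_def)
  have far: "ennreal (2 - \<gamma>) \<le> vdiameter V C" if \<gamma>: "0 < \<gamma>" for \<gamma>
  proof -
    have "\<exists>c d. (\<forall>i\<in>{1..n}. c i \<in> slice V (f i) \<beta> \<and> d i \<in> slice V (f i) \<beta>) \<and>
        2 - \<gamma> < vdist V (\<Oplus>i\<in>{1..n}. t i \<odot> c i) (\<Oplus>i\<in>{1..n}. t i \<odot> d i)"
      by (rule convex_combination_of_slices_far_points[OF dense n t f \<beta> \<gamma>])
    then obtain c d where cd: "\<And>i. i \<in> {1..n} \<Longrightarrow> c i \<in> slice V (f i) \<beta>" "\<And>i. i \<in> {1..n} \<Longrightarrow> d i \<in> slice V (f i) \<beta>"
      and dist: "2 - \<gamma> < vdist V (\<Oplus>i\<in>{1..n}. t i \<odot> c i) (\<Oplus>i\<in>{1..n}. t i \<odot> d i)"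
      by blast
    have sub: "slice V (f i) \<beta> \<subseteq> S i" if "i \<in> {1..n}" for i
    proof
      fix x assume "x \<in> slice V (f i) \<beta>"
      then have "x \<in> vball V" "(SUP y\<in>vball V. f i y) - \<beta> < f i x"
        by (simp_all add: slice_def)
      then show "x \<in> S i"
        unfolding S[OF that] slice_def using \<beta>_le[OF that] by simp
    qed
    have inC: "(\<Oplus>i\<in>{1..n}. t i \<odot> x i) \<in> C" if "\<And>i. i \<in> {1..n} \<Longrightarrow> x i \<in> slice V (f i) \<beta>" for x
      unfolding C by (rule CollectI, rule exI[of _ x]) (use subsetD[OF sub that] in blast)
    have "ennreal (vdist V (\<Oplus>i\<in>{1..n}. t i \<odot> c i) (\<Oplus>i\<in>{1..n}. t i \<odot> d i)) \<le> vdiameter V C"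
      unfolding vdiameter_def by (rule SUP_upper2[OF inC[OF cd(1)] SUP_upper[OF inC[OF cd(2)]]])
    then show ?thesis
      by (rule order_trans[OF ennreal_leI[OF less_imp_le[OF dist]]])
  qed
  show "2 \<le> vdiameter V C"
  proof (rule ccontr)
    assume "\<not> 2 \<le> vdiameter V C"
    then have less: "vdiameter V C < 2"
      by simp
    then obtain r where r: "0 \<le> r" "vdiameter V C = ennreal r"
      by (cases "vdiameter V C") auto
    then have "r < 2"
      using less by (simp add: ennreal_less_iff flip: ennreal_numeral)
    then have "ennreal (2 - (2 - r) / 2) \<le> ennreal r"
      using far[of "(2 - r) / 2"] r by simp
    then show False
      using r \<open>r < 2\<close> by (simp add: ennreal_le_iff field_simps)
  qed
qed

end

section \<open>Ultraproducts\<close>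

text \<open>Compactness of \<open>{-B..B}\<close> gives a cluster point of the image filter, and for
  an ultrafilter every cluster point is a limit.\<close>

lemma ultrafilter_tendsto:
  fixes g :: "'i \<Rightarrow> real"
  assumes U: "ultrafilter U" and g: "\<And>i. \<bar>g i\<bar> \<le> B"
  obtains l where "(g \<longlongrightarrow> l) U"
proof -
  have "filtermap g U \<noteq> bot" "eventually (\<lambda>x. x \<in> {-B..B}) (filtermap g U)"
    using U g by (auto simp: ultrafilter_def filtermap_bot_iff eventually_filtermap abs_le_iff minus_le_iff)
  then obtain l where l: "inf (nhds l) (filtermap g U) \<noteq> bot"
    using compact_Icc[of "-B" B] unfolding compact_filter by blast
  have "(g \<longlongrightarrow> l) U"
  proof (rule topological_tendstoI)
    fix S assume S: "open S" "l \<in> S"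
    show "eventually (\<lambda>i. g i \<in> S) U"
    proof (rule ccontr)
      assume "\<not> eventually (\<lambda>i. g i \<in> S) U"
      then have "eventually (\<lambda>x. x \<notin> S) (filtermap g U)"
        using U by (auto simp: ultrafilter_def eventually_filtermap)
      moreover have "eventually (\<lambda>x. x \<in> S) (nhds l)"
        using S by (rule eventually_nhds_in_open)
      ultimately have "eventually (\<lambda>_. False) (inf (nhds l) (filtermap g U))"
        by (subst eventually_inf) blast
      then show False
        using l by (simp add: eventually_False)
    qed
  qed
  then show ?thesis
    using that by blast
qed

section \<open>The ultraproduct as a normed space\<close>

locale normed_ultraproduct =
  fixes X :: "'i \<Rightarrow> 'a nspace" and U :: "'i filter"
  assumes normed_spaces: "\<And>i. real_normed_space (X i)"
    and ultrafilter: "ultrafilter U"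
begin

sublocale Xi: real_normed_space "X i" for i
  by (rule normed_spaces)

sublocale W: normed_family UNIV X
  by unfold_locales (auto intro: normed_spaces)

abbreviation "\<W> \<equiv> linf UNIV X"
abbreviation "\<N> \<equiv> c0 U X"
abbreviation "\<Q> \<equiv> ultraproduct U X"

definition proj :: "('i \<Rightarrow> 'a) \<Rightarrow> ('i \<Rightarrow> 'a) set" where
  "proj x = \<N> +>\<^bsub>\<W>\<^esub> x"

lemma nontrivial: "U \<noteq> bot"
  using ultrafilter by (simp add: ultrafilter_def)

lemma W_carrierI:
  assumes "\<And>i. x i \<in> carrier (X i)" "\<And>i. vnorm (X i) (x i) \<le> B"
  shows "x \<in> carrier \<W>"
  using assms by (intro W.linf_carrierI) auto

lemma W_carrierD: "x \<in> carrier \<W> \<Longrightarrow> x i \<in> carrier (X i)"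
  by (rule W.linf_carrierD) auto

lemma W_vnorm_apply_le: "x \<in> carrier \<W> \<Longrightarrow> vnorm (X i) (x i) \<le> vnorm \<W> x"
  by (rule W.vnorm_apply_le) auto

lemma W_apply:
  shows "\<zero>\<^bsub>\<W>\<^esub> i = \<zero>\<^bsub>X i\<^esub>"
    and "(x \<oplus>\<^bsub>\<W>\<^esub> y) i = x i \<oplus>\<^bsub>X i\<^esub> y i"
    and "(r \<odot>\<^bsub>\<W>\<^esub> x) i = r \<odot>\<^bsub>X i\<^esub> x i"
  by (simp_all add: linf_def)

lemma W_minus_apply:
  "x \<in> carrier \<W> \<Longrightarrow> y \<in> carrier \<W> \<Longrightarrow> (x \<ominus>\<^bsub>\<W>\<^esub> y) i = x i \<ominus>\<^bsub>X i\<^esub> y i"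
  by (rule W.linf_minus_apply) auto

lemma c0_iff: "x \<in> \<N> \<longleftrightarrow> x \<in> carrier \<W> \<and> ((\<lambda>i. vnorm (X i) (x i)) \<longlongrightarrow> 0) U"
  by (simp add: c0_def)

lemma c0_smult: "x \<in> \<N> \<Longrightarrow> r \<odot>\<^bsub>\<W>\<^esub> x \<in> \<N>"
  unfolding c0_iff
  by (auto simp: W_apply Xi.vnorm_smult W_carrierD intro: tendsto_mult_right_zero)

lemma c0_dominated:
  assumes "x \<in> carrier \<W>" "eventually (\<lambda>i. vnorm (X i) (x i) \<le> g i) U" "(g \<longlongrightarrow> 0) U"
  shows "x \<in> \<N>"
  unfolding c0_iff
proof
  show "((\<lambda>i. vnorm (X i) (x i)) \<longlongrightarrow> 0) U"
    by (rule tendsto_sandwich[OF _ assms(2) tendsto_const assms(3)])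
      (use assms(1) in \<open>auto simp: Xi.vnorm_nonneg W_carrierD intro!: always_eventually\<close>)
qed fact

lemma additive_subgroup_c0: "additive_subgroup \<N> \<W>"
proof (rule additive_subgroupI, rule W.L.M.add.subgroupI)
  show "\<N> \<subseteq> carrier \<W>"
    by (auto simp: c0_iff)
  have "\<zero>\<^bsub>\<W>\<^esub> \<in> \<N>"
    by (simp add: c0_iff W_apply)
  then show "\<N> \<noteq> {}"
    by auto
  show "\<ominus>\<^bsub>\<W>\<^esub> x \<in> \<N>" if "x \<in> \<N>" for x
    using c0_smult[OF that, of "- 1"] that by (simp add: c0_iff W.L.smult_minus_one)
  show "x \<oplus>\<^bsub>\<W>\<^esub> y \<in> \<N>" if "x \<in> \<N>" "y \<in> \<N>" for x y
  proof (rule c0_dominated)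
    show "((\<lambda>i. vnorm (X i) (x i) + vnorm (X i) (y i)) \<longlongrightarrow> 0) U"
      using that tendsto_add[of "\<lambda>i. vnorm (X i) (x i)" 0 U "\<lambda>i. vnorm (X i) (y i)" 0]
      by (simp add: c0_iff)
  qed (use that in \<open>auto simp: c0_iff W_apply intro!: always_eventually Xi.vnorm_triangle W_carrierD\<close>)
qed

sublocale c0: abelian_subgroup \<N> \<W>
  by (rule abelian_subgroupI3[OF additive_subgroup_c0 W.L.M.abelian_group_axioms])

lemma mem_proj_iff: "x \<in> carrier \<W> \<Longrightarrow> y \<in> proj x \<longleftrightarrow> y \<in> carrier \<W> \<and> y \<ominus>\<^bsub>\<W>\<^esub> x \<in> \<N>"
  unfolding proj_def W.L.M.minus_eq
  using c0.a_rcos_module[of x y] c0.a_elemrcos_carrier[of x y] by auto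

lemma proj_eqI:
  assumes "x \<in> carrier \<W>" "y \<in> carrier \<W>" "y \<ominus>\<^bsub>\<W>\<^esub> x \<in> \<N>"
  shows "proj x = proj y"
  using mem_proj_iff[of x y] c0.a_repr_independence'[of y x] assms by (simp add: proj_def)

lemma Q_carrier: "carrier \<Q> = proj ` carrier \<W>"
  by (auto simp: ultraproduct_def vquotient_def A_RCOSETS_def' proj_def)

lemma proj_closed: "x \<in> carrier \<W> \<Longrightarrow> proj x \<in> carrier \<Q>"
  by (simp add: Q_carrier)

lemma proj_zero: "\<zero>\<^bsub>\<Q>\<^esub> = proj \<zero>\<^bsub>\<W>\<^esub>"
  by (simp add: ultraproduct_def vquotient_def proj_def c0.a_subset W.L.M.a_coset_add_zero)

lemma proj_add:
  "x \<in> carrier \<W> \<Longrightarrow> y \<in> carrier \<W> \<Longrightarrow> proj x \<oplus>\<^bsub>\<Q>\<^esub> proj y = proj (x \<oplus>\<^bsub>\<W>\<^esub> y)"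
  by (simp add: ultraproduct_def vquotient_def proj_def c0.a_rcos_sum)

text \<open>The quotient forms the union over all representatives; as \<open>\<N>\<close> is closed
  under scaling, they all contribute the same coset.\<close>

lemma proj_smult:
  assumes "x \<in> carrier \<W>"
  shows "r \<odot>\<^bsub>\<Q>\<^esub> proj x = proj (r \<odot>\<^bsub>\<W>\<^esub> x)"
proof -
  have "proj (r \<odot>\<^bsub>\<W>\<^esub> y) = proj (r \<odot>\<^bsub>\<W>\<^esub> x)" if "y \<in> proj x" for y
  proof (rule proj_eqI[symmetric])
    have y: "y \<in> carrier \<W>" "y \<ominus>\<^bsub>\<W>\<^esub> x \<in> \<N>"
      using that assms by (simp_all add: mem_proj_iff)
    then show "r \<odot>\<^bsub>\<W>\<^esub> y \<ominus>\<^bsub>\<W>\<^esub> r \<odot>\<^bsub>\<W>\<^esub> x \<in> \<N>" "r \<odot>\<^bsub>\<W>\<^esub> y \<in> carrier \<W>"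
      using c0_smult[of "y \<ominus>\<^bsub>\<W>\<^esub> x" r] assms by (simp_all add: W.L.scale_minus)
  qed (use assms in auto)
  moreover have "x \<in> proj x"
    using assms c0.a_rcos_self by (simp add: proj_def)
  ultimately have "(\<Union>y\<in>proj x. proj (r \<odot>\<^bsub>\<W>\<^esub> y)) = proj (r \<odot>\<^bsub>\<W>\<^esub> x)"
    by blast
  then show ?thesis
    by (simp add: ultraproduct_def vquotient_def proj_def)
qed

text \<open>Members of a coset differ by a family whose norms tend to 0, so none has sup norm below
  the limit \<open>l\<close>; truncation produces members of norm at most
  \<open>l + \<eta>\<close>.\<close>

lemma vnorm_proj_eq:
  assumes x: "x \<in> carrier \<W>" and l: "((\<lambda>i. vnorm (X i) (x i)) \<longlongrightarrow> l) U"
  shows "vnorm \<Q> (proj x) = l"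
proof -
  have eq: "vnorm \<Q> (proj x) = (INF y\<in>proj x. vnorm \<W> y)"
    by (simp add: ultraproduct_def vquotient_def proj_def)
  have self: "x \<in> proj x"
    using x c0.a_rcos_self by (simp add: proj_def)
  have l0: "0 \<le> l"
    by (rule tendsto_lowerbound[OF l _ nontrivial])
      (use x in \<open>auto simp: Xi.vnorm_nonneg W_carrierD intro!: always_eventually\<close>)
  show ?thesis
  proof (rule antisym)
    show "l \<le> vnorm \<Q> (proj x)"
      unfolding eq
    proof (rule cINF_greatest)
      fix y assume "y \<in> proj x"
      then have y: "y \<in> carrier \<W>" and yx: "((\<lambda>i. vnorm (X i) (y i \<ominus>\<^bsub>X i\<^esub> x i)) \<longlongrightarrow> 0) U"
        using x by (auto simp: mem_proj_iff c0_iff W_minus_apply)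
      have "l \<le> vnorm \<W> y + 0"
      proof (rule tendsto_le[OF nontrivial tendsto_add[OF tendsto_const yx] l])
        have "vnorm (X i) (x i) \<le> vnorm \<W> y + vnorm (X i) (y i \<ominus>\<^bsub>X i\<^esub> x i)" for i
        proof -
          have c: "x i \<in> carrier (X i)" "y i \<in> carrier (X i)"
            using x y by (auto simp: W_carrierD)
          have "vnorm (X i) (x i \<ominus>\<^bsub>X i\<^esub> y i) = vnorm (X i) (y i \<ominus>\<^bsub>X i\<^esub> x i)"
            using Metric_space.commute[OF Xi.Metric_space_vdist[of i], of "x i" "y i"] c
            by (simp add: vdist_def)
          then show ?thesis
            using Xi.vnorm_triangle_sub[of "x i" i "y i"] W_vnorm_apply_le[OF y, of i] c by simp
        qed
        then show "eventually (\<lambda>i. vnorm (X i) (x i) \<le> vnorm \<W> y + vnorm (X i) (y i \<ominus>\<^bsub>X i\<^esub> x i)) U"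
          by simp
      qed
      then show "l \<le> vnorm \<W> y"
        by simp
    qed (use self in auto)
    show "vnorm \<Q> (proj x) \<le> l"
    proof (rule field_le_epsilon)
      fix \<eta> :: real assume \<eta>: "0 < \<eta>"
      \<comment> \<open>Coordinates of norm above \<open>l + \<eta>\<close> are set to zero. Along
        \<open>U\<close> there are none, so the coset does not change.\<close>
      define y where "y = (\<lambda>i. if vnorm (X i) (x i) \<le> l + \<eta> then x i else \<zero>\<^bsub>X i\<^esub>)"
      have y: "y \<in> carrier \<W>" "vnorm \<W> y \<le> l + \<eta>"
        using x \<eta> l0
        by (auto intro!: W_carrierI[where B = "l + \<eta>"] W.linf_vnorm_leI simp: y_def W_carrierD)
      have "y \<ominus>\<^bsub>\<W>\<^esub> x \<in> \<N>"
      proof (rule c0_dominated)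
        have "eventually (\<lambda>i. vnorm (X i) (x i) < l + \<eta>) U"
          using l \<eta> by (intro order_tendstoD) auto
        then show "eventually (\<lambda>i. vnorm (X i) ((y \<ominus>\<^bsub>\<W>\<^esub> x) i) \<le> 0) U"
          by eventually_elim
            (use x y in \<open>simp add: W_minus_apply y_def W_carrierD Xi.M.minus_eq Xi.M.r_neg\<close>)
      qed (use x y in auto)
      then have "y \<in> proj x"
        using x y by (simp add: mem_proj_iff)
      moreover have "bdd_below (vnorm \<W> ` proj x)"
        using x by (intro bdd_belowI2[where m = 0]) (auto simp: mem_proj_iff W.L.vnorm_nonneg)
      ultimately show "vnorm \<Q> (proj x) \<le> l + \<eta>"
        unfolding eq using y(2) by (intro cINF_lower2)
    qed
  qed
qed

lemma vnorm_proj_tendsto: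
  assumes x: "x \<in> carrier \<W>"
  shows "((\<lambda>i. vnorm (X i) (x i)) \<longlongrightarrow> vnorm \<Q> (proj x)) U"
proof -
  have bound: "\<bar>vnorm (X i) (x i)\<bar> \<le> vnorm \<W> x" for i
    using W_vnorm_apply_le[OF x] Xi.vnorm_nonneg[OF W_carrierD[OF x]] by simp
  obtain l where "((\<lambda>i. vnorm (X i) (x i)) \<longlongrightarrow> l) U"
    by (rule ultrafilter_tendsto[OF ultrafilter bound])
  then show ?thesis
    using vnorm_proj_eq[OF x] by simp
qed

lemma real_normed_space_ultraproduct: "real_normed_space \<Q>"
proof -
  have "abelian_group \<Q>"
  proof (rule abelian_groupI)
    fix A B C assume "A \<in> carrier \<Q>" "B \<in> carrier \<Q>" "C \<in> carrier \<Q>"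
    then obtain x y z where "x \<in> carrier \<W>" "A = proj x" "y \<in> carrier \<W>" "B = proj y"
      "z \<in> carrier \<W>" "C = proj z"
      by (auto simp: Q_carrier)
    then show "(A \<oplus>\<^bsub>\<Q>\<^esub> B) \<oplus>\<^bsub>\<Q>\<^esub> C = A \<oplus>\<^bsub>\<Q>\<^esub> (B \<oplus>\<^bsub>\<Q>\<^esub> C)"
      by (simp add: proj_add W.L.M.a_assoc)
  next
    fix A B assume "A \<in> carrier \<Q>" "B \<in> carrier \<Q>"
    then obtain x y where "x \<in> carrier \<W>" "A = proj x" "y \<in> carrier \<W>" "B = proj y"
      by (auto simp: Q_carrier)
    then show "A \<oplus>\<^bsub>\<Q>\<^esub> B \<in> carrier \<Q>" "A \<oplus>\<^bsub>\<Q>\<^esub> B = B \<oplus>\<^bsub>\<Q>\<^esub> A"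
      by (simp_all add: proj_add proj_closed W.L.M.a_comm)
  next
    fix A assume "A \<in> carrier \<Q>"
    then obtain x where x: "x \<in> carrier \<W>" "A = proj x"
      by (auto simp: Q_carrier)
    then show "\<zero>\<^bsub>\<Q>\<^esub> \<oplus>\<^bsub>\<Q>\<^esub> A = A"
      by (simp add: proj_zero proj_add)
    show "\<exists>B\<in>carrier \<Q>. B \<oplus>\<^bsub>\<Q>\<^esub> A = \<zero>\<^bsub>\<Q>\<^esub>"
      using x by (intro bexI[of _ "proj (\<ominus>\<^bsub>\<W>\<^esub> x)"]) (simp_all add: proj_zero proj_add proj_closed W.L.M.l_neg)
  qed (simp add: proj_zero proj_closed)
  then show ?thesis
  proof (rule real_normed_spaceI)
    fix r s A assume "A \<in> carrier \<Q>"
    then obtain x where x: "x \<in> carrier \<W>" and A: "A = proj x"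
      by (auto simp: Q_carrier)
    show "r \<odot>\<^bsub>\<Q>\<^esub> A \<in> carrier \<Q>"
      using x by (simp add: A proj_smult proj_closed)
    show "(r + s) \<odot>\<^bsub>\<Q>\<^esub> A = r \<odot>\<^bsub>\<Q>\<^esub> A \<oplus>\<^bsub>\<Q>\<^esub> s \<odot>\<^bsub>\<Q>\<^esub> A"
      using x by (simp add: A proj_smult proj_add W.L.scale_left_distrib)
    show "(r * s) \<odot>\<^bsub>\<Q>\<^esub> A = r \<odot>\<^bsub>\<Q>\<^esub> (s \<odot>\<^bsub>\<Q>\<^esub> A)"
      using x by (simp add: A proj_smult W.L.scale_scale)
    show "1 \<odot>\<^bsub>\<Q>\<^esub> A = A"
      using x by (simp add: A proj_smult)
    show "vnorm \<Q> A = 0 \<longleftrightarrow> A = \<zero>\<^bsub>\<Q>\<^esub>"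
    proof
      assume "vnorm \<Q> A = 0"
      then have "x \<in> \<N>"
        using vnorm_proj_tendsto[OF x] x by (simp add: A c0_iff)
      then have "A = \<N>"
        using c0.a_rcos_const by (simp add: A proj_def)
      then show "A = \<zero>\<^bsub>\<Q>\<^esub>"
        by (simp add: ultraproduct_def vquotient_def)
    next
      assume "A = \<zero>\<^bsub>\<Q>\<^esub>"
      then show "vnorm \<Q> A = 0"
        using vnorm_proj_eq[of "\<zero>\<^bsub>\<W>\<^esub>" 0] by (simp add: proj_zero W_apply)
    qed
    have "((\<lambda>i. vnorm (X i) ((r \<odot>\<^bsub>\<W>\<^esub> x) i)) \<longlongrightarrow> \<bar>r\<bar> * vnorm \<Q> (proj x)) U"
      using tendsto_mult[OF tendsto_const[of "\<bar>r\<bar>"] vnorm_proj_tendsto[OF x]] x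
      by (simp add: W_apply Xi.vnorm_smult W_carrierD)
    then show "vnorm \<Q> (r \<odot>\<^bsub>\<Q>\<^esub> A) = \<bar>r\<bar> * vnorm \<Q> A"
      using x by (simp add: A proj_smult vnorm_proj_eq)
  next
    fix r A B assume "A \<in> carrier \<Q>" "B \<in> carrier \<Q>"
    then obtain x y where x: "x \<in> carrier \<W>" and A: "A = proj x"
      and y: "y \<in> carrier \<W>" and B: "B = proj y"
      by (auto simp: Q_carrier)
    show "r \<odot>\<^bsub>\<Q>\<^esub> (A \<oplus>\<^bsub>\<Q>\<^esub> B) = r \<odot>\<^bsub>\<Q>\<^esub> A \<oplus>\<^bsub>\<Q>\<^esub> r \<odot>\<^bsub>\<Q>\<^esub> B"
      using x y by (simp add: A B proj_smult proj_add W.L.scale_right_distrib)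
    have "x \<oplus>\<^bsub>\<W>\<^esub> y \<in> carrier \<W>"
      using x y by simp
    then have "vnorm \<Q> (proj (x \<oplus>\<^bsub>\<W>\<^esub> y)) \<le> vnorm \<Q> (proj x) + vnorm \<Q> (proj y)"
      by (rule tendsto_le[OF nontrivial tendsto_add[OF vnorm_proj_tendsto[OF x] vnorm_proj_tendsto[OF y]]
            vnorm_proj_tendsto])
        (use x y in \<open>auto simp: W_apply W_carrierD intro!: always_eventually Xi.vnorm_triangle\<close>)
    then show "vnorm \<Q> (A \<oplus>\<^bsub>\<Q>\<^esub> B) \<le> vnorm \<Q> A + vnorm \<Q> B"
      using x y by (simp add: A B proj_add)
  qed
qed

sublocale Q: real_normed_space \<Q>
  by (rule real_normed_space_ultraproduct)

lemma proj_minus: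
  assumes "x \<in> carrier \<W>" "y \<in> carrier \<W>"
  shows "proj (x \<ominus>\<^bsub>\<W>\<^esub> y) = proj x \<ominus>\<^bsub>\<Q>\<^esub> proj y"
  using assms
  by (simp add: W.L.M.minus_eq Q.M.minus_eq proj_add[symmetric] proj_smult[symmetric] proj_closed
      W.L.smult_minus_one[symmetric] Q.smult_minus_one[symmetric])

lemma proj_finsum:
  assumes "finite A" "g \<in> A \<rightarrow> carrier \<W>"
  shows "proj (finsum \<W> g A) = (\<Oplus>\<^bsub>\<Q>\<^esub>a\<in>A. proj (g a))"
  by (rule finsum_additive[OF W.L.M.abelian_group_axioms Q.M.abelian_group_axioms])
    (use assms in \<open>auto simp: proj_closed proj_add\<close>)

lemma W_finsum_apply:
  assumes "finite A" "g \<in> A \<rightarrow> carrier \<W>"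
  shows "finsum \<W> g A i = (\<Oplus>\<^bsub>X i\<^esub>a\<in>A. g a i)"
  using W.linf_finsum_apply[of i A g] assms by simp

section \<open>Passing inequalities, representatives and coefficients to the ultraproduct\<close>

lemma vnorm_proj_leI:
  assumes "x \<in> carrier \<W>" "eventually (\<lambda>i. vnorm (X i) (x i) \<le> B) U"
  shows "vnorm \<Q> (proj x) \<le> B"
  using tendsto_upperbound[OF vnorm_proj_tendsto[OF assms(1)] assms(2) nontrivial] .

lemma vnorm_proj_geI:
  assumes "x \<in> carrier \<W>" "eventually (\<lambda>i. B \<le> vnorm (X i) (x i)) U"
  shows "B \<le> vnorm \<Q> (proj x)"
  using tendsto_lowerbound[OF vnorm_proj_tendsto[OF assms(1)] assms(2) nontrivial] .

text \<open>The quotient norm is an infimum, so a class of norm at most 1 might only have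
  representatives slightly outside the unit ball. Dividing coordinate \<open>i\<close> by
  \<open>max 1 (vnorm (X i) (y i))\<close> repairs this within the class, because these divisors
  tend to 1. The exact bound allows the direction from the SD2P to \<open>D\<close> to keep radius
  1.\<close>

lemma contractive_representative:
  assumes "A \<in> vball \<Q>"
  obtains x where "x \<in> carrier \<W>" "A = proj x" "\<And>i. vnorm (X i) (x i) \<le> 1"
proof -
  obtain y where y: "y \<in> carrier \<W>" and A: "A = proj y"
    using assms by (auto simp: vball_def Q_carrier)
  define m where "m = (\<lambda>i. max 1 (vnorm (X i) (y i)))"
  define x where "x = (\<lambda>i. inverse (m i) \<odot>\<^bsub>X i\<^esub> y i)"
  have m: "1 \<le> m i" "vnorm (X i) (y i) \<le> m i" for i
    by (simp_all add: m_def)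
  have xi: "x i \<in> carrier (X i)" for i
    using y by (simp add: x_def W_carrierD)
  have norm: "vnorm (X i) (x i) \<le> 1" for i
    using m[of i] y by (simp add: x_def Xi.vnorm_smult W_carrierD field_simps)
  have x: "x \<in> carrier \<W>"
    using xi norm by (rule W_carrierI)
  have "x \<ominus>\<^bsub>\<W>\<^esub> y \<in> \<N>"
  proof (rule c0_dominated)
    have "vnorm (X i) ((x \<ominus>\<^bsub>\<W>\<^esub> y) i) \<le> m i - 1" for i
    proof -
      have yi: "y i \<in> carrier (X i)"
        using y by (simp add: W_carrierD)
      have "(inverse (m i) + - 1) \<odot>\<^bsub>X i\<^esub> y i = x i \<oplus>\<^bsub>X i\<^esub> (- 1) \<odot>\<^bsub>X i\<^esub> y i"
        using yi by (simp add: x_def Xi.scale_left_distrib del: add_uminus_conv_diff)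
      then have "(x \<ominus>\<^bsub>\<W>\<^esub> y) i = (inverse (m i) + - 1) \<odot>\<^bsub>X i\<^esub> y i"
        using x y yi by (simp add: W_minus_apply Xi.M.minus_eq Xi.smult_minus_one)
      then have "vnorm (X i) ((x \<ominus>\<^bsub>\<W>\<^esub> y) i) = (1 - inverse (m i)) * vnorm (X i) (y i)"
        using m(1)[of i] yi by (simp add: Xi.vnorm_smult inverse_le_1_iff)
      also have "\<dots> \<le> (1 - inverse (m i)) * m i"
        using m[of i] by (intro mult_left_mono) (auto simp: inverse_le_1_iff)
      also have "\<dots> = m i - 1"
        using m(1)[of i] by (simp add: field_simps)
      finally show ?thesis .
    qed
    then show "eventually (\<lambda>i. vnorm (X i) ((x \<ominus>\<^bsub>\<W>\<^esub> y) i) \<le> m i - 1) U"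
      by simp
    have "((\<lambda>i. m i - 1) \<longlongrightarrow> max 1 (vnorm \<Q> (proj y)) - 1) U"
      unfolding m_def by (intro tendsto_intros vnorm_proj_tendsto y)
    then show "((\<lambda>i. m i - 1) \<longlongrightarrow> 0) U"
      using assms by (simp add: A vball_def max_absorb1)
  qed (use x y in auto)
  then have "A = proj x"
    unfolding A using x y by (intro proj_eqI)
  then show ?thesis
    using that x norm by blast
qed

text \<open>Coefficients that vary with the fibre become one scalar in the quotient, since the error
  is at most \<open>\<bar>c i - T\<bar>\<close> times a constant. The bound on \<open>c\<close>
  keeps the family bounded.\<close>

lemma proj_varying_scale:
  assumes v: "v \<in> carrier \<W>" and c: "\<And>i. \<bar>c i\<bar> \<le> 1" "(c \<longlongrightarrow> T) U"
  shows "(\<lambda>i. c i \<odot>\<^bsub>X i\<^esub> v i) \<in> carrier \<W>"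
    and "proj (\<lambda>i. c i \<odot>\<^bsub>X i\<^esub> v i) = T \<odot>\<^bsub>\<Q>\<^esub> proj v"
proof -
  let ?cv = "\<lambda>i. c i \<odot>\<^bsub>X i\<^esub> v i"
  have vi: "v i \<in> carrier (X i)" "0 \<le> vnorm (X i) (v i)" "vnorm (X i) (v i) \<le> vnorm \<W> v" for i
    using v W_vnorm_apply_le by (auto simp: W_carrierD Xi.vnorm_nonneg)
  have "vnorm (X i) (?cv i) \<le> vnorm \<W> v" for i
    using vi[of i] mult_right_mono[OF c(1)[of i] vi(2)[of i]] by (simp add: Xi.vnorm_smult)
  then show cv: "?cv \<in> carrier \<W>"
    using vi(1) by (intro W_carrierI) auto
  have "?cv \<ominus>\<^bsub>\<W>\<^esub> T \<odot>\<^bsub>\<W>\<^esub> v \<in> \<N>"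
  proof (rule c0_dominated)
    have "vnorm (X i) ((?cv \<ominus>\<^bsub>\<W>\<^esub> T \<odot>\<^bsub>\<W>\<^esub> v) i) \<le> \<bar>c i - T\<bar> * vnorm \<W> v" for i
    proof -
      have "(c i + - T) \<odot>\<^bsub>X i\<^esub> v i = c i \<odot>\<^bsub>X i\<^esub> v i \<oplus>\<^bsub>X i\<^esub> (- 1) \<odot>\<^bsub>X i\<^esub> (T \<odot>\<^bsub>X i\<^esub> v i)"
        using vi(1) by (simp add: Xi.scale_left_distrib Xi.scale_scale del: add_uminus_conv_diff)
      then have "(?cv \<ominus>\<^bsub>\<W>\<^esub> T \<odot>\<^bsub>\<W>\<^esub> v) i = (c i + - T) \<odot>\<^bsub>X i\<^esub> v i"
        using cv v vi(1) by (simp add: W_minus_apply W_apply Xi.M.minus_eq Xi.smult_minus_one)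
      then show ?thesis
        using vi[of i] by (simp add: Xi.vnorm_smult mult_left_mono)
    qed
    then show "eventually (\<lambda>i. vnorm (X i) ((?cv \<ominus>\<^bsub>\<W>\<^esub> T \<odot>\<^bsub>\<W>\<^esub> v) i) \<le> \<bar>c i - T\<bar> * vnorm \<W> v) U"
      by simp
    have "((\<lambda>i. \<bar>c i - T\<bar> * vnorm \<W> v) \<longlongrightarrow> \<bar>T - T\<bar> * vnorm \<W> v) U"
      by (intro tendsto_intros c(2))
    then show "((\<lambda>i. \<bar>c i - T\<bar> * vnorm \<W> v) \<longlongrightarrow> 0) U"
      by simp
  qed (use cv v in auto)
  then have "proj (T \<odot>\<^bsub>\<W>\<^esub> v) = proj ?cv"
    using cv v by (intro proj_eqI) auto
  then show "proj ?cv = T \<odot>\<^bsub>\<Q>\<^esub> proj v"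
    using v by (simp add: proj_smult)
qed

end

text \<open>The length of a combination may vary from fibre to fibre. Padding with zero weights
  gives exactly \<open>m\<close> terms everywhere, so that the l-th weights and l-th tuples form
  families indexed by the fibres.\<close>

lemma (in real_normed_space) Cset_padded:
  assumes n: "1 \<le> n" and y: "y \<in> Cset m n \<epsilon> \<alpha> V"
  shows "\<exists>t w. (\<forall>l\<in>{1..m}. 0 \<le> t l \<and> w l \<in> large_tuples n \<epsilon> \<alpha> V) \<and> (\<Sum>l\<in>{1..m}. t l) = 1 \<and>
    y = (\<Oplus>\<^bsub>linf_n n V\<^esub>l\<in>{1..m}. t l \<odot>\<^bsub>linf_n n V\<^esub> w l)"
proof -
  let ?L = "linf_n n V"
  interpret N: normed_family "{1..n}" "\<lambda>_. V"
    using n by (rule normed_family_n)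
  obtain k t w where k: "k \<le> m" and tw: "\<And>l. l \<in> {1..k} \<Longrightarrow> 0 \<le> t l \<and> w l \<in> large_tuples n \<epsilon> \<alpha> V"
    and sum: "(\<Sum>l\<in>{1..k}. t l) = 1" and y_eq: "y = (\<Oplus>\<^bsub>?L\<^esub>l\<in>{1..k}. t l \<odot>\<^bsub>?L\<^esub> w l)"
    using y unfolding Cset_eq co_def by blast
  \<comment> \<open>An empty combination has total weight 0, so there is a first tuple; it fills the
    added places.\<close>
  have "k \<noteq> 0"
    using sum by (intro notI) simp
  then have w1: "w 1 \<in> large_tuples n \<epsilon> \<alpha> V"
    using tw[of 1] by simp
  define t' where "t' = (\<lambda>l. if l \<le> k then t l else 0)"
  define w' where "w' = (\<lambda>l. if l \<le> k then w l else w 1)"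
  have tw': "0 \<le> t' l \<and> w' l \<in> large_tuples n \<epsilon> \<alpha> V" if "l \<in> {1..m}" for l
    using tw[of l] w1 that by (simp add: t'_def w'_def)
  have w'c: "w' l \<in> carrier ?L" if "l \<in> {1..m}" for l
    using tw'[OF that] subsetD[OF large_tuples_subset] by blast
  have "(\<Sum>l\<in>{1..m}. t' l) = (\<Sum>l\<in>{1..k}. t l)"
    using k by (intro sum.mono_neutral_cong_right) (auto simp: t'_def)
  moreover have "y = (\<Oplus>\<^bsub>?L\<^esub>l\<in>{1..m}. t' l \<odot>\<^bsub>?L\<^esub> w' l)"
    unfolding y_eq
  proof (rule N.L.M.add.finprod_mono_neutral_cong_left)
    fix l assume l: "l \<in> {1..m} - {1..k}"
    then show "t' l \<odot>\<^bsub>?L\<^esub> w' l = \<zero>\<^bsub>?L\<^esub>"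
      using w'c[of l] by (simp add: t'_def)
  qed (use k w'c in \<open>auto simp: t'_def w'_def\<close>)
  ultimately show ?thesis
    using tw' sum by (intro exI[of _ t'] exI[of _ w']) simp
qed

section \<open>Transfer between the fibres and the ultraproduct\<close>

context normed_ultraproduct
begin

lemma vball_representatives:
  assumes n: "1 \<le> n" and z: "z \<in> vball (linf_n n \<Q>)"
  obtains x where "\<And>j. j \<in> {1..n} \<Longrightarrow> x j \<in> carrier \<W>" "\<And>j. j \<in> {1..n} \<Longrightarrow> z j = proj (x j)"
    "\<And>j i. j \<in> {1..n} \<Longrightarrow> vnorm (X i) (x j i) \<le> 1"
proof -
  interpret NQ: normed_family "{1..n}" "\<lambda>_. \<Q>"
    using n by (rule Q.normed_family_n)
  have "\<exists>x. x \<in> carrier \<W> \<and> z j = proj x \<and> (\<forall>i. vnorm (X i) (x i) \<le> 1)" if j: "j \<in> {1..n}" for j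
  proof -
    have "z j \<in> vball \<Q>"
      using z NQ.linf_carrierD[of z j] NQ.vnorm_apply_le[of z j] j by (auto simp: vball_def)
    then obtain x where "x \<in> carrier \<W>" "z j = proj x" "\<And>i. vnorm (X i) (x i) \<le> 1"
      by (rule contractive_representative) (rule that)
    then show ?thesis
      by auto
  qed
  then obtain x where "\<And>j. j \<in> {1..n} \<Longrightarrow>
      x j \<in> carrier \<W> \<and> z j = proj (x j) \<and> (\<forall>i. vnorm (X i) (x j i) \<le> 1)"
    by metis
  then show ?thesis
    by (intro that) auto
qed

lemma section_in_vball:
  assumes n: "1 \<le> n" and x: "\<And>j. j \<in> {1..n} \<Longrightarrow> x j \<in> carrier \<W>"
    "\<And>j i. j \<in> {1..n} \<Longrightarrow> vnorm (X i) (x j i) \<le> 1"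
  shows "(\<lambda>j\<in>{1..n}. x j i) \<in> vball (linf_n n (X i))"
proof -
  interpret N: normed_family "{1..n}" "\<lambda>_. X i"
    using n by (rule Xi.normed_family_n)
  show ?thesis
    unfolding vball_def using x
    by (auto intro!: N.linf_vnorm_leI N.linf_carrierI[where B = 1] simp: W_carrierD)
qed

text \<open>With \<open>m\<close> fixed, fibrewise approximations assemble into \<open>m\<close>
  tuples of the ultraproduct, weighted by the limits of the fibrewise weights.\<close>

lemma approximable_ultraproduct:
  assumes D: "\<And>n \<epsilon> \<delta>. 1 \<le> n \<Longrightarrow> 0 < \<epsilon> \<Longrightarrow> 0 < \<delta> \<Longrightarrow>
    \<exists>m. eventually (\<lambda>i. Dplus m n \<epsilon> (X i) < ennreal \<delta>) U"
  shows "approximable_by_large_tuples \<Q>"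
  unfolding approximable_by_large_tuples_def
proof (intro allI impI ballI)
  fix n :: nat and \<epsilon> \<delta> :: real and z
  assume n: "1 \<le> n" and \<epsilon>: "0 < \<epsilon>" and \<delta>: "0 < \<delta>" and z: "z \<in> vball (linf_n n \<Q>)"
  let ?L = "\<lambda>i. linf_n n (X i)" and ?LQ = "linf_n n \<Q>"
  interpret N: normed_family "{1..n}" "\<lambda>_. X i" for i
    using n by (rule Xi.normed_family_n)
  interpret NQ: normed_family "{1..n}" "\<lambda>_. \<Q>"
    using n by (rule Q.normed_family_n)
  obtain x where x: "\<And>j. j \<in> {1..n} \<Longrightarrow> x j \<in> carrier \<W>" "\<And>j. j \<in> {1..n} \<Longrightarrow> z j = proj (x j)"
    "\<And>j i. j \<in> {1..n} \<Longrightarrow> vnorm (X i) (x j i) \<le> 1"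
    by (rule vball_representatives[OF n z]) (rule that)
  define \<zeta> where "\<zeta> = (\<lambda>i. \<lambda>j\<in>{1..n}. x j i)"
  have \<zeta>: "\<zeta> i \<in> vball (?L i)" for i
    unfolding \<zeta>_def using n x(1,3) by (rule section_in_vball)
  \<comment> \<open>Strict inequalities become weak in the limit; halving both constants leaves room
    to make them strict again.\<close>
  have \<epsilon>2: "0 < \<epsilon> / 2" and \<delta>2: "0 < \<delta> / 2"
    using \<epsilon> \<delta> by auto
  obtain m where m: "eventually (\<lambda>i. Dplus m n (\<epsilon> / 2) (X i) < ennreal (\<delta> / 2)) U"
    using D[OF n \<epsilon>2 \<delta>2] by blast
  define approx where "approx = (\<lambda>i t w. (\<Sum>l\<in>{1..m}. t l) = (1 :: real) \<and>
      (\<forall>l\<in>{1..m}. w l \<in> large_tuples n (\<epsilon> / 2) (1 + \<epsilon> / 2) (X i)) \<and>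
      vnorm (?L i) (\<zeta> i \<ominus>\<^bsub>?L i\<^esub> (\<Oplus>\<^bsub>?L i\<^esub>l\<in>{1..m}. t l \<odot>\<^bsub>?L i\<^esub> w l)) \<le> \<delta> / 2)"
  \<comment> \<open>Where the distance is not small, zero weights and zero tuples are chosen. The
    bounds therefore hold in every fibre, as membership in \<open>\<W>\<close> demands, while
    \<open>approx\<close> holds only along \<open>U\<close>.\<close>
  have "\<exists>t w. (\<forall>l\<in>{1..m}. 0 \<le> t l \<and> t l \<le> 1 \<and> w l \<in> carrier (?L i) \<and> vnorm (?L i) (w l) \<le> 1 + \<epsilon> / 2) \<and>
      (Dplus m n (\<epsilon> / 2) (X i) < ennreal (\<delta> / 2) \<longrightarrow> approx i t w)" for i
  proof (cases "Dplus m n (\<epsilon> / 2) (X i) < ennreal (\<delta> / 2)")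
    case True
    have "vsetdist (?L i) (\<zeta> i) (Cset m n (\<epsilon> / 2) (1 + \<epsilon> / 2) (X i)) \<le> Dplus m n (\<epsilon> / 2) (X i)"
      unfolding Dgen_def using \<zeta> by (rule SUP_upper)
    also note True
    finally obtain y where y: "y \<in> Cset m n (\<epsilon> / 2) (1 + \<epsilon> / 2) (X i)"
      and dist: "ennreal (vdist (?L i) (\<zeta> i) y) < ennreal (\<delta> / 2)"
      unfolding vsetdist_def INF_less_iff by blast
    obtain t w where tw: "\<And>l. l \<in> {1..m} \<Longrightarrow> 0 \<le> t l \<and> w l \<in> large_tuples n (\<epsilon> / 2) (1 + \<epsilon> / 2) (X i)"
      and sum: "(\<Sum>l\<in>{1..m}. t l) = 1" and y_eq: "y = (\<Oplus>\<^bsub>?L i\<^esub>l\<in>{1..m}. t l \<odot>\<^bsub>?L i\<^esub> w l)"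
      using Xi.Cset_padded[OF n y] by blast
    have wc: "w l \<in> carrier (?L i)" "vnorm (?L i) (w l) \<le> 1 + \<epsilon> / 2" if "l \<in> {1..m}" for l
      using tw[OF that] by (auto simp: large_tuples_def)
    have "t l \<le> 1" if "l \<in> {1..m}" for l
      using member_le_sum[of l "{1..m}" t] tw that sum by auto
    moreover have "y \<in> carrier (?L i)"
      unfolding y_eq using wc by (intro N.L.M.finsum_closed) auto
    then have "vnorm (?L i) (\<zeta> i \<ominus>\<^bsub>?L i\<^esub> y) \<le> \<delta> / 2"
      using dist \<zeta>[of i] by (simp add: vdist_def vball_def ennreal_less_iff N.L.vnorm_nonneg)
    ultimately show ?thesis
      using tw wc sum y_eq by (intro exI[of _ t] exI[of _ w]) (simp add: approx_def)
  next
    case False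
    then show ?thesis
      using \<epsilon> by (intro exI[of _ "\<lambda>_. 0"] exI[of _ "\<lambda>_. \<zero>\<^bsub>?L i\<^esub>"]) simp
  qed
  then obtain t w where t: "\<And>i l. l \<in> {1..m} \<Longrightarrow> 0 \<le> t i l \<and> t i l \<le> 1"
    and w: "\<And>i l. l \<in> {1..m} \<Longrightarrow> w i l \<in> carrier (?L i) \<and> vnorm (?L i) (w i l) \<le> 1 + \<epsilon> / 2"
    and approx: "\<And>i. Dplus m n (\<epsilon> / 2) (X i) < ennreal (\<delta> / 2) \<Longrightarrow> approx i (t i) (w i)"
    by metis
  have ev: "eventually (\<lambda>i. approx i (t i) (w i)) U"
    using m by eventually_elim (rule approx)
  have "\<exists>T. ((\<lambda>i. t i l) \<longlongrightarrow> T) U" if l: "l \<in> {1..m}" for l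
  proof -
    have "\<bar>t i l\<bar> \<le> 1" for i
      using t[OF l] by (simp add: abs_le_iff)
    then show ?thesis
      using ultrafilter_tendsto[OF ultrafilter] by metis
  qed
  then obtain T where T: "\<And>l. l \<in> {1..m} \<Longrightarrow> ((\<lambda>i. t i l) \<longlongrightarrow> T l) U"
    by metis
  have T_nonneg: "0 \<le> T l" if "l \<in> {1..m}" for l
    by (rule tendsto_lowerbound[OF T[OF that] _ nontrivial]) (use t that in auto)
  have T_sum: "(\<Sum>l\<in>{1..m}. T l) = 1"
  proof (rule tendsto_unique[OF nontrivial])
    show "((\<lambda>i. \<Sum>l\<in>{1..m}. t i l) \<longlongrightarrow> (\<Sum>l\<in>{1..m}. T l)) U"
      by (intro tendsto_sum T)
    show "((\<lambda>i. \<Sum>l\<in>{1..m}. t i l) \<longlongrightarrow> 1) U"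
      by (rule tendsto_eventually, rule eventually_mono[OF ev]) (simp add: approx_def)
  qed
  \<comment> \<open>The same data with the fibre as last index: \<open>v l j\<close> is a bounded
    family, representing coordinate \<open>j\<close> of the l-th tuple.\<close>
  define v where "v = (\<lambda>l j i. w i l j)"
  have v_norm: "vnorm (X i) (v l j i) \<le> 1 + \<epsilon> / 2" and v: "v l j \<in> carrier \<W>"
    if l: "l \<in> {1..m}" and j: "j \<in> {1..n}" for l j i
  proof -
    have "v l j i \<in> carrier (X i) \<and> vnorm (X i) (v l j i) \<le> 1 + \<epsilon> / 2" for i
      using w[OF l, of i] N.linf_carrierD[OF _ j, of "w i l"] N.vnorm_apply_le[OF _ j, of "w i l"]
      by (force simp: v_def)
    then show "vnorm (X i) (v l j i) \<le> 1 + \<epsilon> / 2" "v l j \<in> carrier \<W>"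
      by (auto intro: W_carrierI)
  qed
  define p where "p = (\<lambda>l. \<lambda>j\<in>{1..n}. proj (v l j))"
  have proj_v: "vnorm \<Q> (proj (v l j)) \<le> 1 + \<epsilon>" if "l \<in> {1..m}" "j \<in> {1..n}" for l j
  proof (rule vnorm_proj_leI[OF v[OF that]])
    have "vnorm (X i) (v l j i) \<le> 1 + \<epsilon>" for i
      using v_norm[OF that, of i] \<epsilon> by simp
    then show "eventually (\<lambda>i. vnorm (X i) (v l j i) \<le> 1 + \<epsilon>) U"
      by simp
  qed
  have pc: "p l \<in> carrier ?LQ" if l: "l \<in> {1..m}" for l
    unfolding p_def using v[OF l] proj_v[OF l]
    by (intro NQ.linf_carrierI[where B = "1 + \<epsilon>"]) (auto intro: proj_closed)
  have p: "p l \<in> large_tuples n \<epsilon> (1 + \<epsilon>) \<Q>" if l: "l \<in> {1..m}" for l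
  proof -
    have "vnorm ?LQ (p l) \<le> 1 + \<epsilon>"
      unfolding p_def using proj_v[OF l] by (intro NQ.linf_vnorm_leI) auto
    moreover have "(\<Oplus>\<^bsub>\<Q>\<^esub>j\<in>{1..n}. p l j) = (\<Oplus>\<^bsub>\<Q>\<^esub>j\<in>{1..n}. proj (v l j))"
      using v[OF l] by (intro Q.M.finsum_cong') (auto simp: p_def proj_closed)
    then have "(\<Oplus>\<^bsub>\<Q>\<^esub>j\<in>{1..n}. p l j) = proj (\<Oplus>\<^bsub>\<W>\<^esub>j\<in>{1..n}. v l j)"
      using v[OF l] by (subst proj_finsum) auto
    moreover have "n * (1 - \<epsilon> / 2) \<le> vnorm \<Q> (proj (\<Oplus>\<^bsub>\<W>\<^esub>j\<in>{1..n}. v l j))"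
    proof (rule vnorm_proj_geI)
      show "(\<Oplus>\<^bsub>\<W>\<^esub>j\<in>{1..n}. v l j) \<in> carrier \<W>"
        using v[OF l] by (intro W.L.M.finsum_closed) auto
      show "eventually (\<lambda>i. n * (1 - \<epsilon> / 2) \<le> vnorm (X i) ((\<Oplus>\<^bsub>\<W>\<^esub>j\<in>{1..n}. v l j) i)) U"
        using ev
      proof eventually_elim
        case (elim i)
        then have "1 - \<epsilon> / 2 < 1 / n * vnorm (X i) (\<Oplus>\<^bsub>X i\<^esub>j\<in>{1..n}. w i l j)"
          using l by (simp add: approx_def large_tuples_def)
        then have "n * (1 - \<epsilon> / 2) \<le> vnorm (X i) (\<Oplus>\<^bsub>X i\<^esub>j\<in>{1..n}. w i l j)"
          using n by (simp add: field_simps)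
        moreover have "(\<Oplus>\<^bsub>\<W>\<^esub>j\<in>{1..n}. v l j) i = (\<Oplus>\<^bsub>X i\<^esub>j\<in>{1..n}. w i l j)"
          using v[OF l] by (subst W_finsum_apply) (auto simp: v_def)
        ultimately show ?case
          by simp
      qed
    qed
    moreover have "n * (1 - \<epsilon>) < n * (1 - \<epsilon> / 2)"
      using n \<epsilon> by simp
    ultimately show ?thesis
      using pc[OF l] n by (simp add: large_tuples_def field_simps)
  qed
  define y where "y = (\<Oplus>\<^bsub>?LQ\<^esub>l\<in>{1..m}. T l \<odot>\<^bsub>?LQ\<^esub> p l)"
  have yc: "y \<in> carrier ?LQ"
    unfolding y_def using pc by (intro NQ.L.M.finsum_closed) auto
  have "y \<in> Cset m n \<epsilon> (1 + \<epsilon>) \<Q>"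
    unfolding Cset_eq y_def using p pc T_nonneg T_sum
    by (intro co_memI NQ.L.M.abelian_monoid_axioms) auto
  moreover have "vdist ?LQ z y < \<delta>"
  proof -
    have zc: "z \<in> carrier ?LQ"
      using z by (simp add: vball_def)
    have "vnorm ?LQ (z \<ominus>\<^bsub>?LQ\<^esub> y) \<le> \<delta> / 2"
    proof (rule NQ.linf_vnorm_leI)
      fix j assume j: "j \<in> {1..n}"
      \<comment> \<open>The fibrewise terms keep the weights \<open>t i l\<close>, whose limits are
        the weights \<open>T l\<close> of \<open>y\<close>. Hence the distance can be estimated in
        the fibres, where \<open>approx\<close> applies.\<close>
      define b where "b = (\<lambda>l i. t i l \<odot>\<^bsub>X i\<^esub> v l j i)"
      have b: "b l \<in> carrier \<W>" "proj (b l) = T l \<odot>\<^bsub>\<Q>\<^esub> proj (v l j)" if l: "l \<in> {1..m}" for l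
      proof -
        have "\<bar>t i l\<bar> \<le> 1" for i
          using t[OF l] by (simp add: abs_le_iff)
        from proj_varying_scale[OF v[OF l j] this T[OF l]]
        show "b l \<in> carrier \<W>" "proj (b l) = T l \<odot>\<^bsub>\<Q>\<^esub> proj (v l j)"
          by (simp_all add: b_def)
      qed
      define B where "B = (\<Oplus>\<^bsub>\<W>\<^esub>l\<in>{1..m}. b l)"
      have B: "B \<in> carrier \<W>"
        unfolding B_def using b by (intro W.L.M.finsum_closed) auto
      have "y j = (\<Oplus>\<^bsub>\<Q>\<^esub>l\<in>{1..m}. (T l \<odot>\<^bsub>?LQ\<^esub> p l) j)"
        unfolding y_def using j pc by (intro NQ.linf_finsum_apply) auto
      also have "\<dots> = (\<Oplus>\<^bsub>\<Q>\<^esub>l\<in>{1..m}. proj (b l))"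
        using j b v[OF _ j] by (intro Q.M.finsum_cong') (auto simp: NQ.linf_smult_apply p_def proj_closed)
      also have "\<dots> = proj B"
        unfolding B_def using b by (intro proj_finsum[symmetric]) auto
      finally have "(z \<ominus>\<^bsub>?LQ\<^esub> y) j = proj (x j \<ominus>\<^bsub>\<W>\<^esub> B)"
        using zc yc j x B by (simp add: NQ.linf_minus_apply proj_minus)
      moreover have "vnorm \<Q> (proj (x j \<ominus>\<^bsub>\<W>\<^esub> B)) \<le> \<delta> / 2"
      proof (rule vnorm_proj_leI)
        show "x j \<ominus>\<^bsub>\<W>\<^esub> B \<in> carrier \<W>"
          using x(1)[OF j] B by simp
        show "eventually (\<lambda>i. vnorm (X i) ((x j \<ominus>\<^bsub>\<W>\<^esub> B) i) \<le> \<delta> / 2) U"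
          using ev
        proof eventually_elim
          case (elim i)
          let ?s = "\<Oplus>\<^bsub>?L i\<^esub>l\<in>{1..m}. t i l \<odot>\<^bsub>?L i\<^esub> w i l"
          have wc: "w i l \<in> carrier (?L i)" if "l \<in> {1..m}" for l
            using w[OF that] by blast
          have s: "?s \<in> carrier (?L i)"
            using wc by (intro N.L.M.finsum_closed) auto
          have "?s j = (\<Oplus>\<^bsub>X i\<^esub>l\<in>{1..m}. (t i l \<odot>\<^bsub>?L i\<^esub> w i l) j)"
            using j wc by (intro N.linf_finsum_apply) auto
          also have "\<dots> = (\<Oplus>\<^bsub>X i\<^esub>l\<in>{1..m}. b l i)"
            using j N.linf_carrierD[OF wc j]
            by (intro Xi.M.finsum_cong') (auto simp: N.linf_smult_apply b_def v_def)
          also have "\<dots> = B i"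
            unfolding B_def using b by (intro W_finsum_apply[symmetric]) auto
          finally have "(\<zeta> i \<ominus>\<^bsub>?L i\<^esub> ?s) j = (x j \<ominus>\<^bsub>\<W>\<^esub> B) i"
            using \<zeta>[of i] s j x(1)[OF j] B
            by (simp add: N.linf_minus_apply vball_def W_minus_apply) (simp add: \<zeta>_def)
          moreover have "vnorm (X i) ((\<zeta> i \<ominus>\<^bsub>?L i\<^esub> ?s) j) \<le> vnorm (?L i) (\<zeta> i \<ominus>\<^bsub>?L i\<^esub> ?s)"
            using \<zeta>[of i] s j by (intro N.vnorm_apply_le) (simp_all add: vball_def)
          ultimately show ?case
            using elim by (simp add: approx_def)
        qed
      qed
      ultimately show "vnorm \<Q> ((z \<ominus>\<^bsub>?LQ\<^esub> y) j) \<le> \<delta> / 2"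
        by simp
    qed
    then show ?thesis
      using zc yc \<delta> by (simp add: vdist_def)
  qed
  ultimately show "\<exists>k. \<exists>y\<in>Cset k n \<epsilon> (1 + \<epsilon>) \<Q>. vdist ?LQ z y < \<delta>"
    by blast
qed

text \<open>If no \<open>m\<close> works, a depth \<open>M i\<close> that exceeds every fixed
  \<open>k\<close> along \<open>U\<close> is assigned to the fibres, and in fibre \<open>i\<close> a
  point is chosen that \<open>M i\<close> terms cannot approximate. The class of these points is
  approximated in the ultraproduct by some finite number \<open>k\<close> of terms, which yields
  k-term approximations in fibres with \<open>k < M i\<close>.\<close>

lemma SD2P_ultraproduct_imp_D:
  assumes SD2P: "SD2P \<Q>" and incomplete: "countably_incomplete U"
    and n: "1 \<le> n" and \<epsilon>: "0 < \<epsilon>" and \<delta>: "0 < \<delta>"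
  shows "\<exists>m\<ge>1. eventually (\<lambda>i. D m n \<epsilon> (X i) < ennreal \<delta>) U"
proof (rule ccontr)
  assume "\<not> ?thesis"
  then have large: "eventually (\<lambda>i. \<not> D (Suc k) n \<epsilon> (X i) < ennreal \<delta>) U" for k
    using ultrafilter by (auto simp: ultrafilter_def)
  let ?L = "\<lambda>i. linf_n n (X i)" and ?LQ = "linf_n n \<Q>"
  interpret N: normed_family "{1..n}" "\<lambda>_. X i" for i
    using n by (rule Xi.normed_family_n)
  interpret NQ: normed_family "{1..n}" "\<lambda>_. \<Q>"
    using n by (rule Q.normed_family_n)
  obtain \<F> :: "'i set set" where \<F>: "countable \<F>" "\<And>A. A \<in> \<F> \<Longrightarrow> eventually (\<lambda>i. i \<in> A) U" "\<Inter>\<F> = {}"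
    using incomplete by (auto simp: countably_incomplete_def)
  have "\<F> \<noteq> {}"
    using \<F>(3) by auto
  then have range: "range (from_nat_into \<F>) = \<F>"
    using \<F>(1) by (rule range_from_nat_into)
  \<comment> \<open>Quantifying over all \<open>l \<le> k\<close> makes the sets decreasing. Index
    \<open>l\<close> belongs to \<open>D (Suc l)\<close>, because only \<open>m \<ge> 1\<close> is
    refuted.\<close>
  define E where "E = (\<lambda>k i. \<forall>l\<le>k. i \<in> from_nat_into \<F> l \<and> \<not> D (Suc l) n \<epsilon> (X i) < ennreal \<delta>)"
  have E: "eventually (E k) U" for k
  proof -
    have "eventually (\<lambda>i. i \<in> from_nat_into \<F> l \<and> \<not> D (Suc l) n \<epsilon> (X i) < ennreal \<delta>) U" for l
      using \<F>(2)[OF from_nat_into[OF \<open>\<F> \<noteq> {}\<close>]] large by (rule eventually_conj)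
    then have "eventually (\<lambda>i. \<forall>l\<in>{..k}. i \<in> from_nat_into \<F> l \<and> \<not> D (Suc l) n \<epsilon> (X i) < ennreal \<delta>) U"
      by (intro eventually_ball_finite) auto
    then show ?thesis
      by eventually_elim (auto simp: E_def)
  qed
  have "\<exists>k. \<not> E k i" for i
  proof -
    obtain k where "i \<notin> from_nat_into \<F> k"
      using \<F>(3) range by (metis Inter_iff empty_iff rangeE)
    then show ?thesis
      by (auto simp: E_def)
  qed
  \<comment> \<open>The empty intersection of \<F> makes the least failing index exist in every
    fibre. The last index that holds is \<open>M i - 1\<close>, and it speaks about
    \<open>D (M i)\<close>.\<close>
  define M where "M = (\<lambda>i. LEAST k. \<not> E k i)"
  have M_le: "k < M i" if "E k i" for k i
  proof (rule ccontr)
    assume "\<not> k < M i"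
    moreover have "\<not> E (M i) i"
      unfolding M_def using \<open>\<exists>k. \<not> E k i\<close> by (rule LeastI_ex)
    ultimately show False
      using that by (auto simp: E_def)
  qed
  \<comment> \<open>A supremum of at least \<open>\<delta>\<close> need not be attained, hence the
    distance \<open>\<delta> / 2\<close>. Fibres with \<open>M i = 0\<close> carry no condition and
    receive the zero tuple.\<close>
  have "\<exists>z\<in>vball (?L i). 0 < M i \<longrightarrow> ennreal (\<delta> / 2) < vsetdist (?L i) z (Cset (M i) n \<epsilon> 1 (X i))" for i
  proof (cases "0 < M i")
    case True
    then have "E (M i - 1) i"
      using not_less_Least[of "M i - 1" "\<lambda>k. \<not> E k i"] by (auto simp: M_def)
    then have "\<not> D (M i) n \<epsilon> (X i) < ennreal \<delta>"
      using True by (auto simp: E_def dest: spec[of _ "M i - 1"])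
    moreover have "ennreal (\<delta> / 2) < ennreal \<delta>"
      using \<delta> by (intro ennreal_lessI) auto
    ultimately have "ennreal (\<delta> / 2) < D (M i) n \<epsilon> (X i)"
      by simp
    then show ?thesis
      unfolding Dgen_def less_SUP_iff by blast
  next
    case False
    then show ?thesis
      by (intro bexI[OF _ N.L.zero_in_vball]) simp
  qed
  then obtain \<zeta> where \<zeta>: "\<And>i. \<zeta> i \<in> vball (?L i)"
    and far: "\<And>i. 0 < M i \<Longrightarrow> ennreal (\<delta> / 2) < vsetdist (?L i) (\<zeta> i) (Cset (M i) n \<epsilon> 1 (X i))"
    by metis
  define x where "x = (\<lambda>j i. \<zeta> i j)"
  have x_norm: "vnorm (X i) (x j i) \<le> 1" and x: "x j \<in> carrier \<W>" if j: "j \<in> {1..n}" for i j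
  proof -
    have "x j i \<in> carrier (X i) \<and> vnorm (X i) (x j i) \<le> 1" for i
      using \<zeta>[of i] N.linf_carrierD[OF _ j, of "\<zeta> i"] N.vnorm_apply_le[OF _ j, of "\<zeta> i"]
      by (force simp: x_def vball_def)
    then show "vnorm (X i) (x j i) \<le> 1" "x j \<in> carrier \<W>"
      by (auto intro: W_carrierI)
  qed
  define z where "z = (\<lambda>j\<in>{1..n}. proj (x j))"
  have z_norm: "vnorm \<Q> (proj (x j)) \<le> 1" if "j \<in> {1..n}" for j
    using x_norm[OF that] by (intro vnorm_proj_leI x[OF that]) simp
  have zc: "z \<in> carrier ?LQ"
    unfolding z_def using x z_norm
    by (intro NQ.linf_carrierI[where B = 1]) (auto intro: proj_closed)
  have "vnorm ?LQ z \<le> 1"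
    unfolding z_def using z_norm by (intro NQ.linf_vnorm_leI) auto
  then have z: "z \<in> vball ?LQ"
    using zc by (simp add: vball_def)
  have \<delta>2: "0 < \<delta> / 2"
    using \<delta> by simp
  obtain k y where y: "y \<in> Cset k n \<epsilon> 1 \<Q>" and dist: "vdist ?LQ z y < \<delta> / 2"
    by (rule Q.SD2P_imp_dense[OF SD2P n \<epsilon> \<delta>2 z]) (rule that)
  obtain t w where tw: "\<And>l. l \<in> {1..k} \<Longrightarrow> 0 \<le> t l \<and> w l \<in> large_tuples n \<epsilon> 1 \<Q>"
    and sum: "(\<Sum>l\<in>{1..k}. t l) = 1" and y_eq: "y = (\<Oplus>\<^bsub>?LQ\<^esub>l\<in>{1..k}. t l \<odot>\<^bsub>?LQ\<^esub> w l)"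
    using Q.Cset_padded[OF n y] by blast
  have w: "w l \<in> carrier ?LQ" "w l \<in> vball ?LQ" if "l \<in> {1..k}" for l
    using tw[OF that] by (auto simp: large_tuples_def vball_def)
  have yc: "y \<in> carrier ?LQ"
    unfolding y_eq using w by (intro NQ.L.M.finsum_closed) auto
  have "\<exists>v. \<forall>j\<in>{1..n}. v j \<in> carrier \<W> \<and> w l j = proj (v j) \<and> (\<forall>i. vnorm (X i) (v j i) \<le> 1)"
    if l: "l \<in> {1..k}" for l
  proof -
    obtain v where "\<And>j. j \<in> {1..n} \<Longrightarrow> v j \<in> carrier \<W>" "\<And>j. j \<in> {1..n} \<Longrightarrow> w l j = proj (v j)"
      "\<And>j i. j \<in> {1..n} \<Longrightarrow> vnorm (X i) (v j i) \<le> 1"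
      by (rule vball_representatives[OF n w(2)[OF l]]) (rule that)
    then show ?thesis
      by (intro exI[of _ v]) simp
  qed
  then obtain v where v': "\<And>l j. l \<in> {1..k} \<Longrightarrow> j \<in> {1..n} \<Longrightarrow>
      v l j \<in> carrier \<W> \<and> w l j = proj (v l j) \<and> (\<forall>i. vnorm (X i) (v l j i) \<le> 1)"
    by metis
  have v: "v l j \<in> carrier \<W>" "w l j = proj (v l j)" "vnorm (X i) (v l j i) \<le> 1"
    if "l \<in> {1..k}" "j \<in> {1..n}" for l j i
    using v'[OF that] by auto
  define u where "u = (\<lambda>i l. \<lambda>j\<in>{1..n}. v l j i)"
  have u: "u i l \<in> vball (?L i)" if l: "l \<in> {1..k}" for i l
    unfolding u_def using n v(1,3)[OF l] by (rule section_in_vball)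
  then have uc: "u i l \<in> carrier (?L i)" if "l \<in> {1..k}" for i l
    using that by (simp add: vball_def)
  \<comment> \<open>Largeness is a strict inequality for a limit, so it holds along \<open>U\<close>
    with the same \<open>\<epsilon>\<close>; the contractive representatives keep the norm bound
    1.\<close>
  have ev_large: "eventually (\<lambda>i. u i l \<in> large_tuples n \<epsilon> 1 (X i)) U" if l: "l \<in> {1..k}" for l
  proof -
    define V where "V = (\<Oplus>\<^bsub>\<W>\<^esub>j\<in>{1..n}. v l j)"
    have V: "V \<in> carrier \<W>"
      unfolding V_def using v(1)[OF l] by (intro W.L.M.finsum_closed) auto
    have "(\<Oplus>\<^bsub>\<Q>\<^esub>j\<in>{1..n}. w l j) = (\<Oplus>\<^bsub>\<Q>\<^esub>j\<in>{1..n}. proj (v l j))"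
      using v[OF l] by (intro Q.M.finsum_cong') (auto simp: proj_closed)
    also have "\<dots> = proj V"
      unfolding V_def using v(1)[OF l] by (intro proj_finsum[symmetric]) auto
    finally have "1 - \<epsilon> < 1 / n * vnorm \<Q> (proj V)"
      using tw[OF l] by (simp add: large_tuples_def)
    moreover have "((\<lambda>i. 1 / n * vnorm (X i) (V i)) \<longlongrightarrow> 1 / n * vnorm \<Q> (proj V)) U"
      by (intro tendsto_intros vnorm_proj_tendsto V)
    ultimately have "eventually (\<lambda>i. 1 - \<epsilon> < 1 / n * vnorm (X i) (V i)) U"
      by (rule order_tendstoD(1)[rotated])
    then show ?thesis
    proof eventually_elim
      case (elim i)
      have "V i = (\<Oplus>\<^bsub>X i\<^esub>j\<in>{1..n}. v l j i)"
        unfolding V_def using v(1)[OF l] by (intro W_finsum_apply) auto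
      also have "\<dots> = (\<Oplus>\<^bsub>X i\<^esub>j\<in>{1..n}. u i l j)"
        using v(1)[OF l] by (intro Xi.M.finsum_cong') (auto simp: u_def W_carrierD)
      finally show ?case
        using elim u[OF l, of i] by (simp add: large_tuples_def vball_def)
    qed
  qed
  let ?s = "\<lambda>i. \<Oplus>\<^bsub>?L i\<^esub>l\<in>{1..k}. t l \<odot>\<^bsub>?L i\<^esub> u i l"
  have s: "?s i \<in> carrier (?L i)" for i
    using uc by (intro N.L.M.finsum_closed) auto
  have ev_close: "eventually (\<lambda>i. vnorm (X i) ((\<zeta> i \<ominus>\<^bsub>?L i\<^esub> ?s i) j) < \<delta> / 2) U" if j: "j \<in> {1..n}" for j
  proof -
    define B where "B = (\<Oplus>\<^bsub>\<W>\<^esub>l\<in>{1..k}. t l \<odot>\<^bsub>\<W>\<^esub> v l j)"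
    have vj: "v l j \<in> carrier \<W>" if "l \<in> {1..k}" for l
      using v(1)[OF that j] .
    have B: "B \<in> carrier \<W>"
      unfolding B_def using vj by (intro W.L.M.finsum_closed) auto
    have "y j = (\<Oplus>\<^bsub>\<Q>\<^esub>l\<in>{1..k}. (t l \<odot>\<^bsub>?LQ\<^esub> w l) j)"
      unfolding y_eq using j w by (intro NQ.linf_finsum_apply) auto
    also have "\<dots> = (\<Oplus>\<^bsub>\<Q>\<^esub>l\<in>{1..k}. proj (t l \<odot>\<^bsub>\<W>\<^esub> v l j))"
      using j v(2)[OF _ j] vj
      by (intro Q.M.finsum_cong') (auto simp: NQ.linf_smult_apply proj_smult proj_closed)
    also have "\<dots> = proj B"
      unfolding B_def using vj by (intro proj_finsum[symmetric]) auto
    finally have "(z \<ominus>\<^bsub>?LQ\<^esub> y) j = proj (x j \<ominus>\<^bsub>\<W>\<^esub> B)"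
      using zc yc j x[OF j] B by (simp add: NQ.linf_minus_apply proj_minus) (simp add: z_def)
    moreover have "vnorm \<Q> ((z \<ominus>\<^bsub>?LQ\<^esub> y) j) \<le> vdist ?LQ z y"
      using zc yc NQ.vnorm_apply_le[OF _ j, of "z \<ominus>\<^bsub>?LQ\<^esub> y"] by (simp add: vdist_def)
    ultimately have "vnorm \<Q> (proj (x j \<ominus>\<^bsub>\<W>\<^esub> B)) < \<delta> / 2"
      using dist by simp
    moreover have "x j \<ominus>\<^bsub>\<W>\<^esub> B \<in> carrier \<W>"
      using x[OF j] B by simp
    ultimately have "eventually (\<lambda>i. vnorm (X i) ((x j \<ominus>\<^bsub>\<W>\<^esub> B) i) < \<delta> / 2) U"
      using order_tendstoD(2)[OF vnorm_proj_tendsto] by blast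
    moreover have "(x j \<ominus>\<^bsub>\<W>\<^esub> B) i = (\<zeta> i \<ominus>\<^bsub>?L i\<^esub> ?s i) j" for i
    proof -
      have "?s i j = (\<Oplus>\<^bsub>X i\<^esub>l\<in>{1..k}. (t l \<odot>\<^bsub>?L i\<^esub> u i l) j)"
        using j uc by (intro N.linf_finsum_apply) auto
      also have "\<dots> = (\<Oplus>\<^bsub>X i\<^esub>l\<in>{1..k}. (t l \<odot>\<^bsub>\<W>\<^esub> v l j) i)"
        using j vj by (intro Xi.M.finsum_cong') (auto simp: N.linf_smult_apply u_def W_apply W_carrierD)
      also have "\<dots> = B i"
        unfolding B_def using vj by (intro W_finsum_apply[symmetric]) auto
      finally show ?thesis
        using \<zeta>[of i] s[of i] j x[OF j] B
        by (simp add: N.linf_minus_apply vball_def W_minus_apply) (simp add: x_def)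
    qed
    ultimately show ?thesis
      by simp
  qed
  have "eventually (\<lambda>i. \<forall>l\<in>{1..k}. u i l \<in> large_tuples n \<epsilon> 1 (X i)) U"
    using ev_large by (intro eventually_ball_finite) auto
  moreover have "eventually (\<lambda>i. \<forall>j\<in>{1..n}. vnorm (X i) ((\<zeta> i \<ominus>\<^bsub>?L i\<^esub> ?s i) j) < \<delta> / 2) U"
    using ev_close by (intro eventually_ball_finite) auto
  ultimately have "eventually (\<lambda>_. False) U"
    using E[of k]
  proof eventually_elim
    case (elim i)
    have M: "k < M i"
      using elim(3) by (rule M_le)
    have "?s i \<in> co (?L i) k (large_tuples n \<epsilon> 1 (X i))"
      using elim(1) uc tw sum by (intro co_memI N.L.M.abelian_monoid_axioms) auto
    \<comment> \<open>Here \<open>k < M i\<close> is used: a combination of \<open>k\<close> large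
      tuples counts among those of at most \<open>M i\<close>, from which \<open>\<zeta> i\<close>
      was chosen to be far.\<close>
    then have "?s i \<in> Cset (M i) n \<epsilon> 1 (X i)"
      using co_mono[of k "M i"] M unfolding Cset_eq by (meson less_imp_le subsetD)
    then have "vsetdist (?L i) (\<zeta> i) (Cset (M i) n \<epsilon> 1 (X i)) \<le> ennreal (vdist (?L i) (\<zeta> i) (?s i))"
      unfolding vsetdist_def by (rule INF_lower)
    also have "vdist (?L i) (\<zeta> i) (?s i) = vnorm (?L i) (\<zeta> i \<ominus>\<^bsub>?L i\<^esub> ?s i)"
      using \<zeta>[of i] s[of i] by (simp add: vdist_def vball_def)
    also have "\<dots> \<le> \<delta> / 2"
      using elim(2) by (intro N.linf_vnorm_leI) (auto intro: less_imp_le)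
    finally show False
      using far[of i] M by (simp add: ennreal_leI)
  qed
  then show False
    using nontrivial by (simp add: eventually_False)
qed

end

text \<open>Enlarging the radius enlarges the generating set and hence the hull, so distances to it
  can only decrease.\<close>

lemma Dplus_le_D:
  assumes "0 \<le> \<epsilon>"
  shows "Dplus m n \<epsilon> V \<le> D m n \<epsilon> V"
proof -
  have "Cset m n \<epsilon> 1 V \<subseteq> Cset m n \<epsilon> (1 + \<epsilon>) V"
    unfolding Cset_def co_def using assms by fastforce
  then show ?thesis
    unfolding Dgen_def vsetdist_def by (intro SUP_mono' INF_superset_mono) auto
qed

theorem theorem3p7:
  fixes X :: "'i \<Rightarrow> 'a nspace" and U :: "'i filter"
  assumes "\<And>i. real_banach_space (X i)"
    and "ultrafilter U"
    and "countably_incomplete U"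
  shows "(SD2P (ultraproduct U X) \<longleftrightarrow>
           (\<forall>n\<ge>1. \<forall>\<epsilon>>0. \<forall>\<delta>>0. \<exists>m\<ge>1. eventually (\<lambda>i. D m n \<epsilon> (X i) < ennreal \<delta>) U)) \<and>
         (SD2P (ultraproduct U X) \<longleftrightarrow>
           (\<forall>n\<ge>1. \<forall>\<epsilon>>0. \<forall>\<delta>>0. \<exists>m\<ge>1. eventually (\<lambda>i. Dplus m n \<epsilon> (X i) < ennreal \<delta>) U))"
    (is "(?SD2P \<longleftrightarrow> ?D) \<and> (_ \<longleftrightarrow> ?Dplus)")
proof -
  interpret normed_ultraproduct X U
    by (intro normed_ultraproduct.intro real_banach_space.axioms(1) assms)
  \<comment> \<open>The equivalences come from the cycle \<open>?SD2P\<close>, \<open>?D\<close>,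
    \<open>?Dplus\<close>, \<open>?SD2P\<close>; countable incompleteness enters in this first
    implication.\<close>
  have "?SD2P \<Longrightarrow> ?D"
    using SD2P_ultraproduct_imp_D assms(3) by blast
  moreover have ?Dplus if D: ?D
  proof (intro allI impI)
    fix n :: nat and \<epsilon> \<delta> :: real assume "1 \<le> n" "0 < \<epsilon>" "0 < \<delta>"
    then obtain m where "1 \<le> m" and m: "eventually (\<lambda>i. D m n \<epsilon> (X i) < ennreal \<delta>) U"
      using D by meson
    from m have "eventually (\<lambda>i. Dplus m n \<epsilon> (X i) < ennreal \<delta>) U"
      by (rule eventually_mono) (rule le_less_trans[OF Dplus_le_D[OF less_imp_le[OF \<open>0 < \<epsilon>\<close>]]])
    then show "\<exists>m\<ge>1. eventually (\<lambda>i. Dplus m n \<epsilon> (X i) < ennreal \<delta>) U"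
      using \<open>1 \<le> m\<close> by blast
  qed
  moreover have ?SD2P if ?Dplus
  proof (rule Q.dense_imp_SD2P, rule approximable_ultraproduct)
    fix n :: nat and \<epsilon> \<delta> :: real assume "1 \<le> n" "0 < \<epsilon>" "0 < \<delta>"
    then show "\<exists>m. eventually (\<lambda>i. Dplus m n \<epsilon> (X i) < ennreal \<delta>) U"
      using that by blast
  qed
  ultimately show ?thesis
    by blast
qed

end
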